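(* For any abelian group $\Lambda$, the formula $$\Delta(D)=\sum_{C\subset\mathcal{C}(D)}(-1)^{k_C(D)}\,q_C(D)\otimes r_C(D),$$ for $D$ a $\Lambda$-decorated dissection diagram, extended to $\Delta:\mathcal{D}(\Lambda)\to\mathcal{D}(\Lambda)\otimes\mathcal{D}(\Lambda)$ as a morphism of algebras, gives $\mathcal{D}(\Lambda)$ the structure of a graded connected commutative Hopf algebra. Moreover, for any morphism $\Lambda\to\Lambda'$ of abelian groups, the corresponding morphism $\mathcal{D}(\Lambda)\to\mathcal{D}(\Lambda')$ (applying $\Lambda\to\Lambda'$ to all decorations) is a morphism of Hopf algebras. In other words, $\Lambda\mapsto\mathcal{D}(\Lambda)$ is a functor from the category of abelian groups to the category of Hopf algebras.
   Context: For $n\ge 0$, $\Pi_n$ is an oriented polygon (drawn as a circle, so that $\Pi_0,\Pi_1$ make sense) with $n+1$ vertices, one of which is called the root; the others are labelled $1,\dots,n$ following the orientation, $1$ being just after the root. Its $n+1$ sides (arcs between consecutive vertices, directed following the orientation) are labelled $0,\dots,n$: side $0$ (the root side) leaves the root and side $i$ leaves vertex $i$ for $1\le i\le n$. Write $\mathcal{S}=\{0,\dots,n\}$, $\mathcal{S}^+=\{1,\dots,n\}$. A chord is a straight line between two distinct vertices (never identified with a side). A dissection diagram $D$ of degree $n$ is a set of $n$ chords of $\Pi_n$ not crossing each other (common endpoints allowed) such that the graph formed by the chords is acyclic; it is then a spanning tree on the vertices. Chords are directed towards the root, and the chord leaving vertex $i$ is labelled $i$, so the set of chords is $\mathcal{C}(D)=\{1,\dots,n\}$.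 $\Gamma(D)$ is the directed graph on the vertices of $\Pi_n$ whose $2n+1$ edges are the sides and the chords. A $\Lambda$-decorated dissection diagram is a dissection diagram with an element of $\Lambda$ attached to each edge of $\Gamma(D)$. Rules for decorations: flipping the direction of an edge multiplies its decoration by $-1$; contracting an edge $v_-\to v_+$ with decoration $\alpha$ adds $\alpha$ to the decorations of the other edges going to $v_-$, subtracts $\alpha$ from those of the other edges leaving $v_-$, and leaves the other decorations unchanged. $\mathcal{D}(\Lambda)$ is the free commutative unital $\mathbb{Q}$-algebra on the set of $\Lambda$-decorated dissection diagrams of positive degree, graded by the degree; diagrams of degree $0$ are identified with $1$. Let $C\subset\mathcal{C}(D)$, $\overline{C}=\mathcal{C}(D)\setminus C$. The planar graph formed by $C$ and all sides has $|C|+1$ faces $\alpha$, each the interior of a polygon $\widetilde{\Pi}(\alpha)$. Let $\mathcal{S}_C(\alpha)$ be the (nonempty) set of sides of $\Pi_n$ bounding $\alpha$, $\overline{C}(\alpha)$ the set of chords of $\overline{C}$ inside $\widetilde{\Pi}(\alpha)$, $\mathcal{S}_C^+(\alpha)=\mathcal{S}_C(\alpha)\setminus\{\min\mathcal{S}_C(\alpha)\}$ and $\mathcal{S}_C^+=\bigsqcup_\alpha\mathcal{S}_C^+(\alpha)$. The decorated dissection diagram $q_C^\alpha(D)$ is obtained by contracting all chords of $C$ and keeping the sides $\mathcal{S}_C(\alpha)$ and the chords $\overline{C}(\alpha)$; its root side is $\min\mathcal{S}_C(\alpha)$ and its root is the starting vertex of that side; its degree is $|\overline{C}(\alpha)|$.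 Put $q_C(D)=\prod_\alpha q_C^\alpha(D)$. The decorated dissection diagram $r_C(D)$ of degree $|C|$ is obtained by deleting the chords not in $C$, contracting the sides in $\mathcal{S}_C^+$, and then flipping chords so that they all point towards the root (the image of the root of $D$); $k_C(D)$ is the number of chords of $C$ that must be flipped.
   Formalization: With plain decorations coassociativity fails (degree 3, chords 1→0, 2→1, 3→1), so decorations are taken up to translation at vertices (add φ(target)−φ(source) to each edge), and D(Λ) is generated by these classes of decorated dissection diagrams. *)

theory Defs
  imports Complex_Main "HOL-Library.Multiset" "HOL-Library.Poly_Mapping" "HOL-Library.Product_Plus"
begin

section \<open>Hopf algebras on monoid algebras\<close>

text \<open>
  All algebras below are monoid algebras \<open>'a \<Rightarrow>\<^sub>0 rat\<close>, with the convolution product of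
  \<^theory>\<open>HOL-Library.Poly_Mapping\<close>.  For \<open>'a = 'x multiset\<close> this is the free commutative
  unital algebra (polynomial algebra) on the set \<open>'x\<close>.
\<close>

definition qscale :: "rat \<Rightarrow> ('a \<Rightarrow>\<^sub>0 rat) \<Rightarrow> ('a \<Rightarrow>\<^sub>0 rat)" where
  "qscale c = Poly_Mapping.map ((*) c)"

lemma lookup_qscale [simp]: "Poly_Mapping.lookup (qscale c x) k = c * Poly_Mapping.lookup x k"
  unfolding qscale_def by (simp add: Poly_Mapping.map.rep_eq when_def)

lemma vector_space_qscale: "vector_space qscale"
  by unfold_locales (auto intro!: poly_mapping_eqI simp: lookup_add algebra_simps)

lemma module_qscale: "module qscale"
  by unfold_locales (auto intro!: poly_mapping_eqI simp: lookup_add algebra_simps)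

lemma linear_qscale_iff:
  "Vector_Spaces.linear qscale qscale f \<longleftrightarrow>
    (\<forall>x y. f (x + y) = f x + f y) \<and> (\<forall>c x. f (qscale c x) = qscale c (f x))"
  by (simp add: Vector_Spaces.linear_def module_hom_def module_hom_axioms_def
        vector_space_qscale module_qscale)

lemma poly_mapping_expansion:
  "x = (\<Sum>k\<in>Poly_Mapping.keys x. qscale (Poly_Mapping.lookup x k) (Poly_Mapping.single k 1))"
proof (rule poly_mapping_eqI)
  fix k
  have "Poly_Mapping.lookup (\<Sum>k\<in>Poly_Mapping.keys x. qscale (Poly_Mapping.lookup x k) (Poly_Mapping.single k 1)) k =
      (\<Sum>j\<in>Poly_Mapping.keys x. if j = k then Poly_Mapping.lookup x j else 0)"
    unfolding lookup_sum by (rule sum.cong) (auto simp: lookup_single when_def)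
  also have "\<dots> = Poly_Mapping.lookup x k"
    by (simp add: in_keys_iff)
  finally show "Poly_Mapping.lookup x k =
      Poly_Mapping.lookup (\<Sum>k\<in>Poly_Mapping.keys x. qscale (Poly_Mapping.lookup x k) (Poly_Mapping.single k 1)) k" ..
qed

text \<open>
  The tensor product of the free modules with bases \<open>'a\<close> and \<open>'b\<close> is the free module with
  basis \<open>'a \<times> 'b\<close>; its product as a monoid algebra is the usual
  \<open>(a \<otimes> b) (a' \<otimes> b') = a a' \<otimes> b b'\<close>.
\<close>

lift_definition tensor ::
  "('a \<Rightarrow>\<^sub>0 rat) \<Rightarrow> ('b \<Rightarrow>\<^sub>0 rat) \<Rightarrow> ('a \<times> 'b \<Rightarrow>\<^sub>0 rat)" (infixr \<open>\<otimes>\<close> 75)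
  is "\<lambda>f g (a, b). f a * g b"
proof -
  fix f :: "'a \<Rightarrow> rat" and g :: "'b \<Rightarrow> rat"
  assume "finite {a. f a \<noteq> 0}" "finite {b. g b \<noteq> 0}"
  then have "finite ({a. f a \<noteq> 0} \<times> {b. g b \<noteq> 0})" by simp
  moreover have "{p. (case p of (a, b) \<Rightarrow> f a * g b) \<noteq> 0} \<subseteq> {a. f a \<noteq> 0} \<times> {b. g b \<noteq> 0}"
    by auto
  ultimately show "finite {p. (case p of (a, b) \<Rightarrow> f a * g b) \<noteq> 0}"
    using finite_subset by blast
qed

lemma lookup_tensor [simp]: "Poly_Mapping.lookup (x \<otimes> y) (a, b) = Poly_Mapping.lookup x a * Poly_Mapping.lookup y b"
  by (simp add: tensor.rep_eq)

definition tensor_lift ::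
  "(('a \<Rightarrow>\<^sub>0 rat) \<Rightarrow> ('b \<Rightarrow>\<^sub>0 rat) \<Rightarrow> ('c \<Rightarrow>\<^sub>0 rat)) \<Rightarrow> ('a \<times> 'b \<Rightarrow>\<^sub>0 rat) \<Rightarrow> ('c \<Rightarrow>\<^sub>0 rat)" where
  "tensor_lift \<beta> t =
    (\<Sum>(a, b)\<in>Poly_Mapping.keys t. qscale (Poly_Mapping.lookup t (a, b)) (\<beta> (Poly_Mapping.single a 1) (Poly_Mapping.single b 1)))"

definition tensor_map ::
  "(('a \<Rightarrow>\<^sub>0 rat) \<Rightarrow> ('c \<Rightarrow>\<^sub>0 rat)) \<Rightarrow> (('b \<Rightarrow>\<^sub>0 rat) \<Rightarrow> ('d \<Rightarrow>\<^sub>0 rat)) \<Rightarrow>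
    ('a \<times> 'b \<Rightarrow>\<^sub>0 rat) \<Rightarrow> ('c \<times> 'd \<Rightarrow>\<^sub>0 rat)" where
  "tensor_map f g = tensor_lift (\<lambda>x y. f x \<otimes> g y)"

definition tensor_assoc :: "(('a \<times> 'b) \<times> 'c \<Rightarrow>\<^sub>0 rat) \<Rightarrow> ('a \<times> 'b \<times> 'c \<Rightarrow>\<^sub>0 rat)" where
  "tensor_assoc = tensor_lift (\<lambda>xy z. tensor_lift (\<lambda>x y. x \<otimes> (y \<otimes> z)) xy)"

definition bilinear_map ::
  "(('a \<Rightarrow>\<^sub>0 rat) \<Rightarrow> ('b \<Rightarrow>\<^sub>0 rat) \<Rightarrow> ('c \<Rightarrow>\<^sub>0 rat)) \<Rightarrow> bool" where
  "bilinear_map \<beta> \<longleftrightarrow>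
    (\<forall>x. Vector_Spaces.linear qscale qscale (\<beta> x)) \<and>
    (\<forall>y. Vector_Spaces.linear qscale qscale (\<lambda>x. \<beta> x y))"

lemma bilinear_tensor: "bilinear_map (\<otimes>)"
  unfolding bilinear_map_def linear_qscale_iff
  by (auto intro!: poly_mapping_eqI simp: lookup_add algebra_simps)

lemma tensor_single:
  "Poly_Mapping.single a c \<otimes> Poly_Mapping.single b d = Poly_Mapping.single (a, b) (c * d)"
  by (rule poly_mapping_eqI) (auto simp: lookup_single when_def split: if_splits)

lemma linear_basis_expansion:
  assumes "Vector_Spaces.linear qscale qscale f"
  shows "f x = (\<Sum>k\<in>Poly_Mapping.keys x. qscale (Poly_Mapping.lookup x k) (f (Poly_Mapping.single k 1)))"
proof -
  interpret f: Vector_Spaces.linear qscale qscale f by fact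
  show ?thesis
    by (subst poly_mapping_expansion[of x]) (simp add: f.sum f.scale)
qed

lemma sum_qscale_extend:
  assumes "finite B" "Poly_Mapping.keys t \<subseteq> B"
  shows "(\<Sum>k\<in>Poly_Mapping.keys t. qscale (Poly_Mapping.lookup t k) (g k)) = (\<Sum>k\<in>B. qscale (Poly_Mapping.lookup t k) (g k))"
  by (rule sum.mono_neutral_left)
    (use assms in \<open>auto intro!: poly_mapping_eqI simp: in_keys_iff\<close>)

lemma linear_basis_lift:
  "Vector_Spaces.linear qscale qscale (\<lambda>t. \<Sum>k\<in>Poly_Mapping.keys t. qscale (Poly_Mapping.lookup t k) (g k))"
proof -
  let ?F = "\<lambda>t. \<Sum>k\<in>Poly_Mapping.keys t. qscale (Poly_Mapping.lookup t k) (g k)"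
  interpret vector_space qscale by (rule vector_space_qscale)
  have "?F (s + t) = ?F s + ?F t" for s t
  proof -
    let ?B = "Poly_Mapping.keys s \<union> Poly_Mapping.keys t"
    have "?F (s + t) = (\<Sum>k\<in>?B. qscale (Poly_Mapping.lookup (s + t) k) (g k))"
      by (rule sum_qscale_extend) (use Poly_Mapping.keys_add[of s t] in auto)
    also have "\<dots> = (\<Sum>k\<in>?B. qscale (Poly_Mapping.lookup s k) (g k)) + (\<Sum>k\<in>?B. qscale (Poly_Mapping.lookup t k) (g k))"
      by (simp add: lookup_add scale_left_distrib sum.distrib)
    also have "\<dots> = ?F s + ?F t"
      using sum_qscale_extend[of ?B s g] sum_qscale_extend[of ?B t g] by simp
    finally show ?thesis .
  qed
  moreover have "?F (qscale c t) = qscale c (?F t)" for c t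
  proof -
    have "?F (qscale c t) = (\<Sum>k\<in>Poly_Mapping.keys t. qscale (Poly_Mapping.lookup (qscale c t) k) (g k))"
      by (rule sum_qscale_extend) (auto simp: in_keys_iff)
    then show ?thesis by (simp add: scale_sum_right)
  qed
  ultimately show ?thesis unfolding linear_qscale_iff by blast
qed

text \<open>The universal property of the tensor product.\<close>

lemma tensor_universal:
  assumes "bilinear_map \<beta>"
  shows "\<exists>!L. Vector_Spaces.linear qscale qscale L \<and> (\<forall>x y. L (x \<otimes> y) = \<beta> x y)"
    and "Vector_Spaces.linear qscale qscale (tensor_lift \<beta>)"
    and "tensor_lift \<beta> (x \<otimes> y) = \<beta> x y"
proof -
  have lin1: "Vector_Spaces.linear qscale qscale (\<lambda>x. \<beta> x y)" for y
    using assms by (simp add: bilinear_map_def)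
  have lin2: "Vector_Spaces.linear qscale qscale (\<beta> x)" for x
    using assms by (simp add: bilinear_map_def)
  have tl: "tensor_lift \<beta> =
      (\<lambda>t. \<Sum>k\<in>Poly_Mapping.keys t. qscale (Poly_Mapping.lookup t k) (\<beta> (Poly_Mapping.single (fst k) 1) (Poly_Mapping.single (snd k) 1)))"
    by (rule ext) (simp add: tensor_lift_def case_prod_unfold)
  show lin: "Vector_Spaces.linear qscale qscale (tensor_lift \<beta>)"
    unfolding tl by (rule linear_basis_lift)
  interpret vector_space qscale by (rule vector_space_qscale)
  have ev: "tensor_lift \<beta> (x \<otimes> y) = \<beta> x y" for x y
  proof -
    have "tensor_lift \<beta> (x \<otimes> y) = (\<Sum>k\<in>Poly_Mapping.keys x \<times> Poly_Mapping.keys y. qscale (Poly_Mapping.lookup (x \<otimes> y) k)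
        (\<beta> (Poly_Mapping.single (fst k) 1) (Poly_Mapping.single (snd k) 1)))"
      unfolding tl by (rule sum_qscale_extend) (auto simp: in_keys_iff)
    also have "\<dots> = (\<Sum>a\<in>Poly_Mapping.keys x. \<Sum>b\<in>Poly_Mapping.keys y. qscale (Poly_Mapping.lookup x a)
        (qscale (Poly_Mapping.lookup y b) (\<beta> (Poly_Mapping.single a 1) (Poly_Mapping.single b 1))))"
      unfolding sum.cartesian_product by (rule sum.cong) auto
    also have "\<dots> = (\<Sum>a\<in>Poly_Mapping.keys x. qscale (Poly_Mapping.lookup x a) (\<beta> (Poly_Mapping.single a 1) y))"
      by (simp add: linear_basis_expansion[OF lin2, of _ y] scale_sum_right)
    also have "\<dots> = \<beta> x y"
      by (simp add: linear_basis_expansion[OF lin1, of x])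
    finally show ?thesis .
  qed
  show "tensor_lift \<beta> (x \<otimes> y) = \<beta> x y" by (rule ev)
  show "\<exists>!L. Vector_Spaces.linear qscale qscale L \<and> (\<forall>x y. L (x \<otimes> y) = \<beta> x y)"
  proof (rule ex1I)
    show "Vector_Spaces.linear qscale qscale (tensor_lift \<beta>) \<and> (\<forall>x y. tensor_lift \<beta> (x \<otimes> y) = \<beta> x y)"
      using lin ev by blast
  next
    fix L assume L: "Vector_Spaces.linear qscale qscale L \<and> (\<forall>x y. L (x \<otimes> y) = \<beta> x y)"
    have "L (Poly_Mapping.single k 1) = \<beta> (Poly_Mapping.single (fst k) 1) (Poly_Mapping.single (snd k) 1)" for k
      using L tensor_single[of "fst k" 1 "snd k" 1] by (metis mult_1 prod.collapse)
    then have "L t = tensor_lift \<beta> t" for t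
      by (subst linear_basis_expansion[of L]) (use L in \<open>simp_all add: tl\<close>)
    then show "L = tensor_lift \<beta>" by blast
  qed
qed

definition algebra_hom ::
  "(rat \<Rightarrow> 'a \<Rightarrow> 'a) \<Rightarrow> (rat \<Rightarrow> 'b \<Rightarrow> 'b) \<Rightarrow> ('a::ring_1 \<Rightarrow> 'b::ring_1) \<Rightarrow> bool" where
  "algebra_hom s1 s2 f \<longleftrightarrow>
    Vector_Spaces.linear s1 s2 f \<and> f 1 = 1 \<and> (\<forall>x y. f (x * y) = f x * f y)"

definition hopf_algebra ::
  "(('a::monoid_add \<Rightarrow>\<^sub>0 rat) \<Rightarrow> ('a \<times> 'a \<Rightarrow>\<^sub>0 rat)) \<Rightarrow> (('a \<Rightarrow>\<^sub>0 rat) \<Rightarrow> rat) \<Rightarrow>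
    (('a \<Rightarrow>\<^sub>0 rat) \<Rightarrow> ('a \<Rightarrow>\<^sub>0 rat)) \<Rightarrow> bool" where
  "hopf_algebra \<Delta> \<epsilon> S \<longleftrightarrow>
    algebra_hom qscale qscale \<Delta> \<and>
    algebra_hom qscale (*) \<epsilon> \<and>
    Vector_Spaces.linear qscale qscale S \<and>
    (\<forall>x. tensor_assoc (tensor_map \<Delta> id (\<Delta> x)) = tensor_map id \<Delta> (\<Delta> x)) \<and>
    (\<forall>x. tensor_lift (\<lambda>a b. qscale (\<epsilon> a) b) (\<Delta> x) = x) \<and>
    (\<forall>x. tensor_lift (\<lambda>a b. qscale (\<epsilon> b) a) (\<Delta> x) = x) \<and>
    (\<forall>x. tensor_lift (\<lambda>a b. S a * b) (\<Delta> x) = qscale (\<epsilon> x) 1) \<and>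
    (\<forall>x. tensor_lift (\<lambda>a b. a * S b) (\<Delta> x) = qscale (\<epsilon> x) 1)"

definition hopf_hom ::
  "(('a::monoid_add \<Rightarrow>\<^sub>0 rat) \<Rightarrow> ('a \<times> 'a \<Rightarrow>\<^sub>0 rat)) \<Rightarrow> (('a \<Rightarrow>\<^sub>0 rat) \<Rightarrow> rat) \<Rightarrow>
    (('a \<Rightarrow>\<^sub>0 rat) \<Rightarrow> ('a \<Rightarrow>\<^sub>0 rat)) \<Rightarrow>
   (('b::monoid_add \<Rightarrow>\<^sub>0 rat) \<Rightarrow> ('b \<times> 'b \<Rightarrow>\<^sub>0 rat)) \<Rightarrow> (('b \<Rightarrow>\<^sub>0 rat) \<Rightarrow> rat) \<Rightarrow>
    (('b \<Rightarrow>\<^sub>0 rat) \<Rightarrow> ('b \<Rightarrow>\<^sub>0 rat)) \<Rightarrow>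
   (('a \<Rightarrow>\<^sub>0 rat) \<Rightarrow> ('b \<Rightarrow>\<^sub>0 rat)) \<Rightarrow> bool" where
  "hopf_hom \<Delta> \<epsilon> S \<Delta>' \<epsilon>' S' f \<longleftrightarrow>
    algebra_hom qscale qscale f \<and>
    (\<forall>x. \<Delta>' (f x) = tensor_map f f (\<Delta> x)) \<and>
    (\<forall>x. \<epsilon>' (f x) = \<epsilon> x) \<and>
    (\<forall>x. S' (f x) = f (S x))"

definition direct_sum_decomposition :: "(nat \<Rightarrow> ('a \<Rightarrow>\<^sub>0 rat) set) \<Rightarrow> bool" where
  "direct_sum_decomposition A \<longleftrightarrow>
    (\<forall>n. module.subspace qscale (A n)) \<and>
    (\<forall>x. \<exists>!f. (\<forall>n. f n \<in> A n) \<and> finite {n. f n \<noteq> 0} \<and> x = (\<Sum>n | f n \<noteq> 0. f n))"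

definition tensor_degree ::
  "(nat \<Rightarrow> ('a \<Rightarrow>\<^sub>0 rat) set) \<Rightarrow> nat \<Rightarrow> ('a \<times> 'a \<Rightarrow>\<^sub>0 rat) set" where
  "tensor_degree A n = module.span qscale {x \<otimes> y | x y i j. x \<in> A i \<and> y \<in> A j \<and> i + j = n}"

definition graded_hopf_algebra ::
  "(nat \<Rightarrow> ('a::monoid_add \<Rightarrow>\<^sub>0 rat) set) \<Rightarrow> (('a \<Rightarrow>\<^sub>0 rat) \<Rightarrow> ('a \<times> 'a \<Rightarrow>\<^sub>0 rat)) \<Rightarrow>
    (('a \<Rightarrow>\<^sub>0 rat) \<Rightarrow> rat) \<Rightarrow> (('a \<Rightarrow>\<^sub>0 rat) \<Rightarrow> ('a \<Rightarrow>\<^sub>0 rat)) \<Rightarrow> bool" where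
  "graded_hopf_algebra A \<Delta> \<epsilon> S \<longleftrightarrow>
    hopf_algebra \<Delta> \<epsilon> S \<and>
    direct_sum_decomposition A \<and>
    1 \<in> A 0 \<and>
    (\<forall>m n. \<forall>x\<in>A m. \<forall>y\<in>A n. x * y \<in> A (m + n)) \<and>
    (\<forall>n. \<forall>x\<in>A n. \<Delta> x \<in> tensor_degree A n) \<and>
    (\<forall>n>0. \<forall>x\<in>A n. \<epsilon> x = 0) \<and>
    (\<forall>n. \<forall>x\<in>A n. S x \<in> A n)"

definition graded_connected_commutative_hopf_algebra ::
  "(nat \<Rightarrow> ('a::monoid_add \<Rightarrow>\<^sub>0 rat) set) \<Rightarrow> (('a \<Rightarrow>\<^sub>0 rat) \<Rightarrow> ('a \<times> 'a \<Rightarrow>\<^sub>0 rat)) \<Rightarrow>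
    (('a \<Rightarrow>\<^sub>0 rat) \<Rightarrow> rat) \<Rightarrow> (('a \<Rightarrow>\<^sub>0 rat) \<Rightarrow> ('a \<Rightarrow>\<^sub>0 rat)) \<Rightarrow> bool" where
  "graded_connected_commutative_hopf_algebra A \<Delta> \<epsilon> S \<longleftrightarrow>
    graded_hopf_algebra A \<Delta> \<epsilon> S \<and>
    A 0 = {qscale c 1 | c. True} \<and>
    (\<forall>x y :: 'a \<Rightarrow>\<^sub>0 rat. x * y = y * x)"

text \<open>The algebra morphism out of a free commutative algebra with given values on the generators.\<close>

definition free_ext :: "('x \<Rightarrow> ('a::comm_monoid_add \<Rightarrow>\<^sub>0 rat)) \<Rightarrow> ('x multiset \<Rightarrow>\<^sub>0 rat) \<Rightarrow> ('a \<Rightarrow>\<^sub>0 rat)" where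
  "free_ext f p = (\<Sum>m\<in>Poly_Mapping.keys p. qscale (Poly_Mapping.lookup p m) (\<Prod>x\<in>#m. f x))"


section \<open>Decorated dissection diagrams\<close>

datatype edge = Side nat | Chord nat

record 'l graph =
  edges :: "edge set"
  src :: "edge \<Rightarrow> nat"
  tgt :: "edge \<Rightarrow> nat"
  dec :: "edge \<Rightarrow> 'l"

text \<open>The vertex resulting from the contraction of an edge keeps the name of its target.\<close>

definition contract :: "edge \<Rightarrow> 'l::ab_group_add graph \<Rightarrow> 'l graph" where
  "contract e G =
    \<lparr>edges = edges G - {e},
     src = (\<lambda>f. if src G f = src G e then tgt G e else src G f),
     tgt = (\<lambda>f. if tgt G f = src G e then tgt G e else tgt G f),
     dec = (\<lambda>f. dec G f + (if tgt G f = src G e then dec G e else 0)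
                        - (if src G f = src G e then dec G e else 0))\<rparr>"

definition flip_edges :: "edge set \<Rightarrow> 'l::ab_group_add graph \<Rightarrow> 'l graph" where
  "flip_edges F G =
    G\<lparr>src := (\<lambda>e. if e \<in> F then tgt G e else src G e),
      tgt := (\<lambda>e. if e \<in> F then src G e else tgt G e),
      dec := (\<lambda>e. if e \<in> F then - dec G e else dec G e)\<rparr>"

definition keep_edges :: "edge set \<Rightarrow> 'l graph \<Rightarrow> 'l graph" where
  "keep_edges F G = G\<lparr>edges := edges G \<inter> F\<rparr>"

definition joined :: "nat set set \<Rightarrow> nat \<Rightarrow> nat \<Rightarrow> bool" where
  "joined K u v \<longleftrightarrow> (u, v) \<in> {(x, y). {x, y} \<in> K}\<^sup>*"

definition acyclic_chords :: "nat set set \<Rightarrow> bool" where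
  "acyclic_chords K \<longleftrightarrow>
    \<not> (\<exists>vs. 3 \<le> length vs \<and> distinct vs \<and>
          (\<forall>i<length vs. {vs ! i, vs ! (Suc i mod length vs)} \<in> K))"

definition crossing :: "nat set \<Rightarrow> nat set \<Rightarrow> bool" where
  "crossing c d \<longleftrightarrow> Min c < Min d \<and> Min d < Max c \<and> Max c < Max d"

text \<open>
  The vertices of the polygon are \<open>0, \<dots>, deg D\<close>, with root \<open>0\<close>.  The values of \<open>deco D\<close>
  outside the edges of the graph of \<open>D\<close> are irrelevant.
\<close>

record 'l diagram =
  deg :: nat
  chords :: "nat set set"
  deco :: "edge \<Rightarrow> 'l"

definition dissection_diagram :: "'l diagram \<Rightarrow> bool" where
  "dissection_diagram D \<longleftrightarrow>
    chords D \<subseteq> {{i, j} | i j. i \<le> deg D \<and> j \<le> deg D \<and> i \<noteq> j} \<and>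
    card (chords D) = deg D \<and>
    (\<forall>c\<in>chords D. \<forall>d\<in>chords D. \<not> crossing c d) \<and>
    acyclic_chords (chords D)"

text \<open>
  In a tree, a chord is directed towards the root from \<open>i\<close> to \<open>j\<close> iff \<open>j\<close> is still joined to
  the root after removing that chord.
\<close>

definition parent :: "'l diagram \<Rightarrow> nat \<Rightarrow> nat" where
  "parent D i = (THE j. {i, j} \<in> chords D \<and> joined (chords D - {{i, j}}) j 0)"

definition chord :: "'l diagram \<Rightarrow> nat \<Rightarrow> nat set" where
  "chord D i = {i, parent D i}"

definition diagram_graph :: "'l diagram \<Rightarrow> 'l graph" where
  "diagram_graph D =
    \<lparr>edges = Side ` {0..deg D} \<union> Chord ` {1..deg D},
     src = (\<lambda>e. case e of Side i \<Rightarrow> i | Chord i \<Rightarrow> i),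
     tgt = (\<lambda>e. case e of Side i \<Rightarrow> (i + 1) mod (deg D + 1) | Chord i \<Rightarrow> parent D i),
     dec = deco D\<rparr>"

definition map_deco :: "('l \<Rightarrow> 'm) \<Rightarrow> 'l diagram \<Rightarrow> 'm diagram" where
  "map_deco h D = \<lparr>deg = deg D, chords = chords D, deco = h \<circ> deco D\<rparr>"

text \<open>
  Conversely, a graph whose sides form one polygon is turned into a diagram by renumbering:
  the sides are renumbered in increasing order, the vertices like the sides starting there
  (so that the root side is the least side), the chords like the vertices they leave.
\<close>

definition graph_sides :: "'l graph \<Rightarrow> nat list" where
  "graph_sides G = sorted_list_of_set {i. Side i \<in> edges G}"

definition vertex_number :: "'l graph \<Rightarrow> nat \<Rightarrow> nat" where
  "vertex_number G v = (THE k. k < length (graph_sides G) \<and> src G (Side (graph_sides G ! k)) = v)"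

definition graph_diagram :: "'l graph \<Rightarrow> 'l diagram" where
  "graph_diagram G = (let K = {i. Chord i \<in> edges G} in
    \<lparr>deg = card K,
     chords = (\<lambda>i. {vertex_number G (src G (Chord i)), vertex_number G (tgt G (Chord i))}) ` K,
     deco = (\<lambda>e. case e of
         Side k \<Rightarrow> dec G (Side (graph_sides G ! k))
       | Chord k \<Rightarrow> dec G (Chord (THE i. i \<in> K \<and> vertex_number G (src G (Chord i)) = k)))\<rparr>)"

definition points_to_root :: "'l graph \<Rightarrow> nat \<Rightarrow> bool" where
  "points_to_root G i \<longleftrightarrow>
    joined ((\<lambda>j. {src G (Chord j), tgt G (Chord j)}) ` ({j. Chord j \<in> edges G} - {i}))
      (tgt G (Chord i)) (src G (Side 0))"


subsection \<open>Faces\<close>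

text \<open>
  A chord \<open>c\<close> cuts the polygon into two halves, the sides in \<open>arc c\<close> and the other ones.  A
  face of the planar graph formed by the sides and the chords in \<open>C\<close> is a region of the
  polygon not cut by any of these chords; it is represented by the set of sides bounding it,
  and two sides bound the same face iff no chord of \<open>C\<close> separates them.
\<close>

definition arc :: "nat set \<Rightarrow> nat set" where
  "arc c = {Min c..<Max c}"

definition faces :: "'l diagram \<Rightarrow> nat set \<Rightarrow> nat set set" where
  "faces D C = {0..deg D} //
    {(s, t). s \<in> {0..deg D} \<and> t \<in> {0..deg D} \<and> (\<forall>i\<in>C. s \<in> arc (chord D i) \<longleftrightarrow> t \<in> arc (chord D i))}"

text \<open>Vertices (ends of \<open>c\<close> included) of the half of the polygon cut by \<open>c\<close> that contains side \<open>s\<close>.\<close>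

definition half_polygon :: "nat \<Rightarrow> nat set \<Rightarrow> nat \<Rightarrow> nat set" where
  "half_polygon n c s = (if s \<in> arc c then {Min c..Max c} else {0..Min c} \<union> {Max c..n})"

definition face_vertices :: "'l diagram \<Rightarrow> nat set \<Rightarrow> nat set \<Rightarrow> nat set" where
  "face_vertices D C \<alpha> = {v \<in> {0..deg D}. \<forall>i\<in>C. \<forall>s\<in>\<alpha>. v \<in> half_polygon (deg D) (chord D i) s}"

definition inner_chords :: "'l diagram \<Rightarrow> nat set \<Rightarrow> nat set \<Rightarrow> nat set" where
  "inner_chords D C \<alpha> = {j \<in> {1..deg D} - C. chord D j \<subseteq> face_vertices D C \<alpha>}"

definition plus_sides :: "'l diagram \<Rightarrow> nat set \<Rightarrow> nat set" where
  "plus_sides D C = (\<Union>\<alpha>\<in>faces D C. \<alpha> - {Min \<alpha>})"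


subsection \<open>The operations on diagrams\<close>

text \<open>
  The edges contracted below form a forest in which at most one edge leaves each vertex, and
  then the result of the contractions does not depend on their order.
\<close>

definition q_face :: "'l::ab_group_add diagram \<Rightarrow> nat set \<Rightarrow> nat set \<Rightarrow> 'l diagram" where
  "q_face D C \<alpha> = graph_diagram (keep_edges (Side ` \<alpha> \<union> Chord ` inner_chords D C \<alpha>)
    (fold contract (map Chord (sorted_list_of_set C)) (diagram_graph D)))"

definition r_graph :: "'l::ab_group_add diagram \<Rightarrow> nat set \<Rightarrow> 'l graph" where
  "r_graph D C = fold contract (map Side (sorted_list_of_set (plus_sides D C)))
    (keep_edges (Side ` {0..deg D} \<union> Chord ` C) (diagram_graph D))"

definition flipped_chords :: "'l::ab_group_add diagram \<Rightarrow> nat set \<Rightarrow> nat set" where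
  "flipped_chords D C = {i \<in> C. \<not> points_to_root (r_graph D C) i}"

definition r_diag :: "'l::ab_group_add diagram \<Rightarrow> nat set \<Rightarrow> 'l diagram" where
  "r_diag D C = graph_diagram (flip_edges (Chord ` flipped_chords D C) (r_graph D C))"

definition k_num :: "'l::ab_group_add diagram \<Rightarrow> nat set \<Rightarrow> nat" where
  "k_num D C = card (flipped_chords D C)"


section \<open>The algebra of decorated dissection diagrams\<close>

text \<open>
  Contracting an edge \<open>v \<rightarrow> w\<close> decorated by \<open>a\<close>, or first flipping it and then contracting the
  edge \<open>w \<rightarrow> v\<close> decorated by \<open>- a\<close>, gives decorations which differ by a translation at the
  resulting vertex: \<open>a\<close> is added to the edges going to that vertex and subtracted from those
  leaving it.  The rules for flipping and contracting are thus compatible only if decorations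
  are considered up to translations at the vertices, and this is the convention used here.

  The convention is necessary.  Let \<open>D\<close> be of degree 3 with chords \<open>1 \<rightarrow> 0\<close>, \<open>2 \<rightarrow> 1\<close>, \<open>3 \<rightarrow> 1\<close>,
  chord \<open>i\<close> being decorated by \<open>c\<^sub>i\<close> and side \<open>i\<close> by \<open>s\<^sub>i\<close>, and write \<open>[a, b; c]\<close> for the diagram
  of degree 1 with sides \<open>a\<close>, \<open>b\<close> and chord \<open>c\<close>.  With \<open>C = {3}\<close>, \<open>(\<Delta> \<otimes> id) (\<Delta> D)\<close> contains the
  term \<open>[s\<^sub>1, s\<^sub>2 + c\<^sub>3; c\<^sub>2] \<otimes> [s\<^sub>0, s\<^sub>3 - c\<^sub>3; c\<^sub>1] \<otimes> [s\<^sub>0, s\<^sub>1 + s\<^sub>2 + s\<^sub>3; s\<^sub>3 - c\<^sub>3]\<close>, whereas the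
  corresponding term of \<open>(id \<otimes> \<Delta>) (\<Delta> D)\<close> comes from \<open>C = {1, 3}\<close> and has first factor
  \<open>[s\<^sub>1 - c\<^sub>1, s\<^sub>2 + c\<^sub>3 + c\<^sub>1; c\<^sub>2 + c\<^sub>1]\<close>, its translate by \<open>c\<^sub>1\<close> at the root.
\<close>

definition translation_rel :: "'l::ab_group_add diagram \<Rightarrow> 'l diagram \<Rightarrow> bool" where
  "translation_rel D D' \<longleftrightarrow>
    dissection_diagram D \<and> dissection_diagram D' \<and>
    deg D = deg D' \<and> chords D = chords D' \<and>
    (\<exists>\<phi>. \<forall>e\<in>edges (diagram_graph D).
       deco D' e = deco D e + \<phi> (tgt (diagram_graph D) e) - \<phi> (src (diagram_graph D) e))"

definition generator_rel :: "'l::ab_group_add diagram \<Rightarrow> 'l diagram \<Rightarrow> bool" where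
  "generator_rel D D' \<longleftrightarrow> translation_rel D D' \<and> 0 < deg D"

lemma diagram_graph_cong:
  assumes "deg D = deg D'" "chords D = chords D'"
  shows "edges (diagram_graph D) = edges (diagram_graph D')"
    "src (diagram_graph D) = src (diagram_graph D')"
    "tgt (diagram_graph D) = tgt (diagram_graph D')"
proof -
  have p: "parent D = parent D'" using assms by (simp add: parent_def fun_eq_iff)
  show "edges (diagram_graph D) = edges (diagram_graph D')"
    "src (diagram_graph D) = src (diagram_graph D')"
    "tgt (diagram_graph D) = tgt (diagram_graph D')"
    unfolding diagram_graph_def p assms by simp_all
qed

lemma translation_rel_refl: "dissection_diagram D \<Longrightarrow> translation_rel D D"
  unfolding translation_rel_def by (auto intro!: exI[of _ "\<lambda>_. 0"])

lemma dissection_diagram_degree_1: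
  "dissection_diagram \<lparr>deg = 1, chords = {{0, 1}}, deco = d\<rparr>"
proof -
  have "acyclic_chords {{0, 1::nat}}"
    unfolding acyclic_chords_def
  proof (intro notI, elim exE conjE)
    fix vs :: "nat list"
    assume l: "3 \<le> length vs" and "distinct vs"
      and e: "\<forall>i<length vs. {vs ! i, vs ! (Suc i mod length vs)} \<in> {{0, 1}}"
    have "set vs \<subseteq> {0, 1}"
    proof
      fix v assume "v \<in> set vs"
      then obtain i where i: "i < length vs" "v = vs ! i" by (auto simp: in_set_conv_nth)
      then have "{v, vs ! (Suc i mod length vs)} = {0, 1}"
        using e[rule_format, OF i(1)] by (simp only: i(2) singleton_iff)
      then show "v \<in> {0, 1}" by (metis insertI1)
    qed
    then have "card (set vs) \<le> card {0, 1::nat}" by (intro card_mono) auto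
    then show False using l \<open>distinct vs\<close> by (simp add: distinct_card)
  qed
  moreover have "{{0, 1}} \<subseteq> {{i, j} | i j. i \<le> 1 \<and> j \<le> (1::nat) \<and> i \<noteq> j}"
    by (intro subsetI CollectI exI[of _ 0] exI[of _ 1]) simp
  ultimately show ?thesis
    unfolding dissection_diagram_def diagram.select_convs by (auto simp: crossing_def)
qed

quotient_type (overloaded) 'l dd_generator = "'l::ab_group_add diagram" / partial: generator_rel
proof (rule part_equivpI)
  show "\<exists>D :: 'l diagram. generator_rel D D"
    using translation_rel_refl[OF dissection_diagram_degree_1[of "\<lambda>_. 0 :: 'l"]]
    unfolding generator_rel_def by (metis diagram.select_convs(1) zero_less_one)
  show "symp (generator_rel :: 'l diagram \<Rightarrow> _)"
  proof (rule sympI)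
    fix D D' :: "'l diagram" assume "generator_rel D D'"
    then obtain \<phi> where *: "dissection_diagram D" "dissection_diagram D'" "deg D = deg D'"
      "chords D = chords D'" "0 < deg D" "\<forall>e\<in>edges (diagram_graph D).
        deco D' e = deco D e + \<phi> (tgt (diagram_graph D) e) - \<phi> (src (diagram_graph D) e)"
      unfolding generator_rel_def translation_rel_def by auto
    then have "\<forall>e\<in>edges (diagram_graph D').
        deco D e = deco D' e + (- \<phi> (tgt (diagram_graph D') e)) - (- \<phi> (src (diagram_graph D') e))"
      using diagram_graph_cong[OF *(3,4)] by simp
    then show "generator_rel D' D"
      using *(1-5) unfolding generator_rel_def translation_rel_def
      by (intro conjI exI[of _ "\<lambda>v. - \<phi> v"]) simp_all
  qed
  show "transp (generator_rel :: 'l diagram \<Rightarrow> _)"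
  proof (rule transpI)
    fix D D' D'' :: "'l diagram" assume "generator_rel D D'" "generator_rel D' D''"
    then obtain \<phi> \<psi> where *: "dissection_diagram D" "dissection_diagram D'" "dissection_diagram D''"
      "deg D = deg D'" "chords D = chords D'" "deg D' = deg D''" "chords D' = chords D''" "0 < deg D"
      "\<forall>e\<in>edges (diagram_graph D).
        deco D' e = deco D e + \<phi> (tgt (diagram_graph D) e) - \<phi> (src (diagram_graph D) e)"
      "\<forall>e\<in>edges (diagram_graph D').
        deco D'' e = deco D' e + \<psi> (tgt (diagram_graph D') e) - \<psi> (src (diagram_graph D') e)"
      unfolding generator_rel_def translation_rel_def by auto
    then have "\<forall>e\<in>edges (diagram_graph D). deco D'' e = deco D e
        + (\<phi> (tgt (diagram_graph D) e) + \<psi> (tgt (diagram_graph D) e))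
        - (\<phi> (src (diagram_graph D) e) + \<psi> (src (diagram_graph D) e))"
      using diagram_graph_cong[OF *(4,5)] by simp
    then show "generator_rel D D''"
      using *(1-8) unfolding generator_rel_def translation_rel_def
      by (intro conjI exI[of _ "\<lambda>v. \<phi> v + \<psi> v"]) simp_all
  qed
qed

type_synonym 'l dd_algebra = "'l dd_generator multiset \<Rightarrow>\<^sub>0 rat"

definition dd :: "'l::ab_group_add diagram \<Rightarrow> 'l dd_algebra" where
  "dd D = (if deg D = 0 then 1 else Poly_Mapping.single {#abs_dd_generator D#} 1)"

definition q_elem :: "'l::ab_group_add diagram \<Rightarrow> nat set \<Rightarrow> 'l dd_algebra" where
  "q_elem D C = (\<Prod>\<alpha>\<in>faces D C. dd (q_face D C \<alpha>))"

definition r_elem :: "'l::ab_group_add diagram \<Rightarrow> nat set \<Rightarrow> 'l dd_algebra" where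
  "r_elem D C = dd (r_diag D C)"

definition coproduct_formula ::
  "'l::ab_group_add diagram \<Rightarrow> ('l dd_generator multiset \<times> 'l dd_generator multiset \<Rightarrow>\<^sub>0 rat)" where
  "coproduct_formula D = (\<Sum>C\<in>Pow {1..deg D}. qscale ((-1) ^ k_num D C) (q_elem D C \<otimes> r_elem D C))"

text \<open>
  The next three definitions go through a representative \<open>rep_dd_generator x\<close>; that its choice
  does not matter is part of what has to be proved about \<open>dd_coproduct\<close> and \<open>dd_map\<close>.
\<close>

definition dd_coproduct ::
  "'l::ab_group_add dd_algebra \<Rightarrow> ('l dd_generator multiset \<times> 'l dd_generator multiset \<Rightarrow>\<^sub>0 rat)" where
  "dd_coproduct = free_ext (\<lambda>x. coproduct_formula (rep_dd_generator x))"

definition dd_map :: "('l::ab_group_add \<Rightarrow> 'm::ab_group_add) \<Rightarrow> 'l dd_algebra \<Rightarrow> 'm dd_algebra" where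
  "dd_map h = free_ext (\<lambda>x. dd (map_deco h (rep_dd_generator x)))"

definition dd_grade :: "nat \<Rightarrow> 'l::ab_group_add dd_algebra set" where
  "dd_grade n = {p. \<forall>m\<in>Poly_Mapping.keys p. (\<Sum>x\<in>#m. deg (rep_dd_generator x)) = n}"

end

theory Submission
  imports Defs
begin

text \<open>
  A chord cuts the sides of the polygon into two parts.  Because the chords of a dissection
  diagram form a noncrossing spanning tree, each of them is the only chord separating some pair
  of sides, and these pairs form the dual tree, whose vertices are the sides.  Up to translation
  the chords may be decorated by 0, so that a decorated diagram becomes a dual tree with decorated
  vertices.  In these terms \<open>q\<^sub>C(D)\<close> consists of the components that remain when the edges dual
  to \<open>C\<close> are deleted, and \<open>r\<^sub>C(D)\<close> is the tree in which these components are contracted to points,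
  the decorations being added up.  Both sides of the coassociativity equation are then sums over
  pairs \<open>C \<subseteq> C'\<close> of sets of chords.  The signs match because a chord is directed by its dual edge
  alone: it leaves its endpoint lying between the two sides it separates, away from the root; so
  the flips on both sides compare the directions in \<open>D\<close>, in \<open>r\<^bsub>C'\<^esub>(D)\<close> and in \<open>r\<^sub>C(D)\<close>.  The antipode
  is the series \<open>\<Sum>\<^sub>k (-1)\<^sup>k (id - \<eta>\<epsilon>)\<^sup>k\<close> for the convolution product, which is finite in every
  degree.
\<close>

section \<open>Linear algebra of monoid algebras\<close>

text \<open>The obstacle is bookkeeping: iterated coproducts contract and renumber polygons twice,
  in different orders on the two sides of coassociativity. A tree system therefore keeps the names
  of the sides and the ends of the chords of the original polygon. Passing to a face or to the least
  sides of the faces only selects subsets, so that both iterations lead to literally the same sets.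
  The ends of a chord need not be vertices of the smaller polygon, since only the separation of
  sides is used. Renumbering happens inside \<open>gen\<close>, and \<open>cop_image\<close> shows
  that it is harmless. Well-definedness comes from the same normal form:
  \<open>coproduct_formula_cop\<close> expresses the formula through the decorations of the sides
  after a translation that kills those of the chords, and all representatives of a generator share
  such a normal form.\<close>

abbreviation lin :: "(('a \<Rightarrow>\<^sub>0 rat) \<Rightarrow> ('b \<Rightarrow>\<^sub>0 rat)) \<Rightarrow> bool" where
  "lin \<equiv> Vector_Spaces.linear qscale qscale"

abbreviation basis :: "'a \<Rightarrow> ('a \<Rightarrow>\<^sub>0 rat)" where
  "basis k \<equiv> Poly_Mapping.single k 1"

lemma lin_scale: "lin f \<Longrightarrow> f (qscale c x) = qscale c (f x)"
  by (simp add: linear_qscale_iff)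

lemma lin_sum: "lin f \<Longrightarrow> f (sum g A) = (\<Sum>i\<in>A. f (g i))"
  by (metis Vector_Spaces.linear_def module_hom.sum)

lemma linI:
  assumes "\<And>x y. f (x + y) = f x + f y" "\<And>c x. f (qscale c x) = qscale c (f x)"
  shows "lin f"
  using assms by (simp add: linear_qscale_iff)

lemma qscale_conv_mult: "qscale c x = Poly_Mapping.single 0 c * (x :: 'a::monoid_add \<Rightarrow>\<^sub>0 rat)"
  by (simp add: qscale_def mult_map_scale_conv_mult)

lemma qscale_mult_left: "qscale c x * y = qscale c (x * (y :: 'a::monoid_add \<Rightarrow>\<^sub>0 rat))"
  by (simp add: qscale_conv_mult mult.assoc)

lemma qscale_mult_right: "x * qscale c y = qscale c (x * (y :: 'a::comm_monoid_add \<Rightarrow>\<^sub>0 rat))"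
  by (metis mult.commute qscale_mult_left)

lemma qscale_simps [simp]:
  "qscale c (qscale d x) = qscale (c * d) x" "qscale 1 x = x" "qscale 0 x = 0" "qscale c 0 = 0"
  "qscale c (x + y) = qscale c x + qscale c y"
  by (auto intro!: poly_mapping_eqI simp: lookup_add algebra_simps)

lemma qscale_add_left: "qscale (c + d) x = qscale c x + qscale d x"
  by (auto intro!: poly_mapping_eqI simp: lookup_add algebra_simps)

lemma qscale_sum: "qscale c (sum f A) = (\<Sum>i\<in>A. qscale c (f i))"
  by (auto intro!: poly_mapping_eqI simp: lookup_sum sum_distrib_left)

lemma lin_id: "lin (\<lambda>x. x)"
  by (simp add: linear_qscale_iff)

lemma lin_comp: "lin f \<Longrightarrow> lin g \<Longrightarrow> lin (\<lambda>x. f (g x))"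
  by (simp add: linear_qscale_iff)

lemma lin_plus: "lin f \<Longrightarrow> lin g \<Longrightarrow> lin (\<lambda>x. f x + g x)"
  by (simp add: linear_qscale_iff)

lemma lin_qscale: "lin f \<Longrightarrow> lin (\<lambda>x. qscale c (f x))"
  by (simp add: linear_qscale_iff mult.commute)

lemma lin_eqI:
  assumes "lin f" "lin g" "\<And>k. f (basis k) = g (basis k)"
  shows "f x = g x"
  using linear_basis_expansion[OF assms(1), of x] linear_basis_expansion[OF assms(2), of x] assms(3)
  by simp

lemma lin_tensor_lift: "lin (tensor_lift \<beta>)"
proof -
  have "tensor_lift \<beta> = (\<lambda>t. \<Sum>k\<in>Poly_Mapping.keys t. qscale (Poly_Mapping.lookup t k)
      (\<beta> (basis (fst k)) (basis (snd k))))"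
    by (rule ext) (simp add: tensor_lift_def case_prod_unfold)
  then show ?thesis by (simp only: linear_basis_lift)
qed

lemma tensor_lift_basis: "tensor_lift \<beta> (basis (a, b)) = \<beta> (basis a) (basis b)"
  by (simp add: tensor_lift_def)

lemma bilinear_mapI:
  assumes "\<And>x. lin (\<beta> x)" "\<And>y. lin (\<lambda>x. \<beta> x y)"
  shows "bilinear_map \<beta>"
  using assms by (simp add: bilinear_map_def)

lemma tensor_add_left: "(x + y) \<otimes> z = x \<otimes> z + y \<otimes> z"
  and tensor_add_right: "z \<otimes> (x + y) = z \<otimes> x + z \<otimes> y"
  and tensor_scale_left: "qscale c x \<otimes> z = qscale c (x \<otimes> z)"
  and tensor_scale_right: "z \<otimes> qscale c x = qscale c (z \<otimes> x)"
  by (auto intro!: poly_mapping_eqI simp: lookup_add algebra_simps)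

lemma lin_tensor_left: "lin f \<Longrightarrow> lin (\<lambda>x. f x \<otimes> z)"
  and lin_tensor_right: "lin f \<Longrightarrow> lin (\<lambda>x. z \<otimes> f x)"
  by (simp_all add: linear_qscale_iff tensor_add_left tensor_add_right tensor_scale_left tensor_scale_right)

lemma lin_mult_left: "lin f \<Longrightarrow> lin (\<lambda>x. f x * (z :: 'a::comm_monoid_add \<Rightarrow>\<^sub>0 rat))"
  and lin_mult_right: "lin f \<Longrightarrow> lin (\<lambda>x. (z :: 'a::comm_monoid_add \<Rightarrow>\<^sub>0 rat) * f x)"
  by (simp_all add: linear_qscale_iff qscale_mult_left qscale_mult_right algebra_simps)

lemma tensor_sum_left: "sum f A \<otimes> z = (\<Sum>i\<in>A. f i \<otimes> z)"
  using lin_sum[OF lin_tensor_left[OF lin_id]] .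

lemma tensor_sum_right: "z \<otimes> sum f A = (\<Sum>i\<in>A. z \<otimes> f i)"
  using lin_sum[OF lin_tensor_right[OF lin_id]] .

lemma tensor_basis: "basis a \<otimes> basis b = basis (a, b)"
  by (simp add: tensor_single)

lemma tensor_one: "(1 :: 'a::monoid_add \<Rightarrow>\<^sub>0 rat) \<otimes> (1 :: 'b::monoid_add \<Rightarrow>\<^sub>0 rat) = 1"
  using tensor_single[of "0 :: 'a" 1 "0 :: 'b" 1] by (simp add: zero_prod_def[symmetric])

text \<open>The identity is clear on basis elements, and both sides are linear in each of the four
  factors; the factors are released from the basis one at a time.\<close>

lemma tensor_mult:
  fixes x x' :: "'a::comm_monoid_add \<Rightarrow>\<^sub>0 rat" and y y' :: "'b::comm_monoid_add \<Rightarrow>\<^sub>0 rat"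
  shows "(x \<otimes> y) * (x' \<otimes> y') = (x * x') \<otimes> (y * y')"
proof -
  note l = lin_mult_left lin_mult_right lin_tensor_left lin_tensor_right lin_id
  have 1: "(basis a \<otimes> basis b) * (basis a' \<otimes> basis b') = (basis a * basis a') \<otimes> (basis b * basis b')"
    for a a' :: 'a and b b' :: 'b
    by (simp add: tensor_single mult_single)
  have 2: "(basis a \<otimes> basis b) * (basis a' \<otimes> v) = (basis a * basis a') \<otimes> (basis b * v)"
    for a a' :: 'a and b :: 'b and v
    by (rule lin_eqI[of "\<lambda>v. (basis a \<otimes> basis b) * (basis a' \<otimes> v)"]) (auto intro!: l simp: 1)
  have 3: "(basis a \<otimes> basis b) * (u \<otimes> v) = (basis a * u) \<otimes> (basis b * v)"
    for a :: 'a and b :: 'b and u v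
    by (rule lin_eqI[of "\<lambda>u. (basis a \<otimes> basis b) * (u \<otimes> v)"]) (auto intro!: l simp: 2)
  have 4: "(basis a \<otimes> w) * (u \<otimes> v) = (basis a * u) \<otimes> (w * v)"
    for a :: 'a and u and v w :: "'b \<Rightarrow>\<^sub>0 rat"
    by (rule lin_eqI[of "\<lambda>w. (basis a \<otimes> w) * (u \<otimes> v)"]) (auto intro!: l simp: 3)
  show ?thesis
    by (rule lin_eqI[of "\<lambda>x. (x \<otimes> y) * (x' \<otimes> y')"]) (auto intro!: l simp: 4)
qed

lemma tensor_prod:
  fixes f :: "'i \<Rightarrow> ('a::comm_monoid_add \<Rightarrow>\<^sub>0 rat)" and g :: "'i \<Rightarrow> ('b::comm_monoid_add \<Rightarrow>\<^sub>0 rat)"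
  shows "(\<Prod>i\<in>A. f i \<otimes> g i) = (\<Prod>i\<in>A. f i) \<otimes> (\<Prod>i\<in>A. g i)"
  by (induction A rule: infinite_finite_induct) (simp_all add: tensor_one tensor_mult)

lemma prod_qscale:
  "(\<Prod>i\<in>A. qscale (c i) (f i)) = qscale (\<Prod>i\<in>A. c i) (\<Prod>i\<in>A. (f i :: 'a::comm_monoid_add \<Rightarrow>\<^sub>0 rat))"
  by (induction A rule: infinite_finite_induct)
    (simp_all add: qscale_mult_left qscale_mult_right mult.commute)

abbreviation alg_hom :: "(('a::monoid_add \<Rightarrow>\<^sub>0 rat) \<Rightarrow> ('b::monoid_add \<Rightarrow>\<^sub>0 rat)) \<Rightarrow> bool" where
  "alg_hom \<equiv> algebra_hom qscale qscale"

lemma alg_hom_lin: "alg_hom f \<Longrightarrow> lin f"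
  and alg_hom_one: "alg_hom f \<Longrightarrow> f 1 = 1"
  and alg_hom_mult: "alg_hom f \<Longrightarrow> f (x * y) = f x * f y"
  by (simp_all add: algebra_hom_def)

text \<open>Basis elements multiply to basis elements, so multiplicativity is checked on them and
  extended linearly in each factor.\<close>

lemma alg_homI:
  fixes f :: "('a::comm_monoid_add \<Rightarrow>\<^sub>0 rat) \<Rightarrow> ('b::comm_monoid_add \<Rightarrow>\<^sub>0 rat)"
  assumes "lin f" "f 1 = 1" "\<And>k l. f (basis (k + l)) = f (basis k) * f (basis l)"
  shows "alg_hom f"
proof -
  have 1: "f (basis k * basis l) = f (basis k) * f (basis l)" for k l
    by (simp add: mult_single assms(3))
  have 2: "f (basis k * y) = f (basis k) * f y" for k y
    by (rule lin_eqI[of "\<lambda>y. f (basis k * y)"])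
      (auto intro!: lin_comp[OF assms(1)] lin_mult_right lin_id assms(1) simp: 1)
  have "f (x * y) = f x * f y" for x y
    by (rule lin_eqI[of "\<lambda>x. f (x * y)"])
      (auto intro!: lin_comp[OF assms(1)] lin_mult_left lin_id assms(1) simp: 2)
  then show ?thesis using assms(1,2) by (simp add: algebra_hom_def)
qed

lemma alg_hom_comp: "alg_hom f \<Longrightarrow> alg_hom g \<Longrightarrow> alg_hom (\<lambda>x. f (g x))"
  unfolding algebra_hom_def using lin_comp[of f g] by auto

lemma alg_hom_id: "alg_hom (\<lambda>x. x)"
  unfolding algebra_hom_def using lin_id by auto

lemma alg_hom_prod:
  fixes f :: "('a::comm_monoid_add \<Rightarrow>\<^sub>0 rat) \<Rightarrow> ('b::comm_monoid_add \<Rightarrow>\<^sub>0 rat)"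
  shows "alg_hom f \<Longrightarrow> f (prod g A) = (\<Prod>i\<in>A. f (g i))"
  by (induction A rule: infinite_finite_induct) (simp_all add: alg_hom_one alg_hom_mult)

lemma alg_hom_tensor_lift:
  fixes \<beta> :: "('a::comm_monoid_add \<Rightarrow>\<^sub>0 rat) \<Rightarrow> ('b::comm_monoid_add \<Rightarrow>\<^sub>0 rat) \<Rightarrow> ('c::comm_monoid_add \<Rightarrow>\<^sub>0 rat)"
  assumes "\<beta> 1 1 = 1" "\<And>a a' b b'. \<beta> (a * a') (b * b') = \<beta> a b * \<beta> a' b'"
  shows "alg_hom (tensor_lift \<beta>)"
proof (rule alg_homI)
  show "lin (tensor_lift \<beta>)" by (rule lin_tensor_lift)
  show "tensor_lift \<beta> 1 = 1"
    using tensor_lift_basis[of \<beta> 0 0] assms(1) by (simp add: zero_prod_def[symmetric])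
  fix k l :: "'a \<times> 'b"
  obtain a b a' b' where [simp]: "k = (a, b)" "l = (a', b')" by (cases k, cases l)
  show "tensor_lift \<beta> (basis (k + l)) = tensor_lift \<beta> (basis k) * tensor_lift \<beta> (basis l)"
    using assms(2)[of "basis a" "basis a'" "basis b" "basis b'"]
    by (simp add: tensor_lift_basis mult_single)
qed

lemma tensor_map_tensor:
  assumes "lin f" "lin g"
  shows "tensor_map f g (x \<otimes> y) = f x \<otimes> g y"
  unfolding tensor_map_def
  by (intro tensor_universal(3) bilinear_mapI lin_tensor_left lin_tensor_right assms)

lemma lin_tensor_map: "lin (tensor_map f g)"
  by (simp add: tensor_map_def lin_tensor_lift)

lemma alg_hom_tensor_map:
  fixes f :: "('a::comm_monoid_add \<Rightarrow>\<^sub>0 rat) \<Rightarrow> ('c::comm_monoid_add \<Rightarrow>\<^sub>0 rat)"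
    and g :: "('b::comm_monoid_add \<Rightarrow>\<^sub>0 rat) \<Rightarrow> ('d::comm_monoid_add \<Rightarrow>\<^sub>0 rat)"
  assumes "alg_hom f" "alg_hom g"
  shows "alg_hom (tensor_map f g)"
  unfolding tensor_map_def using assms
  by (intro alg_hom_tensor_lift) (simp_all add: alg_hom_one alg_hom_mult tensor_one tensor_mult)

lemma lin_tensor_assoc: "lin tensor_assoc"
  by (simp add: tensor_assoc_def lin_tensor_lift)

lemma tensor_assoc_basis: "tensor_assoc (basis ((a, b), c)) = basis (a, b, c)"
  by (simp add: tensor_assoc_def tensor_lift_basis tensor_basis)

lemma tensor_assoc_tensor: "tensor_assoc ((x \<otimes> y) \<otimes> z) = x \<otimes> y \<otimes> z"
proof -
  note l = lin_comp[OF lin_tensor_assoc] lin_tensor_left lin_tensor_right lin_id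
  have 1: "tensor_assoc ((basis a \<otimes> basis b) \<otimes> z) = basis a \<otimes> basis b \<otimes> z" for a b
    by (rule lin_eqI[of "\<lambda>z. tensor_assoc ((basis a \<otimes> basis b) \<otimes> z)"])
      (auto intro!: l simp: tensor_basis tensor_assoc_basis)
  have 2: "tensor_assoc ((basis a \<otimes> y) \<otimes> z) = basis a \<otimes> y \<otimes> z" for a
    by (rule lin_eqI[of "\<lambda>y. tensor_assoc ((basis a \<otimes> y) \<otimes> z)"]) (auto intro!: l simp: 1)
  show ?thesis
    by (rule lin_eqI[of "\<lambda>x. tensor_assoc ((x \<otimes> y) \<otimes> z)"]) (auto intro!: l simp: 2)
qed

lemma alg_hom_tensor_assoc:
  "alg_hom (tensor_assoc :: (('a::comm_monoid_add \<times> 'b::comm_monoid_add) \<times> 'c::comm_monoid_add \<Rightarrow>\<^sub>0 rat) \<Rightarrow> _)"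
proof (rule alg_homI)
  show "tensor_assoc (1 :: ('a \<times> 'b) \<times> 'c \<Rightarrow>\<^sub>0 rat) = 1"
    using tensor_assoc_tensor[of "1 :: 'a \<Rightarrow>\<^sub>0 rat" "1 :: 'b \<Rightarrow>\<^sub>0 rat" "1 :: 'c \<Rightarrow>\<^sub>0 rat"] by (simp add: tensor_one)
  fix k l :: "('a \<times> 'b) \<times> 'c"
  obtain a b c a' b' c' where [simp]: "k = ((a, b), c)" "l = ((a', b'), c')" by (metis prod.exhaust)
  show "tensor_assoc (basis (k + l)) = tensor_assoc (basis k) * tensor_assoc (basis l)"
    by (simp add: tensor_assoc_basis mult_single)
qed (rule lin_tensor_assoc)

subsection \<open>Free commutative algebras\<close>

lemma lin_free_ext: "lin (free_ext f)"
proof -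
  have "free_ext f = (\<lambda>t. \<Sum>k\<in>Poly_Mapping.keys t. qscale (Poly_Mapping.lookup t k) (\<Prod>x\<in>#k. f x))"
    by (rule ext) (simp add: free_ext_def)
  then show ?thesis by (simp only: linear_basis_lift)
qed

lemma free_ext_basis: "free_ext f (basis m) = (\<Prod>x\<in>#m. f x)"
  by (simp add: free_ext_def)

lemma alg_hom_free_ext: "alg_hom (free_ext f)"
proof (rule alg_homI)
  show "free_ext f 1 = 1" using free_ext_basis[of f 0] by simp
qed (simp_all add: lin_free_ext free_ext_basis)

text \<open>Monomials are products of singletons and span the algebra. The bialgebra axioms and
  functoriality are reduced to generators in this way.\<close>

lemma alg_hom_eqI:
  fixes f g :: "('x multiset \<Rightarrow>\<^sub>0 rat) \<Rightarrow> ('b::comm_monoid_add \<Rightarrow>\<^sub>0 rat)"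
  assumes "alg_hom f" "alg_hom g" "\<And>x. f (basis {#x#}) = g (basis {#x#})"
  shows "f p = g p"
proof -
  have "f (basis m) = g (basis m)" for m
  proof (induction m)
    case empty
    then show ?case using alg_hom_one[OF assms(1)] alg_hom_one[OF assms(2)] by simp
  next
    case (add x m)
    have "basis (add_mset x m) = basis {#x#} * basis m" by (simp add: mult_single)
    then show ?case using add assms by (simp add: alg_hom_mult)
  qed
  then show ?thesis using lin_eqI alg_hom_lin assms(1,2) by metis
qed

subsection \<open>Convolution and antipodes\<close>

text \<open>The convolution product: \<open>f \<otimes> g\<close> applied after the coproduct,
  followed by multiplication. An antipode is a two-sided inverse of the identity for it.\<close>

definition conv ::
  "(('a \<Rightarrow>\<^sub>0 rat) \<Rightarrow> ('a \<times> 'a \<Rightarrow>\<^sub>0 rat)) \<Rightarrow> (('a \<Rightarrow>\<^sub>0 rat) \<Rightarrow> ('b::comm_monoid_add \<Rightarrow>\<^sub>0 rat)) \<Rightarrow>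
    (('a \<Rightarrow>\<^sub>0 rat) \<Rightarrow> ('b \<Rightarrow>\<^sub>0 rat)) \<Rightarrow> ('a \<Rightarrow>\<^sub>0 rat) \<Rightarrow> ('b \<Rightarrow>\<^sub>0 rat)" where
  "conv \<Delta> f g x = tensor_lift (\<lambda>a b. f a * g b) (\<Delta> x)"

lemma lin_conv: "lin \<Delta> \<Longrightarrow> lin (conv \<Delta> f g)"
  unfolding conv_def[abs_def] by (rule lin_comp[OF lin_tensor_lift])

lemma conv_expand:
  "conv \<Delta> f g x = (\<Sum>p\<in>Poly_Mapping.keys (\<Delta> x). qscale (Poly_Mapping.lookup (\<Delta> x) p)
     (f (basis (fst p)) * g (basis (snd p))))"
  by (simp add: conv_def tensor_lift_def case_prod_unfold)

lemma conv_tensor: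
  assumes "lin f" "lin g"
  shows "tensor_lift (\<lambda>a b. f a * g b) (x \<otimes> y) = f x * (g y :: 'b::comm_monoid_add \<Rightarrow>\<^sub>0 rat)"
  by (rule tensor_universal(3)) (intro bilinear_mapI lin_mult_left lin_mult_right assms)

lemma lin_tensor_eqI:
  assumes "lin F" "lin G" "\<And>a b. F (basis a \<otimes> basis b) = G (basis a \<otimes> basis b)"
  shows "F t = G t"
  by (rule lin_eqI[OF assms(1,2)]) (metis assms(3) tensor_basis prod.collapse)

text \<open>Both sides apply the linear map \<open>T\<close>, which sends
  \<open>a \<otimes> b \<otimes> c\<close> to the product of \<open>f a\<close>, \<open>g b\<close>
  and \<open>h c\<close>, to an iterated coproduct of \<open>x\<close>; coassociativity identifies
  the two iterated coproducts.\<close>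

lemma conv_assoc:
  fixes f g h :: "('a \<Rightarrow>\<^sub>0 rat) \<Rightarrow> ('b::comm_monoid_add \<Rightarrow>\<^sub>0 rat)"
  assumes \<Delta>: "lin \<Delta>" "tensor_assoc (tensor_map \<Delta> id (\<Delta> x)) = tensor_map id \<Delta> (\<Delta> x)"
    and lin: "lin f" "lin g" "lin h"
  shows "conv \<Delta> f (conv \<Delta> g h) x = conv \<Delta> (conv \<Delta> f g) h x"
proof -
  define gh where "gh = tensor_lift (\<lambda>b c. g b * h c)"
  define T where "T = tensor_lift (\<lambda>a bc. f a * gh bc)"
  have lgh: "lin gh" and lT: "lin T" by (simp_all add: gh_def T_def lin_tensor_lift)
  have gh: "gh (y \<otimes> z) = g y * h z" for y z unfolding gh_def by (rule conv_tensor[OF lin(2,3)])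
  have T: "T (y \<otimes> z) = f y * gh z" for y z unfolding T_def by (rule conv_tensor[OF lin(1) lgh])
  have li: "lin id" using lin_id by (simp add: id_def)
  have 1: "tensor_lift (\<lambda>a b. f a * conv \<Delta> g h b) t = T (tensor_map id \<Delta> t)" for t
    by (rule lin_tensor_eqI[OF lin_tensor_lift lin_comp[OF lT lin_tensor_map]])
      (simp add: conv_tensor lin lin_conv \<Delta> tensor_map_tensor li T, simp add: conv_def gh_def)
  have 2: "T (tensor_assoc (u \<otimes> basis b)) = tensor_lift (\<lambda>a b. f a * g b) u * h (basis b)" for u b
    by (rule lin_tensor_eqI[of "\<lambda>u. T (tensor_assoc (u \<otimes> basis b))"])
      (auto intro!: lin_comp[OF lT] lin_comp[OF lin_tensor_assoc] lin_tensor_left lin_id lin_mult_left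
        lin_tensor_lift simp: tensor_assoc_tensor T gh conv_tensor lin mult.assoc)
  have 3: "tensor_lift (\<lambda>a b. conv \<Delta> f g a * h b) t = T (tensor_assoc (tensor_map \<Delta> id t))" for t
    by (rule lin_tensor_eqI[OF lin_tensor_lift lin_comp[OF lT lin_comp[OF lin_tensor_assoc lin_tensor_map]]])
      (simp add: conv_tensor lin lin_conv \<Delta> tensor_map_tensor li 2, simp add: conv_def)
  show ?thesis
    unfolding conv_def[of \<Delta> f "conv \<Delta> g h"] conv_def[of \<Delta> "conv \<Delta> f g" h] 1 3 \<Delta>(2) ..
qed

lemma lin_unit:
  assumes "algebra_hom qscale (*) \<epsilon>"
  shows "lin (\<lambda>x. qscale (\<epsilon> x) 1)"
proof (rule linI)
  have "\<epsilon> (x + y) = \<epsilon> x + \<epsilon> y" "\<epsilon> (qscale c x) = c * \<epsilon> x" for x y c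
    using assms by (simp_all add: algebra_hom_def Vector_Spaces.linear_def module_hom_def module_hom_axioms_def)
  then show "qscale (\<epsilon> (x + y)) 1 = qscale (\<epsilon> x) 1 + qscale (\<epsilon> y) 1"
    "qscale (\<epsilon> (qscale c x)) 1 = qscale c (qscale (\<epsilon> x) 1)" for x y c
    by (simp_all add: qscale_add_left)
qed

lemma conv_unit_right:
  assumes "lin g" "tensor_lift (\<lambda>a b. qscale (\<epsilon> b) a) (\<Delta> x) = x" "algebra_hom qscale (*) \<epsilon>"
  shows "conv \<Delta> g (\<lambda>x. qscale (\<epsilon> x) 1) x = g x"
proof -
  have "tensor_lift (\<lambda>a b. g a * qscale (\<epsilon> b) 1) t = g (tensor_lift (\<lambda>a b. qscale (\<epsilon> b) a) t)" for t
    by (rule lin_eqI[OF lin_tensor_lift lin_comp[OF assms(1) lin_tensor_lift]])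
      (auto simp: tensor_lift_def qscale_mult_right lin_scale[OF assms(1)])
  then show ?thesis using assms(2) by (simp add: conv_def)
qed

lemma conv_unit_left:
  assumes "lin g" "tensor_lift (\<lambda>a b. qscale (\<epsilon> a) b) (\<Delta> x) = x" "algebra_hom qscale (*) \<epsilon>"
  shows "conv \<Delta> (\<lambda>x. qscale (\<epsilon> x) 1) g x = g x"
proof -
  have "tensor_lift (\<lambda>a b. qscale (\<epsilon> a) 1 * g b) t = g (tensor_lift (\<lambda>a b. qscale (\<epsilon> a) b) t)" for t
    by (rule lin_eqI[OF lin_tensor_lift lin_comp[OF assms(1) lin_tensor_lift]])
      (auto simp: tensor_lift_def qscale_mult_left lin_scale[OF assms(1)])
  then show ?thesis using assms(2) by (simp add: conv_def)
qed

text \<open>The lemmas on linear and multiplicative maps concern maps between monoid algebras, so a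
  scalar is first turned into a multiple of 1; this lemma recovers it.\<close>

lemma qscale_one_inject: "qscale c (1 :: 'a::monoid_add \<Rightarrow>\<^sub>0 rat) = qscale d 1 \<Longrightarrow> c = d"
  by (metis lookup_one_zero lookup_qscale mult.right_neutral)

section \<open>Uniqueness of counits and compatibility of antipodes with morphisms\<close>

lemma hopf_algebraD:
  assumes "hopf_algebra \<Delta> \<epsilon> S"
  shows "alg_hom \<Delta>" "algebra_hom qscale (*) \<epsilon>" "lin S"
    "tensor_assoc (tensor_map \<Delta> id (\<Delta> x)) = tensor_map id \<Delta> (\<Delta> x)"
    "tensor_lift (\<lambda>a b. qscale (\<epsilon> a) b) (\<Delta> x) = x"
    "tensor_lift (\<lambda>a b. qscale (\<epsilon> b) a) (\<Delta> x) = x"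
    "tensor_lift (\<lambda>a b. S a * b) (\<Delta> x) = qscale (\<epsilon> x) 1"
    "tensor_lift (\<lambda>a b. a * S b) (\<Delta> x) = qscale (\<epsilon> x) 1"
  using assms unfolding hopf_algebra_def by blast+

text \<open>The convolution of the two counits equals each of them, by the unit laws on the left and
  on the right.\<close>

lemma counit_unique:
  fixes \<Delta> :: "('a::comm_monoid_add \<Rightarrow>\<^sub>0 rat) \<Rightarrow> ('a \<times> 'a \<Rightarrow>\<^sub>0 rat)"
  assumes "hopf_algebra \<Delta> \<epsilon> S" "hopf_algebra \<Delta> \<epsilon>' S'"
  shows "\<epsilon> = \<epsilon>'"
proof
  fix x
  let ?e = "\<lambda>x. qscale (\<epsilon> x) (1 :: 'a \<Rightarrow>\<^sub>0 rat)" and ?e' = "\<lambda>x. qscale (\<epsilon>' x) (1 :: 'a \<Rightarrow>\<^sub>0 rat)"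
  have "conv \<Delta> ?e ?e' x = ?e' x"
    by (intro conv_unit_left[OF lin_unit] hopf_algebraD(5)[OF assms(1)] hopf_algebraD(2)[OF assms(1)] hopf_algebraD(2)[OF assms(2)])
  moreover have "conv \<Delta> ?e ?e' x = ?e x"
    by (intro conv_unit_right[OF lin_unit] hopf_algebraD(6)[OF assms(2)] hopf_algebraD(2)[OF assms(1)] hopf_algebraD(2)[OF assms(2)])
  ultimately show "\<epsilon> x = \<epsilon>' x" by (metis qscale_one_inject)
qed

text \<open>For the convolution of linear maps between the two algebras, \<open>S' \<circ> f\<close>
  is a left inverse of \<open>f\<close> and \<open>f \<circ> S\<close> is a right inverse; hence
  they agree.\<close>

lemma antipode_hom:
  fixes \<Delta> :: "('a::comm_monoid_add \<Rightarrow>\<^sub>0 rat) \<Rightarrow> ('a \<times> 'a \<Rightarrow>\<^sub>0 rat)"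
    and \<Delta>' :: "('b::comm_monoid_add \<Rightarrow>\<^sub>0 rat) \<Rightarrow> ('b \<times> 'b \<Rightarrow>\<^sub>0 rat)"
  assumes H: "hopf_algebra \<Delta> \<epsilon> S" and H': "hopf_algebra \<Delta>' \<epsilon>' S'"
    and f: "alg_hom f" "\<And>x. \<Delta>' (f x) = tensor_map f f (\<Delta> x)" "\<And>x. \<epsilon>' (f x) = \<epsilon> x"
  shows "S' (f x) = f (S x)"
proof -
  let ?e = "\<lambda>x. qscale (\<epsilon> x) (1 :: 'b \<Rightarrow>\<^sub>0 rat)" and ?g = "\<lambda>x. S' (f x)" and ?h = "\<lambda>x. f (S x)"
  have e: "algebra_hom qscale (*) \<epsilon>" and \<Delta>: "lin \<Delta>" and S: "lin S" and S': "lin S'" and lf: "lin f"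
    by (fact hopf_algebraD(2)[OF H] alg_hom_lin[OF hopf_algebraD(1)[OF H]] hopf_algebraD(3)[OF H]
        hopf_algebraD(3)[OF H'] alg_hom_lin[OF f(1)])+
  have lg: "lin ?g" and lh: "lin ?h" by (fact lin_comp[OF S' lf] lin_comp[OF lf S])+
  have "tensor_lift (\<lambda>a b. ?g a * f b) t = tensor_lift (\<lambda>a b. S' a * b) (tensor_map f f t)" for t
    by (rule lin_tensor_eqI[OF lin_tensor_lift lin_comp[OF lin_tensor_lift lin_tensor_map]])
      (simp add: conv_tensor lg lf S' lin_id tensor_map_tensor conv_tensor[of S' "\<lambda>x. x"])
  then have 1: "conv \<Delta> ?g f = ?e"
    by (simp add: conv_def[abs_def] f(2)[symmetric] f(3) hopf_algebraD(7)[OF H'])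
  have "tensor_lift (\<lambda>a b. f a * ?h b) t = f (tensor_lift (\<lambda>a b. a * S b) t)" for t
    by (rule lin_tensor_eqI[OF lin_tensor_lift lin_comp[OF lf lin_tensor_lift]])
      (simp add: conv_tensor lh lf S lin_id conv_tensor[of "\<lambda>x. x" S] alg_hom_mult[OF f(1)])
  then have 2: "conv \<Delta> f ?h = ?e"
    by (simp add: conv_def[abs_def] hopf_algebraD(8)[OF H] lin_scale[OF lf] alg_hom_one[OF f(1)])
  have "?g x = conv \<Delta> ?g ?e x"
    by (rule conv_unit_right[symmetric]) (fact lg e hopf_algebraD(6)[OF H])+
  also have "\<dots> = conv \<Delta> ?g (conv \<Delta> f ?h) x" by (simp only: 2)
  also have "\<dots> = conv \<Delta> (conv \<Delta> ?g f) ?h x"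
    by (rule conv_assoc) (fact \<Delta> lg lh lf hopf_algebraD(4)[OF H])+
  also have "\<dots> = conv \<Delta> ?e ?h x" by (simp only: 1)
  also have "\<dots> = ?h x"
    by (rule conv_unit_left) (fact lh e hopf_algebraD(5)[OF H])+
  finally show ?thesis .
qed

text \<open>Since a sum of keys is 0 only if both keys are, taking the constant term is
  multiplicative.\<close>

lemma lookup_mult_0:
  fixes p q :: "'a::comm_monoid_add \<Rightarrow>\<^sub>0 rat"
  assumes z: "\<And>k l :: 'a. k + l = 0 \<Longrightarrow> k = 0 \<and> l = 0"
  shows "Poly_Mapping.lookup (p * q) 0 = Poly_Mapping.lookup p 0 * Poly_Mapping.lookup q 0"
proof -
  have b: "Poly_Mapping.lookup (basis k * basis l) 0 = (Poly_Mapping.lookup (basis k) 0 * Poly_Mapping.lookup (basis l) 0 :: rat)" for k l :: 'a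
    using z[of k l] by (auto simp: mult_single lookup_single when_def)
  define L where "L = (\<lambda>x :: 'a \<Rightarrow>\<^sub>0 rat. qscale (Poly_Mapping.lookup x 0) (1 :: 'a \<Rightarrow>\<^sub>0 rat))"
  have L: "lin L" unfolding L_def by (rule linI) (simp_all add: lookup_add qscale_add_left)
  have "L (p * q) = L p * L q"
  proof (rule alg_hom_mult[OF alg_homI[OF L]])
    show "L 1 = 1" by (simp add: L_def)
    show "L (basis (k + l)) = L (basis k) * L (basis l)" for k l
      using b[of k l] by (simp add: L_def mult_single qscale_mult_left qscale_mult_right mult.commute)
  qed
  then have "qscale (Poly_Mapping.lookup (p * q) 0) (1 :: 'a \<Rightarrow>\<^sub>0 rat) = qscale (Poly_Mapping.lookup p 0 * Poly_Mapping.lookup q 0) 1"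
    by (simp add: L_def qscale_mult_left qscale_mult_right mult.commute)
  then show ?thesis by (rule qscale_one_inject)
qed

subsection \<open>Connected graded bialgebras\<close>

text \<open>All the structure except the antipode. That \<open>dg\<close> vanishes only at 0 is
  connectedness; it makes the series for the antipode finite on every basis element.\<close>

locale connected_bialgebra =
  fixes dg :: "'a::comm_monoid_add \<Rightarrow> nat"
    and \<Delta> :: "('a \<Rightarrow>\<^sub>0 rat) \<Rightarrow> ('a \<times> 'a \<Rightarrow>\<^sub>0 rat)"
    and \<epsilon> :: "('a \<Rightarrow>\<^sub>0 rat) \<Rightarrow> rat"
  assumes dg_add: "dg (a + b) = dg a + dg b"
    and dg_0: "dg a = 0 \<longleftrightarrow> a = 0"
    and hom_\<Delta>: "alg_hom \<Delta>"
    and coassoc: "tensor_assoc (tensor_map \<Delta> id (\<Delta> x)) = tensor_map id \<Delta> (\<Delta> x)"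
    and \<epsilon>: "\<epsilon> x = Poly_Mapping.lookup x 0"
    and counit_left: "tensor_lift (\<lambda>a b. qscale (\<epsilon> a) b) (\<Delta> x) = x"
    and counit_right: "tensor_lift (\<lambda>a b. qscale (\<epsilon> b) a) (\<Delta> x) = x"
    and dg_\<Delta>: "(k, l) \<in> Poly_Mapping.keys (\<Delta> (basis m)) \<Longrightarrow> dg k + dg l = dg m"
begin

definition grade :: "nat \<Rightarrow> ('a \<Rightarrow>\<^sub>0 rat) set" where
  "grade n = {p. \<forall>m\<in>Poly_Mapping.keys p. dg m = n}"

lemma grade_0: "0 \<in> grade n"
  and grade_qscale: "p \<in> grade n \<Longrightarrow> qscale c p \<in> grade n"
  and grade_basis: "basis m \<in> grade (dg m)"
  by (auto simp: grade_def in_keys_iff)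

lemma grade_lookup: "p \<in> grade n \<Longrightarrow> dg m \<noteq> n \<Longrightarrow> Poly_Mapping.lookup p m = 0"
  by (metis (mono_tags, lifting) grade_def in_keys_iff mem_Collect_eq)

lemma grade_add: "p \<in> grade n \<Longrightarrow> q \<in> grade n \<Longrightarrow> p + q \<in> grade n"
  using Poly_Mapping.keys_add[of p q] by (auto simp: grade_def)

lemma grade_sum: "(\<And>i. i \<in> A \<Longrightarrow> f i \<in> grade n) \<Longrightarrow> sum f A \<in> grade n"
  by (induction A rule: infinite_finite_induct) (auto simp: grade_0 grade_add)

lemma grade_mult: "p \<in> grade m \<Longrightarrow> q \<in> grade n \<Longrightarrow> p * q \<in> grade (m + n)"
  using keys_mult[of p q] by (fastforce simp: grade_def dg_add)

lemma grade_lin: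
  assumes "lin f" "\<And>m. f (basis m) \<in> grade (dg m)" "p \<in> grade n"
  shows "f p \<in> grade n"
  unfolding linear_basis_expansion[OF assms(1), of p]
  by (intro grade_sum grade_qscale) (use assms(2,3) in \<open>auto simp: grade_def\<close>)

lemma lookup_0_mult:
  "Poly_Mapping.lookup (p * q) 0 = Poly_Mapping.lookup p 0 * Poly_Mapping.lookup q 0"
  for p q :: "'a \<Rightarrow>\<^sub>0 rat"
  by (rule lookup_mult_0) (metis add_is_0 dg_0 dg_add)

lemma hom_\<epsilon>: "algebra_hom qscale (*) \<epsilon>"
proof -
  have "vector_space ((*) :: rat \<Rightarrow> rat \<Rightarrow> rat)" "module ((*) :: rat \<Rightarrow> rat \<Rightarrow> rat)"
    by unfold_locales (auto simp: algebra_simps)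
  then show ?thesis
    by (simp add: algebra_hom_def Vector_Spaces.linear_def module_hom_def module_hom_axioms_def
        vector_space_qscale module_qscale \<epsilon> lookup_add lookup_0_mult)
qed

lemmas lin_\<Delta> = alg_hom_lin[OF hom_\<Delta>]

abbreviation (input) unit where "unit \<equiv> \<lambda>x. qscale (\<epsilon> x) (1 :: 'a \<Rightarrow>\<^sub>0 rat)"

section \<open>The antipode as an alternating sum of convolution powers\<close>

definition J :: "('a \<Rightarrow>\<^sub>0 rat) \<Rightarrow> ('a \<Rightarrow>\<^sub>0 rat)" where
  "J x = x + qscale (-1) (unit x)"

primrec Jpow :: "nat \<Rightarrow> ('a \<Rightarrow>\<^sub>0 rat) \<Rightarrow> ('a \<Rightarrow>\<^sub>0 rat)" where
  "Jpow 0 = unit"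
| "Jpow (Suc k) = conv \<Delta> J (Jpow k)"

lemma lin_J: "lin J"
  unfolding J_def[abs_def] by (intro lin_plus lin_qscale lin_id lin_unit hom_\<epsilon>)

lemma lin_Jpow: "lin (Jpow k)"
  by (cases k) (simp_all add: lin_unit hom_\<epsilon> lin_conv lin_\<Delta>)

text \<open>\<open>Jpow\<close> multiplies by \<open>J\<close> on the left; the left antipode
  identity needs the factor \<open>J\<close> on the right.\<close>

lemma Jpow_Suc_right: "conv \<Delta> (Jpow k) J = Jpow (Suc k)"
proof (induction k)
  case 0
  show ?case
    using conv_unit_left[where \<Delta> = \<Delta>, OF lin_J counit_left hom_\<epsilon>] conv_unit_right[where \<Delta> = \<Delta>, OF lin_J counit_right hom_\<epsilon>]
    by (simp add: fun_eq_iff)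
next
  case (Suc k)
  have "conv \<Delta> (conv \<Delta> J (Jpow k)) J x = conv \<Delta> J (conv \<Delta> (Jpow k) J) x" for x
    by (rule conv_assoc[symmetric]) (simp_all add: lin_\<Delta> lin_J lin_Jpow coassoc)
  then show ?case using Suc by (simp add: fun_eq_iff)
qed

lemma J_basis: "J (basis m) = (if m = 0 then 0 else basis m)"
  using qscale_add_left[of 1 "-1" "1 :: 'a \<Rightarrow>\<^sub>0 rat"] by (simp add: J_def \<epsilon> lookup_single when_def)

text \<open>\<open>J\<close> kills \<open>basis 0\<close>, so in a surviving term of the coproduct
  the first factor has positive degree and the second one has degree less than
  \<open>dg m\<close>.\<close>

lemma Jpow_vanish: "dg m < k \<Longrightarrow> Jpow k (basis m) = 0"
proof (induction k arbitrary: m)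
  case (Suc k)
  have "J (basis (fst p)) * Jpow k (basis (snd p)) = 0" if "p \<in> Poly_Mapping.keys (\<Delta> (basis m))" for p
  proof (cases "fst p = 0")
    case False
    then have "dg (fst p) > 0" using dg_0 by blast
    then have "dg (snd p) < k" using dg_\<Delta>[of "fst p" "snd p" m] that Suc.prems by simp
    then show ?thesis using Suc.IH by simp
  next
    case True
    then show ?thesis using J_basis[of 0] by simp
  qed
  then show ?case by (simp add: conv_expand)
qed simp

lemma Jpow_grade: "Jpow k (basis m) \<in> grade (dg m)"
proof (induction k arbitrary: m)
  case 0
  show ?case
  proof (cases "m = 0")
    case True
    then show ?thesis using grade_basis[of 0] by (auto intro!: grade_qscale)
  next
    case False
    then have "\<epsilon> (basis m) = 0" by (simp add: \<epsilon> lookup_single when_def)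
    then show ?thesis by (simp add: grade_0)
  qed
next
  case (Suc k)
  have "J (basis (fst p)) * Jpow k (basis (snd p)) \<in> grade (dg m)" if "p \<in> Poly_Mapping.keys (\<Delta> (basis m))" for p
  proof -
    have "J (basis (fst p)) \<in> grade (dg (fst p))" by (simp add: J_basis grade_0 grade_basis)
    then show ?thesis using grade_mult[OF _ Suc, of _ _ "snd p"] dg_\<Delta>[of "fst p" "snd p" m] that by fastforce
  qed
  then show ?case by (auto simp: conv_expand intro!: grade_sum grade_qscale)
qed

definition T :: "nat \<Rightarrow> ('a \<Rightarrow>\<^sub>0 rat) \<Rightarrow> ('a \<Rightarrow>\<^sub>0 rat)" where
  "T N x = (\<Sum>k\<le>N. qscale ((-1) ^ k) (Jpow k x))"

text \<open>On a basis element the series may be cut off at its degree, by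
  \<open>Jpow_vanish\<close>. The cutoff varies with the element, whence the definition by values on
  the basis.\<close>

definition antipode :: "('a \<Rightarrow>\<^sub>0 rat) \<Rightarrow> ('a \<Rightarrow>\<^sub>0 rat)" where
  "antipode x = (\<Sum>m\<in>Poly_Mapping.keys x. qscale (Poly_Mapping.lookup x m) (T (dg m) (basis m)))"

lemma lin_antipode: "lin antipode"
  unfolding antipode_def[abs_def] by (rule linear_basis_lift)

lemma antipode_basis:
  assumes "dg m \<le> N"
  shows "antipode (basis m) = T N (basis m)"
proof -
  have "T N (basis m) = T (dg m) (basis m)"
    unfolding T_def
    by (rule sum.mono_neutral_right) (use assms Jpow_vanish in \<open>auto simp: not_le\<close>)
  then show ?thesis by (simp add: antipode_def)
qed

lemma antipode_grade: "p \<in> grade n \<Longrightarrow> antipode p \<in> grade n"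
  by (rule grade_lin[OF lin_antipode])
    (auto simp: antipode_basis[OF order_refl] T_def intro!: grade_sum grade_qscale Jpow_grade)

lemma id_J: "x = J x + unit x"
  using qscale_add_left[of "-1" 1 "unit x"] by (simp add: J_def add.assoc)

text \<open>Consecutive terms cancel; what remains is \<open>Jpow 0\<close>, the unit, and a last
  term that vanishes because its exponent exceeds the degree.\<close>

lemma telescope:
  assumes "dg m \<le> N"
  shows "(\<Sum>k\<le>N. qscale ((-1) ^ k) (Jpow (Suc k) (basis m))) + T N (basis m) = unit (basis m)"
proof -
  have "(\<Sum>k\<le>n. qscale ((-1) ^ k) (Jpow (Suc k) x)) + T n x = Jpow 0 x + qscale ((-1) ^ n) (Jpow (Suc n) x)" for n x
  proof (induction n)
    case (Suc n)
    have "qscale ((-1) ^ n) y + qscale ((-1) ^ Suc n) y = 0" for y :: "'a \<Rightarrow>\<^sub>0 rat"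
      by (metis add.right_inverse mult_minus1 power_Suc qscale_add_left qscale_simps(3))
    then show ?case using Suc by (simp add: T_def algebra_simps del: Jpow.simps)
  qed (simp add: T_def add.commute)
  from this[where n = N and x = "basis m"] show ?thesis using Jpow_vanish[of m "Suc N"] assms by (simp del: Jpow.simps(2))
qed

text \<open>Writing the second factor as its image under \<open>J\<close> plus its counit part gives
  the two sums of \<open>telescope\<close>. The cutoff \<open>dg m\<close> serves for all terms at
  once, because no factor in the coproduct has degree above \<open>dg m\<close>.\<close>

lemma antipode_left: "tensor_lift (\<lambda>a b. antipode a * b) (\<Delta> x) = unit x"
proof -
  have "conv \<Delta> antipode (\<lambda>x. x) (basis m) = unit (basis m)" for m
  proof -
    let ?K = "Poly_Mapping.keys (\<Delta> (basis m))"
    have "antipode (basis (fst p)) * basis (snd p) =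
        (\<Sum>k\<le>dg m. qscale ((-1) ^ k) (Jpow k (basis (fst p)) * J (basis (snd p)))) +
        (\<Sum>k\<le>dg m. qscale ((-1) ^ k) (Jpow k (basis (fst p)) * unit (basis (snd p))))" if "p \<in> ?K" for p
    proof -
      have "antipode (basis (fst p)) = T (dg m) (basis (fst p))"
        using antipode_basis dg_\<Delta>[of "fst p" "snd p" m] that by (metis le_add1 prod.collapse)
      then show ?thesis
        by (subst id_J[of "basis (snd p)"])
          (simp add: T_def distrib_left sum_distrib_right qscale_mult_left sum.distrib)
    qed
    then have "conv \<Delta> antipode (\<lambda>x. x) (basis m) =
        (\<Sum>k\<le>dg m. qscale ((-1) ^ k) (conv \<Delta> (Jpow k) J (basis m))) +
        (\<Sum>k\<le>dg m. qscale ((-1) ^ k) (conv \<Delta> (Jpow k) unit (basis m)))"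
      by (simp add: conv_expand sum.distrib qscale_sum sum.swap[of _ ?K] mult.commute)
    also have "\<dots> = unit (basis m)"
      using telescope[of m "dg m"]
      by (simp add: Jpow_Suc_right conv_unit_right[where \<Delta> = \<Delta>, OF lin_Jpow counit_right hom_\<epsilon>] T_def del: Jpow.simps)
    finally show ?thesis .
  qed
  then show ?thesis
    using lin_eqI[OF lin_conv[OF lin_\<Delta>] lin_unit[OF hom_\<epsilon>], of antipode "\<lambda>x. x" x]
    by (simp add: conv_def)
qed

lemma antipode_right: "tensor_lift (\<lambda>a b. a * antipode b) (\<Delta> x) = unit x"
proof -
  have "conv \<Delta> (\<lambda>x. x) antipode (basis m) = unit (basis m)" for m
  proof -
    let ?K = "Poly_Mapping.keys (\<Delta> (basis m))"
    have "basis (fst p) * antipode (basis (snd p)) =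
        (\<Sum>k\<le>dg m. qscale ((-1) ^ k) (J (basis (fst p)) * Jpow k (basis (snd p)))) +
        (\<Sum>k\<le>dg m. qscale ((-1) ^ k) (unit (basis (fst p)) * Jpow k (basis (snd p))))" if "p \<in> ?K" for p
    proof -
      have "antipode (basis (snd p)) = T (dg m) (basis (snd p))"
        using antipode_basis dg_\<Delta>[of "fst p" "snd p" m] that by (metis le_add2 prod.collapse)
      then show ?thesis
        by (subst id_J[of "basis (fst p)"])
          (simp add: T_def distrib_right sum_distrib_left qscale_mult_right sum.distrib)
    qed
    then have "conv \<Delta> (\<lambda>x. x) antipode (basis m) =
        (\<Sum>k\<le>dg m. qscale ((-1) ^ k) (conv \<Delta> J (Jpow k) (basis m))) +
        (\<Sum>k\<le>dg m. qscale ((-1) ^ k) (conv \<Delta> unit (Jpow k) (basis m)))"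
      by (simp add: conv_expand sum.distrib qscale_sum sum.swap[of _ ?K] mult.commute)
    also have "\<dots> = unit (basis m)"
      using telescope[of m "dg m"]
      by (simp add: conv_unit_left[where \<Delta> = \<Delta>, OF lin_Jpow counit_left hom_\<epsilon>] T_def)
    finally show ?thesis .
  qed
  then show ?thesis
    using lin_eqI[OF lin_conv[OF lin_\<Delta>] lin_unit[OF hom_\<epsilon>], of "\<lambda>x. x" antipode x]
    by (simp add: conv_def)
qed

section \<open>The grading\<close>

lemma subspace_grade: "module.subspace qscale (grade n)"
  by (simp add: module.subspace_def[OF module_qscale] grade_0 grade_add grade_qscale)

lemma grade_decomposition: "direct_sum_decomposition grade"
  unfolding direct_sum_decomposition_def
proof (intro conjI allI subspace_grade)
  fix x :: "'a \<Rightarrow>\<^sub>0 rat"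
  define c where "c n = (\<Sum>m\<in>Poly_Mapping.keys x. qscale (if dg m = n then Poly_Mapping.lookup x m else 0) (basis m))" for n
  have c: "Poly_Mapping.lookup (c n) m = (if dg m = n then Poly_Mapping.lookup x m else 0)" for n m
  proof -
    have "Poly_Mapping.lookup (c n) m = (\<Sum>k\<in>Poly_Mapping.keys x. if k = m then (if dg m = n then Poly_Mapping.lookup x m else 0) else 0)"
      unfolding c_def lookup_sum by (rule sum.cong) (auto simp: lookup_single when_def)
    then show ?thesis by (simp add: in_keys_iff)
  qed
  have sum: "Poly_Mapping.lookup (\<Sum>n | f n \<noteq> 0. f n) m = Poly_Mapping.lookup (f (dg m)) m"
    if "\<forall>n. f n \<in> grade n" "finite {n. f n \<noteq> 0}" for f m
  proof -
    have "Poly_Mapping.lookup (f n) m = (if n = dg m then Poly_Mapping.lookup (f (dg m)) m else 0)" for n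
      using that(1) grade_lookup[of "f n" n m] by (cases "n = dg m") simp_all
    then have "Poly_Mapping.lookup (\<Sum>n | f n \<noteq> 0. f n) m =
        (\<Sum>n | f n \<noteq> 0. if n = dg m then Poly_Mapping.lookup (f (dg m)) m else 0)"
      unfolding lookup_sum by (metis (no_types, lifting) sum.cong)
    then show ?thesis using that(2) by auto
  qed
  show "\<exists>!f. (\<forall>n. f n \<in> grade n) \<and> finite {n. f n \<noteq> 0} \<and> x = (\<Sum>n | f n \<noteq> 0. f n)"
  proof (rule ex1I)
    have g: "\<forall>n. c n \<in> grade n" 
    proof (intro allI, unfold grade_def, intro CollectI ballI)
      fix n m assume "m \<in> Poly_Mapping.keys (c n)"
      then show "dg m = n" using c[of n m] by (metis in_keys_iff)
    qed
    have "{n. c n \<noteq> 0} \<subseteq> dg ` Poly_Mapping.keys x"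
    proof
      fix n assume "n \<in> {n. c n \<noteq> 0}"
      then obtain m where "Poly_Mapping.lookup (c n) m \<noteq> 0"
        by (metis lookup_zero mem_Collect_eq poly_mapping_eqI)
      then have "dg m = n" "m \<in> Poly_Mapping.keys x" using c[of n m] by (simp_all add: in_keys_iff split: if_splits)
      then show "n \<in> dg ` Poly_Mapping.keys x" by blast
    qed
    then have f: "finite {n. c n \<noteq> 0}" by (rule finite_subset) simp
    have "x = (\<Sum>n | c n \<noteq> 0. c n)" by (rule poly_mapping_eqI) (simp add: sum[OF g f] c)
    then show "(\<forall>n. c n \<in> grade n) \<and> finite {n. c n \<noteq> 0} \<and> x = (\<Sum>n | c n \<noteq> 0. c n)" using g f by blast
    fix h assume h: "(\<forall>n. h n \<in> grade n) \<and> finite {n. h n \<noteq> 0} \<and> x = (\<Sum>n | h n \<noteq> 0. h n)"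
    have "Poly_Mapping.lookup (h n) m = Poly_Mapping.lookup (c n) m" for n m
    proof (cases "dg m = n")
      case True
      then show ?thesis using h sum[of h m] by (metis c)
    next
      case False
      moreover have "h n \<in> grade n" using h by blast
      ultimately show ?thesis by (auto simp: c grade_def in_keys_iff)
    qed
    then show "h = c" by (intro ext poly_mapping_eqI)
  qed
qed

lemma tensor_degree_basis:
  assumes "dg k + dg l = n"
  shows "basis (k, l) \<in> tensor_degree grade n"
  unfolding tensor_degree_def tensor_basis[symmetric]
  by (rule module.span_base[OF module_qscale]) (use assms grade_basis in blast)

lemma \<Delta>_grade:
  assumes "x \<in> grade n"
  shows "\<Delta> x \<in> tensor_degree grade n"
proof -
  have sub: "module.subspace qscale (tensor_degree grade n)"
    unfolding tensor_degree_def by (rule module.subspace_span[OF module_qscale])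
  have "\<Delta> (basis m) \<in> tensor_degree grade (dg m)" for m
  proof (subst poly_mapping_expansion, unfold tensor_degree_def,
      intro module.span_sum[OF module_qscale] module.span_scale[OF module_qscale],
      fold tensor_degree_def)
    fix p assume "p \<in> Poly_Mapping.keys (\<Delta> (basis m))"
    then show "basis p \<in> tensor_degree grade (dg m)"
      using dg_\<Delta> tensor_degree_basis by (metis prod.collapse)
  qed
  then have *: "m \<in> Poly_Mapping.keys x \<Longrightarrow> \<Delta> (basis m) \<in> tensor_degree grade n" for m
    using assms by (auto simp: grade_def)
  show ?thesis
    unfolding linear_basis_expansion[OF lin_\<Delta>, of x]
    by (rule module.subspace_sum[OF module_qscale sub]) (intro module.subspace_scale[OF module_qscale sub] *)
qed

lemma hopf: "hopf_algebra \<Delta> \<epsilon> antipode"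
  unfolding hopf_algebra_def
  by (simp add: hom_\<Delta> hom_\<epsilon> lin_antipode coassoc counit_left counit_right antipode_left antipode_right)

lemma graded_connected_commutative_hopf:
  "graded_connected_commutative_hopf_algebra grade \<Delta> \<epsilon> antipode"
proof -
  have "\<epsilon> x = 0" if "n > 0" "x \<in> grade n" for n x
    using that dg_0[of 0] grade_lookup[of x n 0] by (simp add: \<epsilon>)
  moreover have "grade 0 = {qscale c 1 | c. True}"
  proof (intro equalityI subsetI)
    fix p assume p: "p \<in> grade 0"
    have "p = qscale (Poly_Mapping.lookup p 0) 1"
      by (rule poly_mapping_eqI) (use p in \<open>auto simp: grade_def in_keys_iff dg_0 lookup_one when_def\<close>)
    then show "p \<in> {qscale c 1 | c. True}" by blast
  next
    fix p :: "'a \<Rightarrow>\<^sub>0 rat" assume "p \<in> {qscale c 1 | c. True}"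
    then show "p \<in> grade 0" using grade_basis[of 0] dg_0[of 0] by (auto intro!: grade_qscale)
  qed
  moreover have "1 \<in> grade 0" using grade_basis[of 0] dg_0[of 0] by simp
  ultimately show ?thesis
    unfolding graded_connected_commutative_hopf_algebra_def graded_hopf_algebra_def
    by (auto simp: hopf grade_decomposition grade_mult \<Delta>_grade antipode_grade mult.commute)
qed

end

section \<open>Tree systems\<close>

definition sep :: "nat set \<Rightarrow> nat \<Rightarrow> nat \<Rightarrow> bool" where
  "sep c s t \<longleftrightarrow> (s \<in> arc c) \<noteq> (t \<in> arc c)"

definition dual :: "nat set set \<Rightarrow> nat set \<Rightarrow> nat \<Rightarrow> nat \<Rightarrow> bool" where
  "dual H c s t \<longleftrightarrow> (\<forall>d\<in>H. sep d s t \<longleftrightarrow> d = c)"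

definition noncrossing :: "nat set set \<Rightarrow> bool" where
  "noncrossing H \<longleftrightarrow> (\<forall>c\<in>H. \<forall>d\<in>H. \<not> crossing c d)"

text \<open>
  \<open>Y\<close> is a set of sides of a polygon and \<open>H\<close> a set of chords, given by their ends; only the way
  in which the chords separate the sides in \<open>Y\<close> matters.  The pairs \<open>s\<close>, \<open>t\<close> with \<open>dual H c s t\<close>
  are the edges of the dual tree.  Side \<open>s\<close> joins vertex \<open>s\<close> to vertex \<open>s + 1\<close>.
\<close>

definition tree_sys :: "nat set \<Rightarrow> nat set set \<Rightarrow> bool" where
  "tree_sys Y H \<longleftrightarrow>
    finite Y \<and> Y \<noteq> {} \<and> finite H \<and> (\<forall>c\<in>H. \<exists>a b. a \<noteq> b \<and> c = {a, b}) \<and> noncrossing H \<and>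
    (\<forall>s\<in>Y. \<forall>t\<in>Y. s \<noteq> t \<longrightarrow> (\<exists>c\<in>H. sep c s t)) \<and>
    (\<forall>c\<in>H. \<exists>s\<in>Y. \<exists>t\<in>Y. s < t \<and> dual H c s t)"

lemma arc_pair: "arc {a, b} = {min a b..<max a b}"
  by (simp add: arc_def)

text \<open>By this symmetry the cut \<open>{s<..t}\<close> of the vertices, which never contains the root, can be used
  to direct the chords.\<close>

lemma sep_cut:
  assumes "s < t"
  shows "sep {a, b} s t \<longleftrightarrow> (a \<in> {s<..t}) \<noteq> (b \<in> {s<..t})"
  using assms by (auto simp: sep_def arc_pair min_def max_def)

lemma sep_commute: "sep c s t \<longleftrightarrow> sep c t s"
  by (auto simp: sep_def)

lemma sep_refl [simp]: "\<not> sep c s s"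
  by (simp add: sep_def)

lemma sep_trans: "sep c s t \<longleftrightarrow> (sep c s u \<noteq> sep c u t)"
  by (auto simp: sep_def)

lemma sep_subst: "\<not> sep c s s' \<Longrightarrow> \<not> sep c t t' \<Longrightarrow> sep c s t \<longleftrightarrow> sep c s' t'"
  by (auto simp: sep_def)

lemma dual_commute: "dual H c s t \<longleftrightarrow> dual H c t s"
  by (simp add: dual_def sep_commute)

lemma dualD: "dual H c s t \<Longrightarrow> d \<in> H \<Longrightarrow> sep d s t \<longleftrightarrow> d = c"
  by (simp add: dual_def)

lemma dual_mono: "dual H c s t \<Longrightarrow> K \<subseteq> H \<Longrightarrow> dual K c s t"
  by (auto simp: dual_def)

text \<open>Arcs are intervals; if they overlap without being nested, their ends interleave, which
  is a crossing in one of the two orders.\<close>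

lemma laminar:
  assumes "\<not> crossing {a, b} {c, d}" "\<not> crossing {c, d} {a, b}"
  shows "arc {a, b} \<inter> arc {c, d} = {} \<or> arc {a, b} \<subseteq> arc {c, d} \<or> arc {c, d} \<subseteq> arc {a, b}"
proof (rule ccontr)
  assume "\<not> ?thesis"
  then obtain x y z where "x \<in> arc {a, b}" "x \<in> arc {c, d}" "y \<in> arc {a, b}" "y \<notin> arc {c, d}"
    "z \<notin> arc {a, b}" "z \<in> arc {c, d}" by auto
  then show False using assms unfolding crossing_def arc_def by simp linarith
qed

section \<open>Dual edges, and the count of sides and chords\<close>

locale tree_system =
  fixes Y :: "nat set" and H :: "nat set set"
  assumes tree: "tree_sys Y H"
begin

lemma finite_Y: "finite Y" and Y_ne: "Y \<noteq> {}" and finite_H: "finite H" and noncrossing: "noncrossing H"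
  using tree by (auto simp: tree_sys_def)

lemma chordE:
  assumes "c \<in> H"
  obtains a b where "a \<noteq> b" "c = {a, b}"
proof -
  have "\<forall>c\<in>H. \<exists>a b. a \<noteq> b \<and> c = {a, b}" using tree unfolding tree_sys_def by (elim conjE)
  then show ?thesis using assms that by meson
qed

lemma separated: "s \<in> Y \<Longrightarrow> t \<in> Y \<Longrightarrow> s \<noteq> t \<Longrightarrow> \<exists>c\<in>H. sep c s t"
  using tree by (auto simp: tree_sys_def)

lemma dualE:
  assumes "c \<in> H"
  obtains s t where "s \<in> Y" "t \<in> Y" "s < t" "dual H c s t"
proof -
  have "\<forall>c\<in>H. \<exists>s\<in>Y. \<exists>t\<in>Y. s < t \<and> dual H c s t" using tree unfolding tree_sys_def by (elim conjE)
  then show ?thesis using assms that by meson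
qed

lemma compat:
  assumes "c \<in> H" "d \<in> H"
  shows "arc c \<inter> arc d = {} \<or> arc c \<subseteq> arc d \<or> arc d \<subseteq> arc c"
proof -
  obtain a b where c: "c = {a, b}" using assms chordE by metis
  obtain a' b' where d: "d = {a', b'}" using assms chordE by metis
  show ?thesis using laminar[of a b a' b'] noncrossing assms c d by (auto simp: noncrossing_def)
qed

text \<open>\<open>x\<close>, \<open>y\<close>, \<open>z\<close> and \<open>w\<close> would realise
  all four combinations of halves of \<open>c\<close> and \<open>d\<close>, one of which is empty by
  \<open>compat\<close>.\<close>

lemma no_quadrants:
  assumes "c \<in> H" "d \<in> H" "sep c x w" "sep d x w" "sep c y w" "\<not> sep d y w" "\<not> sep c z w" "sep d z w"
  shows False
  using compat[OF assms(1,2)] assms(3-) unfolding sep_def by blast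

text \<open>Otherwise the two pairs would lie on different sides of \<open>d\<close>, each meeting
  both sides of \<open>c\<close>: again all four combinations.\<close>

lemma not_sep_dual:
  assumes "c \<in> H" "d \<in> H" "sep c s t" "sep c s' t'" "\<not> sep d s t" "\<not> sep d s' t'"
  shows "\<not> sep d s s'"
  using compat[OF assms(1,2)] assms(3-) unfolding sep_def by blast

lemma eqI: "s \<in> Y \<Longrightarrow> t \<in> Y \<Longrightarrow> (\<And>c. c \<in> H \<Longrightarrow> \<not> sep c s t) \<Longrightarrow> s = t"
  using separated by blast

lemma dual_eq:
  assumes "c \<in> H" "s \<in> Y" "s' \<in> Y" "dual H c s t" "dual H c s' t'" "\<not> sep c s s'"
  shows "s = s'"
proof (rule eqI)
  fix d assume "d \<in> H"
  then show "\<not> sep d s s'"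
    using not_sep_dual[of c d s t s' t'] assms by (cases "d = c") (auto simp: dual_def)
qed (use assms in auto)

text \<open>The two ends of a dual edge are determined by the side of \<open>c\<close> on which they
  lie, by \<open>dual_eq\<close>. Thus the direction of a chord can be read off any dual pair at
  hand.\<close>

lemma dual_unique:
  assumes "c \<in> H" "s \<in> Y" "t \<in> Y" "s' \<in> Y" "t' \<in> Y" "dual H c s t" "dual H c s' t'" "s < t" "s' < t'"
  shows "s = s' \<and> t = t'"
proof -
  have d: "dual H c t s" "dual H c t' s'" using assms by (simp_all add: dual_commute)
  have *: "sep c s t" "sep c s' t'" using assms by (auto simp: dual_def)
  show ?thesis
  proof (cases "sep c s s'")
    case True
    then have "\<not> sep c s t'" "\<not> sep c t s'" using * by (auto simp: sep_def)
    then have "s = t'" "t = s'" using dual_eq[of c s t' t s'] dual_eq[of c t s' s t'] assms d by auto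
    then show ?thesis using assms by simp
  next
    case False
    then have "\<not> sep c t t'" using * by (auto simp: sep_def)
    then show ?thesis using False dual_eq[of c s s' t t'] dual_eq[of c t t' s s'] assms d by auto
  qed
qed

text \<open>Take \<open>w\<close> as the root of the dual tree: \<open>u\<close> is then the end of
  the dual edge of \<open>c\<close> away from \<open>w\<close>, and \<open>t\<close> the end towards
  \<open>w\<close>.\<close>

lemma inner_dual:
  assumes "c \<in> H" "w \<in> Y"
  obtains u t where "u \<in> Y" "t \<in> Y" "dual H c u t" "sep c u w" "\<not> sep c t w"
proof -
  obtain s t where st: "s \<in> Y" "t \<in> Y" "dual H c s t" using dualE[OF assms(1)] by metis
  then have "sep c s t" using assms by (simp add: dual_def)
  then show ?thesis
    using that[of s t] that[of t s] st sep_trans[of c s t w] sep_commute dual_commute by metis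
qed

text \<open>At most one dual edge leads from \<open>u\<close> towards \<open>w\<close>: for two of
  them, \<open>u\<close>, \<open>t\<close>, \<open>t'\<close> and \<open>w\<close> would contradict
  \<open>no_quadrants\<close>.\<close>

lemma inner_chord_unique:
  assumes "c \<in> H" "d \<in> H" "dual H c u t" "dual H d u t'" "sep c u w" "\<not> sep c t w" "sep d u w" "\<not> sep d t' w"
  shows "c = d"
proof (rule ccontr)
  assume "c \<noteq> d"
  then have "\<not> sep d u t" "\<not> sep c u t'" using assms by (auto simp: dual_def)
  then have "sep d t w" "sep c t' w" using assms(5,7) by (auto simp: sep_def)
  then show False using no_quadrants[OF assms(1,2,5,7), of t' t] assms by blast
qed

text \<open>The dual edge from \<open>u\<close> towards \<open>w\<close> belongs to the chord that
  separates them and cuts off the fewest sides from \<open>w\<close>. By minimality every other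
  chord separating \<open>u\<close> from \<open>w\<close> cuts off at least these sides.\<close>

lemma innermost:
  assumes u: "u \<in> Y" "w \<in> Y" "u \<noteq> w"
  obtains c t where "c \<in> H" "t \<in> Y" "dual H c u t" "sep c u w" "\<not> sep c t w"
    "\<And>d x. d \<in> H \<Longrightarrow> sep d u w \<Longrightarrow> sep c x w \<Longrightarrow> x \<in> Y \<Longrightarrow> sep d x w"
proof -
  define F where "F c = {x \<in> Y. sep c x w}" for c
  have fin: "finite (F c)" for c using finite_Y by (simp add: F_def)
  obtain c0 where "c0 \<in> H \<and> sep c0 u w" using separated u by blast
  then obtain c where c: "c \<in> H" "sep c u w" and min: "\<And>d. d \<in> H \<Longrightarrow> sep d u w \<Longrightarrow> card (F c) \<le> card (F d)"
    using ex_has_least_nat[of "\<lambda>c. c \<in> H \<and> sep c u w" c0 "\<lambda>c. card (F c)"] by blast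
  have nested: "sep d x w" if d: "d \<in> H" "sep d u w" "sep c x w" "x \<in> Y" for d x
  proof (rule ccontr)
    assume x: "\<not> sep d x w"
    have "F d \<subseteq> F c" using no_quadrants[of c d u w x] c d x by (auto simp: F_def)
    moreover have "x \<in> F c - F d" using d x by (simp add: F_def)
    ultimately have "card (F d) < card (F c)" using fin by (intro psubset_card_mono) auto
    then show False using min d by fastforce
  qed
  obtain s t where st: "s \<in> Y" "t \<in> Y" "dual H c s t" "sep c s w" "\<not> sep c t w"
    using inner_dual[OF c(1) u(2)] by metis
  \<comment> \<open>A chord between \<open>s\<close> and \<open>u\<close> would either violate the
    nesting of the chords that separate \<open>u\<close> from \<open>w\<close>, or give a forbidden
    configuration with \<open>c\<close>.\<close>
  have "s = u"
  proof (rule eqI)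
    fix d assume d: "d \<in> H"
    show "\<not> sep d s u"
    proof
      assume su: "sep d s u"
      then have ne: "d \<noteq> c" using st(4) c(2) by (auto simp: sep_def)
      then have sd: "\<not> sep d s t" using st d by (auto simp: dual_def)
      show False
      proof (cases "sep d u w")
        case True
        then show False using nested[OF d True st(4,1)] su by (auto simp: sep_def)
      next
        case False
        then have "sep d s w" "sep d t w" using su sd by (auto simp: sep_def)
        then show False using no_quadrants[of c d s w u t] c d st False by blast
      qed
    qed
  qed (use st u in auto)
  then show ?thesis using that c st nested by blast
qed

text \<open>As for any tree: after the choice of a root \<open>w\<close>, each other vertex is
  matched with its edge towards \<open>w\<close>.\<close>

lemma card_eq: "card Y = card H + 1"
proof -
  obtain w where w: "w \<in> Y" using Y_ne by blast
  define R where "R u c \<longleftrightarrow> c \<in> H \<and> u \<in> Y \<and> sep c u w \<and> (\<exists>t\<in>Y. dual H c u t \<and> \<not> sep c t w)" for u c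
  have "\<exists>c. R u c" if "u \<in> Y - {w}" for u
    using innermost[of u w] w that unfolding R_def by (metis DiffE insertI1)
  then obtain f where f: "\<And>u. u \<in> Y - {w} \<Longrightarrow> R u (f u)" by metis
  have "bij_betw f (Y - {w}) H"
  proof (rule bij_betw_imageI)
    show "inj_on f (Y - {w})"
    proof (rule inj_onI)
      fix u v assume "u \<in> Y - {w}" "v \<in> Y - {w}" "f u = f v"
      then obtain t t' where "f u \<in> H" "u \<in> Y" "v \<in> Y" "dual H (f u) u t" "dual H (f u) v t'" "sep (f u) u w" "sep (f u) v w"
        using f[of u] f[of v] by (auto simp: R_def)
      then show "u = v" using dual_eq[of "f u" u v t t'] by (auto simp: sep_def)
    qed
    show "f ` (Y - {w}) = H"
    proof
      show "f ` (Y - {w}) \<subseteq> H" using f by (auto simp: R_def)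
      show "H \<subseteq> f ` (Y - {w})"
      proof
        fix c assume c: "c \<in> H"
        obtain u t where u: "u \<in> Y" "t \<in> Y" "dual H c u t" "sep c u w" "\<not> sep c t w"
          using inner_dual[OF c w] by metis
        then have uw: "u \<in> Y - {w}" by auto
        then obtain t' where "f u \<in> H" "dual H (f u) u t'" "sep (f u) u w" "\<not> sep (f u) t' w"
          using f[of u] by (auto simp: R_def)
        then have "f u = c" using inner_chord_unique[of "f u" c u t' t w] c u by blast
        then show "c \<in> f ` (Y - {w})" using uw by blast
      qed
    qed
  qed
  then have "card (Y - {w}) = card H" by (rule bij_betw_same_card)
  then show ?thesis using w finite_Y card_Suc_Diff1[of Y w] by simp
qed

end

subsection \<open>Faces\<close>

definition face_at :: "nat set \<Rightarrow> nat set set \<Rightarrow> nat \<Rightarrow> nat set" where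
  "face_at Y C s = {t \<in> Y. \<forall>c\<in>C. \<not> sep c s t}"

definition sfaces :: "nat set \<Rightarrow> nat set set \<Rightarrow> nat set set" where
  "sfaces Y C = face_at Y C ` Y"

text \<open>A chord inside a face is recognised by separating two sides of that face, without
  reference to vertices; \<open>inner_iff\<close> compares this with the definition by
  vertices.\<close>

definition sinner :: "nat set set \<Rightarrow> nat set set \<Rightarrow> nat set \<Rightarrow> nat set set" where
  "sinner H C \<alpha> = {c \<in> H - C. \<exists>s\<in>\<alpha>. \<exists>t\<in>\<alpha>. sep c s t}"

text \<open>These are the sides that survive in \<open>r_graph\<close>. Each stands for its face, so
  they are the vertices of the contracted dual tree.\<close>

definition mins :: "nat set \<Rightarrow> nat set set \<Rightarrow> nat set" where
  "mins Y C = Min ` sfaces Y C"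

lemma face_at_subset: "face_at Y C s \<subseteq> Y"
  and face_at_self: "s \<in> Y \<Longrightarrow> s \<in> face_at Y C s"
  by (auto simp: face_at_def)

lemma face_at_eq: "t \<in> face_at Y C s \<Longrightarrow> face_at Y C t = face_at Y C s"
  unfolding face_at_def sep_def by blast

lemma finite_face_at: "finite Y \<Longrightarrow> finite (face_at Y C s)"
  by (simp add: face_at_def)

lemma sfaces_eq: "\<alpha> \<in> sfaces Y C \<Longrightarrow> s \<in> \<alpha> \<Longrightarrow> \<alpha> = face_at Y C s"
  unfolding sfaces_def using face_at_eq by blast

lemma sfacesD:
  assumes "\<alpha> \<in> sfaces Y C"
  shows "\<alpha> \<subseteq> Y" "\<alpha> \<noteq> {}" "finite Y \<Longrightarrow> finite \<alpha>"
  using assms face_at_subset face_at_self finite_face_at unfolding sfaces_def by (blast, force, force)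

lemma not_sep_face: "\<alpha> \<in> sfaces Y C \<Longrightarrow> s \<in> \<alpha> \<Longrightarrow> t \<in> \<alpha> \<Longrightarrow> c \<in> C \<Longrightarrow> \<not> sep c s t"
  using sfaces_eq[of \<alpha> Y C s] by (auto simp: face_at_def)

lemma sfaces_disjoint: "\<alpha> \<in> sfaces Y C \<Longrightarrow> \<beta> \<in> sfaces Y C \<Longrightarrow> \<alpha> \<noteq> \<beta> \<Longrightarrow> \<alpha> \<inter> \<beta> = {}"
  using sfaces_eq by blast

lemma finite_sfaces: "finite Y \<Longrightarrow> finite (sfaces Y C)"
  by (simp add: sfaces_def)

lemma Min_face:
  assumes "finite Y" "s \<in> Y"
  shows "Min (face_at Y C s) \<in> face_at Y C s"
  using assms face_at_self[of s Y C] finite_face_at by (intro Min_in) auto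

lemma face_at_Min:
  assumes "finite Y" "s \<in> Y"
  shows "face_at Y C (Min (face_at Y C s)) = face_at Y C s"
  using face_at_eq[OF Min_face[OF assms]] .

lemma mins_subset: "finite Y \<Longrightarrow> mins Y C \<subseteq> Y"
  using Min_face face_at_subset unfolding mins_def sfaces_def by blast

lemma mins_iff:
  assumes "finite Y"
  shows "m \<in> mins Y C \<longleftrightarrow> m \<in> Y \<and> Min (face_at Y C m) = m"
proof
  assume m: "m \<in> mins Y C"
  then obtain s where s: "s \<in> Y" "m = Min (face_at Y C s)" by (auto simp: mins_def sfaces_def)
  then show "m \<in> Y \<and> Min (face_at Y C m) = m"
    using face_at_Min[OF assms s(1), of C] mins_subset[OF assms] m by auto
next
  assume "m \<in> Y \<and> Min (face_at Y C m) = m"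
  then show "m \<in> mins Y C" unfolding mins_def sfaces_def by (metis imageI)
qed

lemma Min_mins: "s \<in> Y \<Longrightarrow> Min (face_at Y C s) \<in> mins Y C"
  by (auto simp: mins_def sfaces_def)

lemma sep_Min:
  assumes "finite Y" "s \<in> Y" "c \<in> C"
  shows "\<not> sep c s (Min (face_at Y C s))"
  using Min_face[OF assms(1,2), of C] assms(3) by (auto simp: face_at_def)

section \<open>Restriction to a face and contraction onto the least sides\<close>

context tree_system
begin

text \<open>\<open>c\<close> separates both \<open>s\<close>, \<open>t\<close> and two sides of
  \<alpha>, while no chord in \<open>C\<close> separates either pair; by \<open>not_sep_dual\<close>
  no chord in \<open>C\<close> separates one pair from the other.\<close>

lemma restrict_dual:
  assumes "C \<subseteq> H" "\<alpha> \<in> sfaces Y C" "c \<in> sinner H C \<alpha>" "s \<in> Y" "t \<in> Y" "dual H c s t"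
  shows "s \<in> \<alpha>" "t \<in> \<alpha>"
proof -
  obtain s' t' where *: "c \<in> H" "c \<notin> C" "s' \<in> \<alpha>" "t' \<in> \<alpha>" "sep c s' t'" using assms(3) by (auto simp: sinner_def)
  have 1: "\<not> sep d s t" "\<not> sep d s' t'" if "d \<in> C" for d
    using assms(1,2,6) * that not_sep_face by (auto simp: dual_def)
  have "\<not> sep d s' s" if "d \<in> C" for d
    using not_sep_dual[of c d s' t' s t] * 1[OF that] that assms by (auto simp: dual_def)
  then have "s \<in> face_at Y C s'" using assms(4) by (simp add: face_at_def)
  moreover have "t \<in> face_at Y C s'"
    using 1 \<open>\<And>d. d \<in> C \<Longrightarrow> \<not> sep d s' s\<close> assms(5) sep_trans[of _ s' t s] by (simp add: face_at_def)
  ultimately show "s \<in> \<alpha>" "t \<in> \<alpha>" using sfaces_eq[OF assms(2) *(3)] by auto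
qed

lemma restrict_tree:
  assumes "C \<subseteq> H" "\<alpha> \<in> sfaces Y C"
  shows "tree_sys \<alpha> (sinner H C \<alpha>)"
  unfolding tree_sys_def
proof (intro conjI ballI impI)
  have sub: "sinner H C \<alpha> \<subseteq> H" by (auto simp: sinner_def)
  show "finite \<alpha>" "\<alpha> \<noteq> {}" using assms finite_Y sfacesD by auto
  show "finite (sinner H C \<alpha>)" using sub finite_H finite_subset by blast
  show "noncrossing (sinner H C \<alpha>)" using sub noncrossing by (auto simp: noncrossing_def)
  show "\<exists>a b. a \<noteq> b \<and> c = {a, b}" if "c \<in> sinner H C \<alpha>" for c using sub that chordE by blast
  show "\<exists>c\<in>sinner H C \<alpha>. sep c s t" if st: "s \<in> \<alpha>" "t \<in> \<alpha>" "s \<noteq> t" for s t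
  proof -
    have "s \<in> Y" "t \<in> Y" using st sfacesD(1)[OF assms(2)] by auto
    then obtain c where c: "c \<in> H" "sep c s t" using separated[of s t] st(3) by auto
    then have "c \<in> sinner H C \<alpha>" using not_sep_face[OF assms(2) that(1,2)] that by (auto simp: sinner_def)
    then show ?thesis using c by blast
  qed
  show "\<exists>s\<in>\<alpha>. \<exists>t\<in>\<alpha>. s < t \<and> dual (sinner H C \<alpha>) c s t" if c: "c \<in> sinner H C \<alpha>" for c
  proof -
    obtain s t where "s \<in> Y" "t \<in> Y" "s < t" "dual H c s t" using dualE subsetD[OF sub c] by metis
    then show ?thesis using restrict_dual[OF assms c] dual_mono[OF _ sub] by blast
  qed
qed

lemma mins_dual:
  assumes "C \<subseteq> H" "s \<in> Y" "t \<in> Y" "dual H c s t"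
  shows "dual C c (Min (face_at Y C s)) (Min (face_at Y C t))"
  unfolding dual_def
proof
  fix d assume d: "d \<in> C"
  have "sep d (Min (face_at Y C s)) (Min (face_at Y C t)) \<longleftrightarrow> sep d s t"
    using sep_Min[OF finite_Y _ d] assms(2,3) sep_subst by blast
  then show "sep d (Min (face_at Y C s)) (Min (face_at Y C t)) \<longleftrightarrow> d = c" using assms d by (auto simp: dual_def)
qed

lemma mins_tree:
  assumes "C \<subseteq> H"
  shows "tree_sys (mins Y C) C"
  unfolding tree_sys_def
proof (intro conjI ballI impI)
  show "finite (mins Y C)" "mins Y C \<noteq> {}"
    using finite_Y Y_ne by (auto simp: mins_def sfaces_def)
  show "finite C" using assms finite_H finite_subset by blast
  show "noncrossing C" using assms noncrossing by (auto simp: noncrossing_def)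
  show "\<exists>a b. a \<noteq> b \<and> c = {a, b}" if "c \<in> C" for c using assms that chordE by blast
  show "\<exists>c\<in>C. sep c s t" if "s \<in> mins Y C" "t \<in> mins Y C" "s \<noteq> t" for s t
  proof (rule ccontr)
    assume "\<not> ?thesis"
    then have "t \<in> face_at Y C s" using that mins_subset[OF finite_Y] by (auto simp: face_at_def)
    then have "face_at Y C t = face_at Y C s" by (rule face_at_eq)
    then show False using that by (metis mins_iff[OF finite_Y])
  qed
  show "\<exists>s\<in>mins Y C. \<exists>t\<in>mins Y C. s < t \<and> dual C c s t" if c: "c \<in> C" for c
  proof -
    obtain s t where st: "s \<in> Y" "t \<in> Y" "dual H c s t" using dualE subsetD[OF assms c] by metis
    let ?s = "Min (face_at Y C s)" and ?t = "Min (face_at Y C t)"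
    have d: "dual C c ?s ?t" "dual C c ?t ?s" using mins_dual[OF assms st] by (simp_all add: dual_commute)
    then have "?s \<noteq> ?t" using c by (auto simp: dual_def)
    then show ?thesis using d Min_mins[of s Y C] Min_mins[of t Y C] st by (metis linorder_neqE_nat)
  qed
qed

end

subsection \<open>Renumbering\<close>

definition ix :: "nat set \<Rightarrow> nat \<Rightarrow> nat" where
  "ix Y k = sorted_list_of_set Y ! k"

definition cnt :: "nat set \<Rightarrow> nat \<Rightarrow> nat" where
  "cnt Y v = card {s \<in> Y. s < v}"

text \<open>Vertex \<open>v\<close> is sent to the number of the first side in \<open>Y\<close> starting at \<open>v\<close> or later; after the
  last side in \<open>Y\<close> one returns to number 0.\<close>

definition nu :: "nat set \<Rightarrow> nat \<Rightarrow> nat" where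
  "nu Y v = cnt Y v mod card Y"

context
  fixes Y :: "nat set"
  assumes fin: "finite Y"
begin

lemma ix_in: "k < card Y \<Longrightarrow> ix Y k \<in> Y"
  using fin by (metis ix_def length_sorted_list_of_set nth_mem set_sorted_list_of_set)

lemma ix_less: "k < l \<Longrightarrow> l < card Y \<Longrightarrow> ix Y k < ix Y l"
  using strict_sorted_list_of_set[of Y] fin by (simp add: ix_def sorted_wrt_iff_nth_less)

lemma ix_less_iff: "k < card Y \<Longrightarrow> l < card Y \<Longrightarrow> ix Y k < ix Y l \<longleftrightarrow> k < l"
  by (metis ix_less linorder_neqE_nat not_less_iff_gr_or_eq)

lemma ix_inj: "k < card Y \<Longrightarrow> l < card Y \<Longrightarrow> ix Y k = ix Y l \<longleftrightarrow> k = l"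
  by (metis ix_less_iff less_irrefl linorder_neqE_nat)

lemma ix_image: "ix Y ` {..<card Y} = Y"
proof -
  have "ix Y ` {..<card Y} = set (sorted_list_of_set Y)"
    by (auto simp: set_conv_nth ix_def)
  then show ?thesis using fin by simp
qed

lemma ix_surj:
  assumes "s \<in> Y"
  obtains k where "k < card Y" "s = ix Y k"
  using assms ix_image by (metis imageE lessThan_iff)

lemma cnt_le: "cnt Y v \<le> card Y"
  unfolding cnt_def using fin by (intro card_mono) auto

text \<open>The adjunction between \<open>ix\<close> and \<open>cnt\<close>; statements about vertex
  numbers are reduced to comparisons with sides through it.\<close>

lemma less_cnt_iff:
  assumes "k < card Y"
  shows "k < cnt Y v \<longleftrightarrow> ix Y k < v"
proof
  assume "ix Y k < v"
  then have "ix Y ` {..k} \<subseteq> {s \<in> Y. s < v}"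
    using assms ix_in ix_less by (auto simp: le_less) (metis ix_in le_less_trans less_imp_le_nat, metis less_trans)
  then have "card (ix Y ` {..k}) \<le> cnt Y v" unfolding cnt_def using fin by (intro card_mono) auto
  moreover have "inj_on (ix Y) {..k}" using assms by (auto simp: inj_on_def ix_inj)
  ultimately show "k < cnt Y v" by (simp add: card_image)
next
  assume k: "k < cnt Y v"
  show "ix Y k < v"
  proof (rule ccontr)
    assume "\<not> ix Y k < v"
    then have "{s \<in> Y. s < v} \<subseteq> ix Y ` {..<k}"
      using ix_surj assms by (smt (verit) image_iff ix_less lessThan_iff less_trans linorder_neqE_nat mem_Collect_eq subsetI)
    then have "cnt Y v \<le> card (ix Y ` {..<k})" unfolding cnt_def by (intro card_mono) auto
    also have "\<dots> \<le> k" using card_image_le[of "{..<k}" "ix Y"] by simp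
    finally show False using k by simp
  qed
qed

lemma cnt_ix:
  assumes "k < card Y"
  shows "cnt Y (ix Y k) = k"
proof (rule antisym)
  show "cnt Y (ix Y k) \<le> k" using less_cnt_iff[OF assms, of "ix Y k"] by simp
  show "k \<le> cnt Y (ix Y k)"
  proof (rule ccontr)
    assume "\<not> k \<le> cnt Y (ix Y k)"
    then show False
      using less_cnt_iff[of "cnt Y (ix Y k)" "ix Y k"] ix_less[of "cnt Y (ix Y k)" k] assms by simp
  qed
qed

lemma nu_ix: "k < card Y \<Longrightarrow> nu Y (ix Y k) = k"
  by (simp add: nu_def cnt_ix)

lemma ix_nu:
  assumes "s \<in> Y"
  shows "ix Y (nu Y s) = s"
proof -
  obtain k where "k < card Y" "s = ix Y k" using ix_surj[OF assms] .
  then show ?thesis using nu_ix by simp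
qed

lemma nu_less: "Y \<noteq> {} \<Longrightarrow> nu Y v < card Y"
  using fin by (simp add: nu_def card_gt_0_iff)

text \<open>A vertex after the last side in \<open>Y\<close> gets number 0, which lies in no cut
  \<open>{k<..l}\<close>; so the wrap-around does no harm. For the other vertices \<open>nu\<close>
  is the monotone count \<open>cnt\<close>.\<close>

lemma nu_interval:
  assumes "k < l" "l < card Y"
  shows "nu Y v \<in> {k<..l} \<longleftrightarrow> v \<in> {ix Y k<..ix Y l}"
proof (cases "cnt Y v = card Y")
  case True
  then have "\<not> v \<le> ix Y l" using less_cnt_iff[OF assms(2), of v] assms(2) by simp
  then show ?thesis using True by (simp add: nu_def)
next
  case False
  then have "nu Y v = cnt Y v" using cnt_le[of v] by (simp add: nu_def)
  then show ?thesis using less_cnt_iff[of k v] less_cnt_iff[of l v] assms by auto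
qed

lemma sep_nu_less:
  assumes "k < l" "l < card Y"
  shows "sep (nu Y ` {a, b}) k l \<longleftrightarrow> sep {a, b} (ix Y k) (ix Y l)"
  using nu_interval[OF assms] ix_less[OF assms] assms by (simp add: sep_cut)

lemma sep_nu:
  assumes "k < card Y" "l < card Y"
  shows "sep (nu Y ` {a, b}) k l \<longleftrightarrow> sep {a, b} (ix Y k) (ix Y l)"
  using sep_nu_less[of k l a b] sep_nu_less[of l k a b] assms
  by (cases k l rule: linorder_cases) (auto simp: sep_commute)

end

lemma nu_image_inj: "finite Y \<Longrightarrow> inj_on (nu Y) Y"
  by (metis inj_on_inverseI ix_nu)

lemma nu_image_eq: 
  assumes "finite Y" "Z \<subseteq> Y"
  shows "k \<in> nu Y ` Z \<longleftrightarrow> k < card Y \<and> ix Y k \<in> Z"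
proof
  assume "k \<in> nu Y ` Z"
  then show "k < card Y \<and> ix Y k \<in> Z" using assms ix_nu nu_less[OF assms(1)] by (metis empty_iff imageE subsetD)
next
  assume "k < card Y \<and> ix Y k \<in> Z"
  then show "k \<in> nu Y ` Z" using nu_ix[OF assms(1)] by (metis imageI)
qed

lemma card_nu_image: "finite Y \<Longrightarrow> Z \<subseteq> Y \<Longrightarrow> card (nu Y ` Z) = card Z"
  by (meson card_image inj_on_subset nu_image_inj)

lemma cnt_nu_image:
  assumes "finite Y" "Z \<subseteq> Y" "k \<le> card Y" "\<And>j. j < card Y \<Longrightarrow> j < k \<longleftrightarrow> ix Y j < v"
  shows "cnt (nu Y ` Z) k = cnt Z v"
proof -
  have "{j \<in> nu Y ` Z. j < k} = nu Y ` {s \<in> Z. s < v}"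
    using assms nu_image_eq[OF assms(1,2)] nu_image_eq[OF assms(1), of "{s \<in> Z. s < v}"] by blast
  then show ?thesis unfolding cnt_def using card_nu_image[OF assms(1), of "{s \<in> Z. s < v}"] assms(2) by auto
qed

text \<open>Needed because \<open>real_diag\<close> renumbers once more whatever has been taken from
  a renumbered polygon.\<close>

lemma nu_nu:
  assumes "finite Y" "Z \<subseteq> Y" "Z \<noteq> {}"
  shows "nu (nu Y ` Z) (nu Y v) = nu Z v"
proof (cases "cnt Y v = card Y")
  case True
  have z: "ix Y k < v" if "k < card Y" for k using less_cnt_iff[OF assms(1) that, of v] True that by simp
  have "cnt Z v = card Z"
    unfolding cnt_def by (rule arg_cong[where f = card]) (use z assms in \<open>auto elim: ix_surj[OF assms(1)]\<close>)
  then show ?thesis using True by (simp add: nu_def cnt_def)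
next
  case False
  then have c: "cnt Y v < card Y" using cnt_le[OF assms(1), of v] by simp
  then have "cnt (nu Y ` Z) (nu Y v) = cnt Z v"
    by (intro cnt_nu_image assms) (simp_all add: nu_def less_cnt_iff[OF assms(1)])
  then show ?thesis using card_nu_image[OF assms(1,2)] by (simp add: nu_def)
qed

lemma ix_ix:
  assumes "finite Y" "Z \<subseteq> Y" "k < card Z"
  shows "ix Y (ix (nu Y ` Z) k) = ix Z k"
proof -
  have fZ: "finite Z" using assms finite_subset by blast
  have "ix (nu Y ` Z) k \<in> nu Y ` Z" using ix_in[of "nu Y ` Z" k] fZ assms by (simp add: card_nu_image)
  then have "ix Y (ix (nu Y ` Z) k) \<in> Z" using nu_image_eq[OF assms(1,2)] by blast
  then obtain j where j: "j < card Z" "ix Y (ix (nu Y ` Z) k) = ix Z j" using ix_surj[OF fZ] by metis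
  have "ix (nu Y ` Z) k = nu Y (ix Z j)"
    using j \<open>ix (nu Y ` Z) k \<in> nu Y ` Z\<close> nu_image_eq[OF assms(1,2)] nu_ix[OF assms(1)] by metis
  moreover have "nu (nu Y ` Z) (nu Y (ix Z j)) = j" using nu_nu[OF assms(1,2)] nu_ix[OF fZ] j assms(3)
    by (metis card.empty not_less_zero)
  moreover have "nu (nu Y ` Z) (ix (nu Y ` Z) k) = k" using nu_ix[of "nu Y ` Z" k] fZ assms by (simp add: card_nu_image)
  ultimately show ?thesis using j by simp
qed

subsection \<open>The coproduct of a tree system\<close>

text \<open>The normal form up to translation, with 0 on all chords. The default 0 beyond the last
  side makes the record depend on \<open>b\<close> only through its values on \<open>Y\<close>, as
  \<open>real_diag_cong\<close> requires.\<close>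

definition real_diag :: "nat set \<Rightarrow> nat set set \<Rightarrow> (nat \<Rightarrow> 'l::ab_group_add) \<Rightarrow> 'l diagram" where
  "real_diag Y H b = \<lparr>deg = card H, chords = (\<lambda>c. nu Y ` c) ` H,
     deco = (\<lambda>e. case e of Side k \<Rightarrow> (if k < card Y then b (ix Y k) else 0) | Chord _ \<Rightarrow> 0)\<rparr>"

definition gen :: "nat set \<Rightarrow> nat set set \<Rightarrow> (nat \<Rightarrow> 'l::ab_group_add) \<Rightarrow> 'l dd_algebra" where
  "gen Y H b = dd (real_diag Y H b)"

definition bsum :: "nat set \<Rightarrow> nat set set \<Rightarrow> (nat \<Rightarrow> 'l::ab_group_add) \<Rightarrow> nat \<Rightarrow> 'l" where
  "bsum Y C b m = (\<Sum>s\<in>face_at Y C m. b s)"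

text \<open>The two ends of \<open>c\<close> lie on different sides of the cut \<open>{s<..t}\<close>; the one inside is cut off
  from the root 0, so that the chord leaves it.\<close>

definition orient :: "nat set \<Rightarrow> nat set set \<Rightarrow> nat set \<Rightarrow> bool" where
  "orient Y H c \<longleftrightarrow> (\<exists>s\<in>Y. \<exists>t\<in>Y. s < t \<and> dual H c s t \<and> Min c \<in> {s<..t})"

text \<open>The counterpart of \<open>flipped_chords\<close>: the chords whose direction in the
  contraction differs from the one in the whole system.\<close>

definition flips :: "nat set \<Rightarrow> nat set set \<Rightarrow> nat set set \<Rightarrow> nat set set" where
  "flips Y H C = {c \<in> C. orient Y H c \<noteq> orient (mins Y C) C c}"

definition cop_term ::
  "nat set \<Rightarrow> nat set set \<Rightarrow> (nat \<Rightarrow> 'l::ab_group_add) \<Rightarrow> nat set set \<Rightarrow>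
    ('l dd_generator multiset \<times> 'l dd_generator multiset \<Rightarrow>\<^sub>0 rat)" where
  "cop_term Y H b C = qscale ((-1) ^ card (flips Y H C))
     ((\<Prod>\<alpha>\<in>sfaces Y C. gen \<alpha> (sinner H C \<alpha>) b) \<otimes> gen (mins Y C) C (bsum Y C b))"

definition cop ::
  "nat set \<Rightarrow> nat set set \<Rightarrow> (nat \<Rightarrow> 'l::ab_group_add) \<Rightarrow>
    ('l dd_generator multiset \<times> 'l dd_generator multiset \<Rightarrow>\<^sub>0 rat)" where
  "cop Y H b = (\<Sum>C\<in>Pow H. cop_term Y H b C)"

lemma real_diag_cong:
  assumes "finite Y" "\<And>s. s \<in> Y \<Longrightarrow> b s = b' s"
  shows "real_diag Y H b = real_diag Y H b'"
  using assms(2) ix_in[OF assms(1)] by (auto simp: real_diag_def fun_eq_iff split: edge.split)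

lemma gen_cong: "finite Y \<Longrightarrow> (\<And>s. s \<in> Y \<Longrightarrow> b s = b' s) \<Longrightarrow> gen Y H b = gen Y H b'"
  unfolding gen_def using real_diag_cong[of Y b b' H] by simp

lemma nu_less_mono:
  assumes "finite Y" "s \<in> Y" "t \<in> Y" "s < t"
  shows "nu Y s < nu Y t"
proof -
  obtain k l where *: "k < card Y" "s = ix Y k" "l < card Y" "t = ix Y l"
    using ix_surj[OF assms(1,2)] ix_surj[OF assms(1,3)] by metis
  then show ?thesis using assms ix_less_iff[OF assms(1), of k l] by (simp add: nu_ix)
qed

lemma nu_image_self: 
  assumes "finite Y" shows "nu Y ` Y = {..<card Y}"
  using nu_image_eq[OF assms, of Y] ix_in[OF assms] by auto

lemma Min_nu_image:
  assumes "finite Y" "\<alpha> \<subseteq> Y" "\<alpha> \<noteq> {}"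
  shows "Min (nu Y ` \<alpha>) = nu Y (Min \<alpha>)"
proof (rule Min_eqI)
  have fa: "finite \<alpha>" using assms finite_subset by blast
  then show "finite (nu Y ` \<alpha>)" by simp
  show "nu Y (Min \<alpha>) \<in> nu Y ` \<alpha>" using Min_in[OF fa assms(3)] by simp
  fix k assume "k \<in> nu Y ` \<alpha>"
  then obtain s where s: "s \<in> \<alpha>" "k = nu Y s" by blast
  have "Min \<alpha> \<le> s" using fa s by simp
  moreover have "Min \<alpha> \<in> Y" "s \<in> Y" using Min_in[OF fa assms(3)] assms s by auto
  ultimately show "nu Y (Min \<alpha>) \<le> k" using nu_less_mono[OF assms(1), of "Min \<alpha>" s] s by (cases "Min \<alpha> = s") auto
qed

section \<open>Directions of chords and invariance under renumbering\<close>

context tree_system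
begin

lemma orient_iff:
  assumes "c \<in> H" "s \<in> Y" "t \<in> Y" "s < t" "dual H c s t"
  shows "orient Y H c \<longleftrightarrow> Min c \<in> {s<..t}"
proof
  assume "orient Y H c"
  then obtain s' t' where "s' \<in> Y" "t' \<in> Y" "s' < t'" "dual H c s' t'" "Min c \<in> {s'<..t'}"
    unfolding orient_def by blast
  then show "Min c \<in> {s<..t}" using dual_unique[of c s t s' t'] assms by simp
next
  assume "Min c \<in> {s<..t}"
  then show "orient Y H c" unfolding orient_def using assms by blast
qed

text \<open>Either end of \<open>c\<close> may be used for the comparison: replacing it by the other
  end changes both memberships, since \<open>c\<close> crosses both cuts.\<close>

lemma flip_iff:
  assumes "C \<subseteq> H" "c \<in> C" "v \<in> c"
    and st: "s \<in> Y" "t \<in> Y" "s < t" "dual H c s t"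
    and st': "s' \<in> mins Y C" "t' \<in> mins Y C" "s' < t'" "dual C c s' t'"
  shows "c \<in> flips Y H C \<longleftrightarrow> (v \<in> {s<..t}) \<noteq> (v \<in> {s'<..t'})"
proof -
  interpret M: tree_system "mins Y C" C using mins_tree[OF assms(1)] by unfold_locales
  have c: "c \<in> H" using assms by blast
  obtain a b where ab: "a \<noteq> b" "c = {a, b}" using chordE[OF c] .
  have "sep c s t" "sep c s' t'" using st st' c assms(2) by (auto simp: dual_def)
  then have 1: "(a \<in> {s<..t}) \<noteq> (b \<in> {s<..t})" "(a \<in> {s'<..t'}) \<noteq> (b \<in> {s'<..t'})"
    using sep_cut[OF st(3), of a b] sep_cut[OF st'(3), of a b] ab by simp_all
  have 2: "Min c = a \<or> Min c = b" "v = a \<or> v = b" using ab assms(3) by (auto simp: min_def)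
  have "c \<in> flips Y H C \<longleftrightarrow> (Min c \<in> {s<..t}) \<noteq> (Min c \<in> {s'<..t'})"
    using orient_iff[OF c st] M.orient_iff[OF assms(2) st'] assms(2) by (simp add: flips_def)
  then show ?thesis using 1 2 by metis
qed

lemma sep_image:
  assumes "c \<in> H" "s \<in> Y" "t \<in> Y"
  shows "sep (nu Y ` c) (nu Y s) (nu Y t) \<longleftrightarrow> sep c s t"
proof -
  obtain a b where c: "c = {a, b}" using chordE[OF assms(1)] .
  show ?thesis unfolding c
    using sep_nu[OF finite_Y nu_less[OF finite_Y Y_ne] nu_less[OF finite_Y Y_ne], of a b s t]
      ix_nu[OF finite_Y assms(2)] ix_nu[OF finite_Y assms(3)] by simp
qed

text \<open>Chords with the same image separate the same sides of \<open>Y\<close>, and the dual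
  edge of a chord is separated by no other chord.\<close>

lemma inj_on_image_chords: "inj_on ((`) (nu Y)) H"
proof (rule inj_onI)
  fix c d assume cd: "c \<in> H" "d \<in> H" "nu Y ` c = nu Y ` d"
  obtain s t where st: "s \<in> Y" "t \<in> Y" "dual H c s t" using dualE[OF cd(1)] .
  then have "sep c s t" using cd by (simp add: dual_def)
  then have "sep d s t" using sep_image[OF cd(1) st(1,2)] sep_image[OF cd(2) st(1,2)] cd by simp
  then show "c = d" using st cd by (simp add: dual_def)
qed

lemma dual_image:
  assumes "K \<subseteq> H" "c \<in> K" "s \<in> Y" "t \<in> Y" "dual K c s t"
  shows "dual ((`) (nu Y) ` K) (nu Y ` c) (nu Y s) (nu Y t)"
  unfolding dual_def
proof
  fix d' assume "d' \<in> (`) (nu Y) ` K"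
  then obtain d where d: "d \<in> K" "d' = nu Y ` d" by blast
  then have "sep d' (nu Y s) (nu Y t) \<longleftrightarrow> d = c" using sep_image[of d s t] assms by (auto simp: dual_def)
  then show "sep d' (nu Y s) (nu Y t) \<longleftrightarrow> d' = nu Y ` c"
    using inj_onD[OF inj_on_image_chords, of d c] d assms by blast
qed

lemma image_tree: "tree_sys (nu Y ` Y) ((`) (nu Y) ` H)"
  unfolding tree_sys_def
proof (intro conjI ballI impI)
  show "finite (nu Y ` Y)" "nu Y ` Y \<noteq> {}" "finite ((`) (nu Y) ` H)" using finite_Y Y_ne finite_H by auto
  show "\<exists>c'\<in>(`) (nu Y) ` H. sep c' s' t'" if st': "s' \<in> nu Y ` Y" "t' \<in> nu Y ` Y" "s' \<noteq> t'" for s' t'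
  proof -
    obtain s t where st: "s \<in> Y" "t \<in> Y" "s' = nu Y s" "t' = nu Y t" using st' by blast
    then obtain c where "c \<in> H" "sep c s t" using separated[of s t] st' by blast
    then show ?thesis using sep_image st by blast
  qed
  show "\<exists>s\<in>nu Y ` Y. \<exists>t\<in>nu Y ` Y. s < t \<and> dual ((`) (nu Y) ` H) c' s t" if c': "c' \<in> (`) (nu Y) ` H" for c'
  proof -
    obtain c where c: "c \<in> H" "c' = nu Y ` c" using c' by blast
    obtain s t where "s \<in> Y" "t \<in> Y" "s < t" "dual H c s t" using dualE[OF c(1)] .
    then show ?thesis using dual_image[OF order_refl c(1), of s t] nu_less_mono[OF finite_Y, of s t] c(2) by blast
  qed
  show "\<exists>a b. a \<noteq> b \<and> c' = {a, b}" if c': "c' \<in> (`) (nu Y) ` H" for c'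
  proof -
    obtain c where c: "c \<in> H" "c' = nu Y ` c" using c' by blast
    obtain s t where st: "s \<in> Y" "t \<in> Y" "dual H c s t" using dualE[OF c(1)] .
    obtain a b where ab: "c = {a, b}" using chordE[OF c(1)] .
    have "sep c' (nu Y s) (nu Y t)" using sep_image[OF c(1) st(1,2)] st c by (simp add: dual_def)
    then have "nu Y a \<noteq> nu Y b" using c ab by (auto simp: sep_def arc_pair)
    then show ?thesis using c ab by auto
  qed
  show "noncrossing ((`) (nu Y) ` H)"
    unfolding noncrossing_def
  proof (intro ballI notI)
    fix c' d' assume c': "c' \<in> (`) (nu Y) ` H" and d': "d' \<in> (`) (nu Y) ` H" and cr: "crossing c' d'"
    obtain c d where cd: "c \<in> H" "c' = nu Y ` c" "d \<in> H" "d' = nu Y ` d" using c' d' by blast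
    obtain a b where ab: "c = {a, b}" using chordE[OF cd(1)] .
    obtain p q where pq: "d = {p, q}" using chordE[OF cd(3)] .
    have lt: "nu Y v < card Y" for v using nu_less[OF finite_Y Y_ne] .
    have cr': "Min c' < Min d'" "Min d' < Max c'" "Max c' < Max d'" using cr by (auto simp: crossing_def)
    have mx: "Max d' < card Y" using cd pq lt by (simp add: max_def)
    define f where "f = ix Y"
    have sc: "sep c (f k) (f l) \<longleftrightarrow> sep c' k l" and sd: "sep d (f k) (f l) \<longleftrightarrow> sep d' k l"
      if "k < card Y" "l < card Y" for k l
      using sep_nu[OF finite_Y that] ab pq cd by (simp_all add: f_def)
    have arcs: "arc c' = {Min c'..<Max c'}" "arc d' = {Min d'..<Max d'}" by (simp_all add: arc_def)
    \<comment> \<open>The sides numbered by the four ends of a crossing realise all four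
      combinations, the one numbered \<open>Max d'\<close> serving as \<open>w\<close> in
      \<open>no_quadrants\<close>.\<close>
    have "sep c (f (Min d')) (f (Max d'))" "sep d (f (Min d')) (f (Max d'))"
      "sep c (f (Min c')) (f (Max d'))" "\<not> sep d (f (Min c')) (f (Max d'))"
      "\<not> sep c (f (Max c')) (f (Max d'))" "sep d (f (Max c')) (f (Max d'))"
      using cr' mx by (simp_all add: sc sd, simp_all add: sep_def arcs)
    then show False using no_quadrants[OF cd(1,3)] by blast
  qed
qed

lemma face_at_image:
  assumes "C \<subseteq> H" "s \<in> Y"
  shows "face_at (nu Y ` Y) ((`) (nu Y) ` C) (nu Y s) = nu Y ` face_at Y C s"
proof -
  have "(\<forall>c\<in>(`) (nu Y) ` C. \<not> sep c (nu Y s) (nu Y t)) \<longleftrightarrow> (\<forall>c\<in>C. \<not> sep c s t)" if "t \<in> Y" for t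
    using sep_image[OF subsetD[OF assms(1)] assms(2) that] by simp
  then have "{t \<in> Y. \<forall>c\<in>(`) (nu Y) ` C. \<not> sep c (nu Y s) (nu Y t)} = face_at Y C s"
    unfolding face_at_def by (intro Collect_cong conj_cong refl)
  moreover have "face_at (nu Y ` Y) D (nu Y s) = nu Y ` {t \<in> Y. \<forall>c\<in>D. \<not> sep c (nu Y s) (nu Y t)}" for D
    unfolding face_at_def by blast
  ultimately show ?thesis by simp
qed

lemma sfaces_image:
  assumes "C \<subseteq> H"
  shows "sfaces (nu Y ` Y) ((`) (nu Y) ` C) = (`) (nu Y) ` sfaces Y C"
  unfolding sfaces_def image_image by (rule image_cong[OF refl face_at_image[OF assms]])

lemma sinner_image:
  assumes "C \<subseteq> H" "\<alpha> \<subseteq> Y"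
  shows "sinner ((`) (nu Y) ` H) ((`) (nu Y) ` C) (nu Y ` \<alpha>) = (`) (nu Y) ` sinner H C \<alpha>"
proof -
  have 1: "(`) (nu Y) ` H - (`) (nu Y) ` C = (`) (nu Y) ` (H - C)"
    by (rule inj_on_image_set_diff[OF inj_on_image_chords, symmetric]) (use assms in auto)
  have 2: "(\<exists>s\<in>nu Y ` \<alpha>. \<exists>t\<in>nu Y ` \<alpha>. sep (nu Y ` c) s t) \<longleftrightarrow> (\<exists>s\<in>\<alpha>. \<exists>t\<in>\<alpha>. sep c s t)" if "c \<in> H" for c
    by (simp only: bex_simps, intro bex_cong refl sep_image that) (use assms(2) in auto)
  have "sinner ((`) (nu Y) ` H) ((`) (nu Y) ` C) (nu Y ` \<alpha>) =
      (`) (nu Y) ` {c \<in> H - C. \<exists>s\<in>nu Y ` \<alpha>. \<exists>t\<in>nu Y ` \<alpha>. sep (nu Y ` c) s t}"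
    unfolding sinner_def 1 by blast
  also have "{c \<in> H - C. \<exists>s\<in>nu Y ` \<alpha>. \<exists>t\<in>nu Y ` \<alpha>. sep (nu Y ` c) s t} = sinner H C \<alpha>"
    unfolding sinner_def by (intro Collect_cong conj_cong refl 2) simp
  finally show ?thesis .
qed

lemma mins_image:
  assumes "C \<subseteq> H"
  shows "mins (nu Y ` Y) ((`) (nu Y) ` C) = nu Y ` mins Y C"
  unfolding mins_def sfaces_image[OF assms] image_image
  by (rule image_cong[OF refl], rule Min_nu_image[OF finite_Y]) (fact sfacesD(1) sfacesD(2))+

lemma bsum_image:
  assumes "C \<subseteq> H" "s \<in> Y"
  shows "bsum (nu Y ` Y) ((`) (nu Y) ` C) (b \<circ> ix Y) (nu Y s) = bsum Y C b s"
proof -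
  have "inj_on (nu Y) (face_at Y C s)" by (rule inj_on_subset[OF nu_image_inj[OF finite_Y] face_at_subset])
  then have "(\<Sum>k\<in>nu Y ` face_at Y C s. (b \<circ> ix Y) k) = (\<Sum>s\<in>face_at Y C s. b s)"
    by (subst sum.reindex) (auto intro!: sum.cong simp: ix_nu[OF finite_Y subsetD[OF face_at_subset]])
  then show ?thesis by (simp add: bsum_def face_at_image[OF assms])
qed

lemma gen_image:
  assumes "K \<subseteq> H" "\<alpha> \<subseteq> Y" "\<alpha> \<noteq> {}" "\<And>s. s \<in> \<alpha> \<Longrightarrow> b' (nu Y s) = b s"
  shows "gen (nu Y ` \<alpha>) ((`) (nu Y) ` K) b' = gen \<alpha> K b"
proof -
  have fa: "finite \<alpha>" using assms finite_Y finite_subset by blast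
  have "card ((`) (nu Y) ` K) = card K" by (rule card_image[OF inj_on_subset[OF inj_on_image_chords assms(1)]])
  moreover have "(\<lambda>c. nu (nu Y ` \<alpha>) ` c) ` (`) (nu Y) ` K = (\<lambda>c. nu \<alpha> ` c) ` K"
    by (simp only: image_image nu_nu[OF finite_Y assms(2,3)])
  moreover have "b' (ix (nu Y ` \<alpha>) k) = b (ix \<alpha> k)" if k: "k < card \<alpha>" for k
  proof -
    have "ix (nu Y ` \<alpha>) k \<in> nu Y ` \<alpha>" using ix_in[of "nu Y ` \<alpha>" k] fa k by (simp add: card_nu_image finite_Y assms)
    then have "nu Y (ix Y (ix (nu Y ` \<alpha>) k)) = ix (nu Y ` \<alpha>) k" using nu_image_eq[OF finite_Y assms(2), of "ix (nu Y ` \<alpha>) k"] nu_ix[OF finite_Y] by simp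
    then show ?thesis using ix_ix[OF finite_Y assms(2) k] assms(4)[OF ix_in[OF fa k]] by simp
  qed
  ultimately show ?thesis
    by (simp add: gen_def real_diag_def card_nu_image[OF finite_Y assms(2)] fun_eq_iff cong: edge.case_cong if_cong)
qed

lemma flips_image:
  assumes "C \<subseteq> H"
  shows "flips (nu Y ` Y) ((`) (nu Y) ` H) ((`) (nu Y) ` C) = (`) (nu Y) ` flips Y H C"
proof -
  interpret I: tree_system "nu Y ` Y" "(`) (nu Y) ` H" using image_tree by unfold_locales
  interpret M: tree_system "mins Y C" C using mins_tree[OF assms] by unfold_locales
  have "nu Y ` c \<in> flips (nu Y ` Y) ((`) (nu Y) ` H) ((`) (nu Y) ` C) \<longleftrightarrow> c \<in> flips Y H C" if c: "c \<in> C" for c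
  proof -
    have cH: "c \<in> H" using c assms by blast
    obtain s t where st: "s \<in> Y" "t \<in> Y" "s < t" "dual H c s t" using dualE[OF cH] .
    obtain s' t' where st': "s' \<in> mins Y C" "t' \<in> mins Y C" "s' < t'" "dual C c s' t'" using M.dualE[OF c] .
    have Y': "s' \<in> Y" "t' \<in> Y" using st' mins_subset[OF finite_Y] by auto
    obtain a b where ab: "c = {a, b}" using chordE[OF cH] .
    have int: "nu Y a \<in> {nu Y u<..nu Y w} \<longleftrightarrow> a \<in> {u<..w}" if "u \<in> Y" "w \<in> Y" "u < w" for u w
      using nu_interval[OF finite_Y nu_less_mono[OF finite_Y that] nu_less[OF finite_Y Y_ne], of a] ix_nu[OF finite_Y] that by simp
    have "c \<in> flips Y H C \<longleftrightarrow> (a \<in> {s<..t}) \<noteq> (a \<in> {s'<..t'})"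
      by (rule flip_iff[OF assms c _ st st']) (simp add: ab)
    also have "\<dots> \<longleftrightarrow> (nu Y a \<in> {nu Y s<..nu Y t}) \<noteq> (nu Y a \<in> {nu Y s'<..nu Y t'})"
      by (simp only: int[OF st(1-3)] int[OF Y' st'(3)])
    also have "\<dots> \<longleftrightarrow> nu Y ` c \<in> flips (nu Y ` Y) ((`) (nu Y) ` H) ((`) (nu Y) ` C)"
      by (rule I.flip_iff[symmetric])
        (use assms imageI[OF c, of "(`) (nu Y)"] st st' Y' ab dual_image[OF order_refl cH st(1,2,4)] dual_image[OF assms c Y' st'(4)]
          nu_less_mono[OF finite_Y] mins_image[OF assms] in auto)
    finally show ?thesis ..
  qed
  moreover have "flips (nu Y ` Y) ((`) (nu Y) ` H) ((`) (nu Y) ` C) \<subseteq> (`) (nu Y) ` C" "flips Y H C \<subseteq> C"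
    by (auto simp: flips_def)
  ultimately show ?thesis by blast
qed

text \<open>\<open>gen\<close> places a tree system on the standard polygon, where its coproduct is
  computed; this lemma carries the result back to the original names.\<close>

lemma cop_image: "cop (nu Y ` Y) ((`) (nu Y) ` H) (b \<circ> ix Y) = cop Y H b"
proof -
  have "cop_term (nu Y ` Y) ((`) (nu Y) ` H) (b \<circ> ix Y) ((`) (nu Y) ` C) = cop_term Y H b C" if C: "C \<subseteq> H" for C
  proof -
    have "card (flips (nu Y ` Y) ((`) (nu Y) ` H) ((`) (nu Y) ` C)) = card (flips Y H C)"
      unfolding flips_image[OF C] using inj_on_image_chords C
      by (intro card_image) (auto simp: flips_def elim: inj_on_subset)
    moreover have "(\<Prod>\<alpha>\<in>sfaces (nu Y ` Y) ((`) (nu Y) ` C). gen \<alpha> (sinner ((`) (nu Y) ` H) ((`) (nu Y) ` C) \<alpha>) (b \<circ> ix Y)) =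
        (\<Prod>\<alpha>\<in>sfaces Y C. gen \<alpha> (sinner H C \<alpha>) b)"
    proof -
      have inj: "inj_on ((`) (nu Y)) (sfaces Y C)"
        using nu_image_inj[OF finite_Y] sfacesD(1) by (meson inj_onI inj_on_image_eq_iff)
      show ?thesis unfolding sfaces_image[OF C] prod.reindex[OF inj] o_def
      proof (rule prod.cong[OF refl])
        fix \<alpha> assume \<alpha>: "\<alpha> \<in> sfaces Y C"
        have "sinner H C \<alpha> \<subseteq> H" by (auto simp: sinner_def)
        then show "gen (nu Y ` \<alpha>) (sinner ((`) (nu Y) ` H) ((`) (nu Y) ` C) (nu Y ` \<alpha>)) (\<lambda>x. b (ix Y x)) = gen \<alpha> (sinner H C \<alpha>) b"
          unfolding sinner_image[OF C sfacesD(1)[OF \<alpha>]]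
          by (rule gen_image[OF _ sfacesD(1,2)[OF \<alpha>]]) (use ix_nu[OF finite_Y] sfacesD(1)[OF \<alpha>] in auto)
      qed
    qed
    moreover have "gen (mins (nu Y ` Y) ((`) (nu Y) ` C)) ((`) (nu Y) ` C) (bsum (nu Y ` Y) ((`) (nu Y) ` C) (b \<circ> ix Y)) =
        gen (mins Y C) C (bsum Y C b)"
      unfolding mins_image[OF C]
      by (rule gen_image[OF C]) (use mins_subset[OF finite_Y] Y_ne bsum_image[OF C] in \<open>auto simp: mins_def sfaces_def subset_iff\<close>)
    ultimately show ?thesis by (simp add: cop_term_def)
  qed
  moreover have "inj_on ((`) ((`) (nu Y))) (Pow H)"
    using inj_on_image_chords by (rule inj_on_image_Pow)
  moreover have "Pow ((`) (nu Y) ` H) = (`) ((`) (nu Y)) ` Pow H" by (rule image_Pow_surj[symmetric]) simp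
  ultimately show ?thesis by (simp add: cop_def sum.reindex)
qed

end

subsection \<open>Coassociativity for tree systems\<close>

lemma sinner_subset: "sinner H C \<alpha> \<subseteq> H - C"
  by (auto simp: sinner_def)

context tree_system
begin

text \<open>The dual edge of a chord inside a face stays in that face, so the same cut serves before
  and after the restriction.\<close>

lemma restrict_orient:
  assumes "C \<subseteq> H" "\<alpha> \<in> sfaces Y C" "c \<in> sinner H C \<alpha>"
  shows "orient \<alpha> (sinner H C \<alpha>) c = orient Y H c"
proof -
  interpret R: tree_system \<alpha> "sinner H C \<alpha>" using restrict_tree[OF assms(1,2)] by unfold_locales
  have cH: "c \<in> H" using assms(3) sinner_subset by blast
  obtain s t where st: "s \<in> Y" "t \<in> Y" "s < t" "dual H c s t" using dualE[OF cH] .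
  have "dual (sinner H C \<alpha>) c s t" using dual_mono[OF st(4)] sinner_subset by blast
  then show ?thesis
    using R.orient_iff[OF assms(3) restrict_dual[OF assms st(1,2,4)] st(3)] orient_iff[OF cH st] by blast
qed

lemma UN_sinner:
  assumes "C \<subseteq> H"
  shows "(\<Union>\<alpha>\<in>sfaces Y C. sinner H C \<alpha>) = H - C"
proof (intro equalityI subsetI)
  fix c assume c: "c \<in> H - C"
  then obtain s t where st: "s \<in> Y" "t \<in> Y" "dual H c s t" using dualE[of c] by blast
  have "t \<in> face_at Y C s" using st c assms by (auto simp: face_at_def dual_def)
  moreover have "sep c s t" using st c by (auto simp: dual_def)
  ultimately have "c \<in> sinner H C (face_at Y C s)" using c face_at_self[OF st(1)] by (auto simp: sinner_def)
  then show "c \<in> (\<Union>\<alpha>\<in>sfaces Y C. sinner H C \<alpha>)" using st by (auto simp: sfaces_def)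
qed (auto simp: sinner_def)

lemma sinner_disjoint:
  assumes "C \<subseteq> H" "\<alpha> \<in> sfaces Y C" "\<beta> \<in> sfaces Y C" "\<alpha> \<noteq> \<beta>"
  shows "sinner H C \<alpha> \<inter> sinner H C \<beta> = {}"
proof (rule ccontr)
  assume "sinner H C \<alpha> \<inter> sinner H C \<beta> \<noteq> {}"
  then obtain c where c: "c \<in> sinner H C \<alpha>" "c \<in> sinner H C \<beta>" by blast
  then have "c \<in> H" using sinner_subset by blast
  then obtain s t where st: "s \<in> Y" "t \<in> Y" "dual H c s t" using dualE[of c] by blast
  have "s \<in> \<alpha>" "s \<in> \<beta>" using restrict_dual(1)[OF assms(1,2) c(1) st] restrict_dual(1)[OF assms(1,3) c(2) st] .
  then show False using sfaces_disjoint[OF assms(2-4)] by blast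
qed

text \<open>The set \<open>X\<close> allows two uses: with \<open>UNIV\<close> for the degrees, and
  with sets of chords for the signs.\<close>

lemma sum_card_sinner:
  assumes "C \<subseteq> H"
  shows "(\<Sum>\<alpha>\<in>sfaces Y C. card (X \<inter> sinner H C \<alpha>)) = card (X \<inter> (H - C))"
proof -
  have "card (\<Union>\<alpha>\<in>sfaces Y C. X \<inter> sinner H C \<alpha>) = (\<Sum>\<alpha>\<in>sfaces Y C. card (X \<inter> sinner H C \<alpha>))"
  proof (rule card_UN_disjoint)
    show "finite (sfaces Y C)" using finite_Y by (rule finite_sfaces)
    show "\<forall>\<alpha>\<in>sfaces Y C. finite (X \<inter> sinner H C \<alpha>)"
      using finite_subset[OF _ finite_H] sinner_subset by blast
    show "\<forall>\<alpha>\<in>sfaces Y C. \<forall>\<beta>\<in>sfaces Y C. \<alpha> \<noteq> \<beta> \<longrightarrow> (X \<inter> sinner H C \<alpha>) \<inter> (X \<inter> sinner H C \<beta>) = {}"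
      using sinner_disjoint[OF assms] by blast
  qed
  moreover have "(\<Union>\<alpha>\<in>sfaces Y C. X \<inter> sinner H C \<alpha>) = X \<inter> (H - C)"
    using UN_sinner[OF assms] by blast
  ultimately show ?thesis by simp
qed

end

lemma even_card_sym_diff:
  assumes "finite P" "finite Q"
  shows "even (card ((P - Q) \<union> (Q - P))) \<longleftrightarrow> even (card P + card Q)"
proof -
  have "card ((P - Q) \<union> (Q - P)) = card (P - Q) + card (Q - P)"
    by (rule card_Un_disjoint) (use assms in auto)
  moreover have "card P = card (P - Q) + card (P \<inter> Q)" "card Q = card (Q - P) + card (P \<inter> Q)"
    using assms card_Diff_subset_Int[of P Q] card_Diff_subset_Int[of Q P]
      card_mono[of P "P \<inter> Q"] card_mono[of Q "P \<inter> Q"] by (simp_all add: Int_commute)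
  ultimately show ?thesis by presburger
qed

text \<open>
  The term of \<open>(\<Delta> \<otimes> id) \<circ> \<Delta>\<close> given by \<open>C\<close> and by subsets of the chords inside its faces corresponds
  to the term of \<open>(id \<otimes> \<Delta>) \<circ> \<Delta>\<close> given by \<open>C' \<supseteq> C\<close> and \<open>C\<close>, where \<open>C' - C\<close> is the union of these
  subsets.
\<close>

locale nested_chords = tree_system +
  fixes C C'
  assumes sub: "C \<subseteq> C'" "C' \<subseteq> H"
begin

abbreviation inn where "inn \<alpha> \<equiv> sinner H C \<alpha>"
abbreviation new where "new \<alpha> \<equiv> C' \<inter> sinner H C \<alpha>"

lemma CH: "C \<subseteq> H"
  using sub by blast

text \<open>A chord of \<open>C'\<close> that separates two sides of the face \<alpha> of
  \<open>C\<close> is not in \<open>C\<close>, hence lies in \<open>new \<alpha>\<close>.\<close>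

lemma face_at_restrict:
  assumes \<alpha>: "\<alpha> \<in> sfaces Y C" and s: "s \<in> \<alpha>"
  shows "face_at \<alpha> (new \<alpha>) s = face_at Y C' s"
proof (intro equalityI subsetI)
  fix t assume t: "t \<in> face_at \<alpha> (new \<alpha>) s"
  then have t\<alpha>: "t \<in> \<alpha>" by (simp add: face_at_def)
  have "\<not> sep c s t" if c: "c \<in> C'" for c
  proof (cases "c \<in> C")
    case True
    then show ?thesis using not_sep_face[OF \<alpha> s t\<alpha>] by simp
  next
    case False
    show ?thesis
    proof
      assume "sep c s t"
      then have "c \<in> new \<alpha>" using False c sub s t\<alpha> by (auto simp: sinner_def)
      then show False using t \<open>sep c s t\<close> by (simp add: face_at_def)
    qed
  qed
  then show "t \<in> face_at Y C' s" using t\<alpha> sfacesD(1)[OF \<alpha>] by (auto simp: face_at_def)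
next
  fix t assume t: "t \<in> face_at Y C' s"
  then have "t \<in> face_at Y C s" using sub by (auto simp: face_at_def)
  then have "t \<in> \<alpha>" using sfaces_eq[OF \<alpha> s] by simp
  then show "t \<in> face_at \<alpha> (new \<alpha>) s" using t by (auto simp: face_at_def)
qed

lemma sfaces_restrict: "\<alpha> \<in> sfaces Y C \<Longrightarrow> sfaces \<alpha> (new \<alpha>) = face_at Y C' ` \<alpha>"
  unfolding sfaces_def[of \<alpha>] by (rule image_cong[OF refl]) (rule face_at_restrict)

lemma UN_sfaces: "\<Union>(sfaces Y C) = Y"
proof (intro equalityI subsetI)
  fix s assume s: "s \<in> Y"
  then show "s \<in> \<Union>(sfaces Y C)" using face_at_self[OF s, of C] by (auto simp: sfaces_def)
qed (use sfacesD(1) in blast)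

lemma UN_sfaces_restrict: "(\<Union>\<alpha>\<in>sfaces Y C. sfaces \<alpha> (new \<alpha>)) = sfaces Y C'"
proof -
  have "(\<Union>\<alpha>\<in>sfaces Y C. sfaces \<alpha> (new \<alpha>)) = (\<Union>\<alpha>\<in>sfaces Y C. face_at Y C' ` \<alpha>)"
    by (rule SUP_cong[OF refl sfaces_restrict])
  also have "\<dots> = face_at Y C' ` \<Union>(sfaces Y C)" by blast
  finally show ?thesis by (simp add: UN_sfaces sfaces_def[of Y C'])
qed

lemma sinner_restrict:
  assumes \<alpha>: "\<alpha> \<in> sfaces Y C" and \<beta>: "\<beta> \<subseteq> \<alpha>"
  shows "sinner (inn \<alpha>) (new \<alpha>) \<beta> = sinner H C' \<beta>"
  using sub \<beta> unfolding sinner_def by blast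

lemma prod_restrict:
  "(\<Prod>\<alpha>\<in>sfaces Y C. \<Prod>\<beta>\<in>sfaces \<alpha> (new \<alpha>). gen \<beta> (sinner (inn \<alpha>) (new \<alpha>) \<beta>) b) =
    (\<Prod>\<beta>\<in>sfaces Y C'. gen \<beta> (sinner H C' \<beta>) b)"
proof -
  have "(\<Prod>\<alpha>\<in>sfaces Y C. \<Prod>\<beta>\<in>sfaces \<alpha> (new \<alpha>). gen \<beta> (sinner (inn \<alpha>) (new \<alpha>) \<beta>) b) =
      (\<Prod>\<alpha>\<in>sfaces Y C. \<Prod>\<beta>\<in>sfaces \<alpha> (new \<alpha>). gen \<beta> (sinner H C' \<beta>) b)"
    by (intro prod.cong refl) (simp add: sinner_restrict sfacesD(1))
  also have "\<dots> = (\<Prod>\<beta>\<in>(\<Union>\<alpha>\<in>sfaces Y C. sfaces \<alpha> (new \<alpha>)). gen \<beta> (sinner H C' \<beta>) b)"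
  proof (rule prod.UNION_disjoint[symmetric])
    show "finite (sfaces Y C)" using finite_Y by (rule finite_sfaces)
    show "\<forall>\<alpha>\<in>sfaces Y C. finite (sfaces \<alpha> (new \<alpha>))" using finite_sfaces sfacesD(3) finite_Y by blast
    show "\<forall>\<alpha>\<in>sfaces Y C. \<forall>\<beta>\<in>sfaces Y C. \<alpha> \<noteq> \<beta> \<longrightarrow> sfaces \<alpha> (new \<alpha>) \<inter> sfaces \<beta> (new \<beta>) = {}"
    proof (intro ballI impI, rule ccontr)
      fix \<alpha> \<beta> assume *: "\<alpha> \<in> sfaces Y C" "\<beta> \<in> sfaces Y C" "\<alpha> \<noteq> \<beta>" "sfaces \<alpha> (new \<alpha>) \<inter> sfaces \<beta> (new \<beta>) \<noteq> {}"
      then obtain \<gamma> where \<gamma>: "\<gamma> \<in> sfaces \<alpha> (new \<alpha>)" "\<gamma> \<in> sfaces \<beta> (new \<beta>)" by blast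
      have "\<gamma> \<subseteq> \<alpha> \<inter> \<beta>" "\<gamma> \<noteq> {}" using sfacesD(1,2)[OF \<gamma>(1)] sfacesD(1)[OF \<gamma>(2)] by auto
      then show False using sfaces_disjoint[OF *(1-3)] by blast
    qed
  qed
  finally show ?thesis unfolding UN_sfaces_restrict .
qed

lemma mins_restrict:
  assumes \<alpha>: "\<alpha> \<in> sfaces Y C"
  shows "mins \<alpha> (new \<alpha>) = \<alpha> \<inter> mins Y C'"
proof -
  have fa: "finite \<alpha>" using sfacesD(3)[OF \<alpha> finite_Y] .
  have "m \<in> mins \<alpha> (new \<alpha>) \<longleftrightarrow> m \<in> \<alpha> \<inter> mins Y C'" for m
    using mins_iff[OF fa, of m "new \<alpha>"] mins_iff[OF finite_Y, of m C'] face_at_restrict[OF \<alpha>, of m] sfacesD(1)[OF \<alpha>]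
    by auto
  then show ?thesis by blast
qed

lemma face_at_mins: "face_at (mins Y C') C m = face_at Y C m \<inter> mins Y C'"
  using mins_subset[OF finite_Y, of C'] by (auto simp: face_at_def)

lemma Min_face_in:
  assumes "\<alpha> \<in> sfaces Y C" "s \<in> \<alpha>"
  shows "Min (face_at Y C' s) \<in> \<alpha> \<inter> mins Y C'"
proof -
  have sY: "s \<in> Y" using assms sfacesD(1) by blast
  have "Min (face_at Y C' s) \<in> face_at Y C' s" by (rule Min_face[OF finite_Y sY])
  then have "Min (face_at Y C' s) \<in> face_at Y C s" using sub by (auto simp: face_at_def)
  then show ?thesis using sfaces_eq[OF assms] Min_mins[OF sY] by blast
qed

lemma sfaces_mins: "sfaces (mins Y C') C = (\<lambda>\<alpha>. \<alpha> \<inter> mins Y C') ` sfaces Y C"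
proof (intro equalityI subsetI)
  fix \<gamma> assume "\<gamma> \<in> sfaces (mins Y C') C"
  then obtain m where "m \<in> mins Y C'" "\<gamma> = face_at Y C m \<inter> mins Y C'" by (auto simp: sfaces_def face_at_mins)
  then show "\<gamma> \<in> (\<lambda>\<alpha>. \<alpha> \<inter> mins Y C') ` sfaces Y C" using mins_subset[OF finite_Y, of C'] by (auto simp: sfaces_def)
next
  fix \<gamma> assume "\<gamma> \<in> (\<lambda>\<alpha>. \<alpha> \<inter> mins Y C') ` sfaces Y C"
  then obtain \<alpha> where \<alpha>: "\<alpha> \<in> sfaces Y C" "\<gamma> = \<alpha> \<inter> mins Y C'" by blast
  obtain s where "s \<in> \<alpha>" using sfacesD(2)[OF \<alpha>(1)] by blast
  then have m: "Min (face_at Y C' s) \<in> \<alpha>" "Min (face_at Y C' s) \<in> mins Y C'" using Min_face_in[OF \<alpha>(1)] by auto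
  then have "\<gamma> = face_at (mins Y C') C (Min (face_at Y C' s))" using sfaces_eq[OF \<alpha>(1) m(1)] \<alpha>(2) face_at_mins by simp
  then show "\<gamma> \<in> sfaces (mins Y C') C" using m(2) by (auto simp: sfaces_def)
qed

lemma inj_on_inter_mins: "inj_on (\<lambda>\<alpha>. \<alpha> \<inter> mins Y C') (sfaces Y C)"
proof (rule inj_onI, rule ccontr)
  fix \<alpha> \<beta> assume *: "\<alpha> \<in> sfaces Y C" "\<beta> \<in> sfaces Y C" "\<alpha> \<inter> mins Y C' = \<beta> \<inter> mins Y C'" "\<alpha> \<noteq> \<beta>"
  obtain s where "s \<in> \<alpha>" using sfacesD(2)[OF *(1)] by blast
  then show False using Min_face_in[OF *(1)] sfaces_disjoint[OF *(1,2,4)] * by blast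
qed

text \<open>Moving from a side to the least side of its face for \<open>C'\<close> passes no chord
  of \<open>C'\<close> and does not leave \<alpha>, so separation can be tested on least
  sides.\<close>

lemma sinner_mins:
  assumes \<alpha>: "\<alpha> \<in> sfaces Y C"
  shows "sinner C' C (\<alpha> \<inter> mins Y C') = new \<alpha>"
proof (intro equalityI subsetI)
  fix c assume "c \<in> sinner C' C (\<alpha> \<inter> mins Y C')"
  then show "c \<in> new \<alpha>" using sub by (auto simp: sinner_def)
next
  fix c assume "c \<in> new \<alpha>"
  then obtain s t where c: "c \<in> C'" "c \<notin> C" "s \<in> \<alpha>" "t \<in> \<alpha>" "sep c s t" by (auto simp: sinner_def)
  have Y: "s \<in> Y" "t \<in> Y" using c sfacesD(1)[OF \<alpha>] by auto
  have "sep c (Min (face_at Y C' s)) (Min (face_at Y C' t))"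
    using sep_Min[OF finite_Y Y(1) c(1)] sep_Min[OF finite_Y Y(2) c(1)] c(5) sep_subst by blast
  then show "c \<in> sinner C' C (\<alpha> \<inter> mins Y C')"
    using Min_face_in[OF \<alpha> c(3)] Min_face_in[OF \<alpha> c(4)] c(1,2) unfolding sinner_def by blast
qed

lemma bsum_restrict:
  "\<alpha> \<in> sfaces Y C \<Longrightarrow> s \<in> \<alpha> \<Longrightarrow> bsum \<alpha> (new \<alpha>) b s = bsum Y C' b s"
  by (simp add: bsum_def face_at_restrict)

lemma prod_mins:
  "(\<Prod>\<alpha>\<in>sfaces Y C. gen (mins \<alpha> (new \<alpha>)) (new \<alpha>) (bsum \<alpha> (new \<alpha>) b)) =
    (\<Prod>\<gamma>\<in>sfaces (mins Y C') C. gen \<gamma> (sinner C' C \<gamma>) (bsum Y C' b))"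
  unfolding sfaces_mins prod.reindex[OF inj_on_inter_mins] o_def
proof (rule prod.cong[OF refl])
  fix \<alpha> assume \<alpha>: "\<alpha> \<in> sfaces Y C"
  have "finite (\<alpha> \<inter> mins Y C')" using sfacesD(3)[OF \<alpha> finite_Y] by simp
  then show "gen (mins \<alpha> (new \<alpha>)) (new \<alpha>) (bsum \<alpha> (new \<alpha>) b) =
      gen (\<alpha> \<inter> mins Y C') (sinner C' C (\<alpha> \<inter> mins Y C')) (bsum Y C' b)"
    unfolding sinner_mins[OF \<alpha>] mins_restrict[OF \<alpha>] by (rule gen_cong) (use bsum_restrict[OF \<alpha>] in auto)
qed

text \<open>The face of \<open>C'\<close> containing \<open>Min \<alpha>\<close> lies inside
  \<alpha>, so \<open>Min \<alpha>\<close> is also the least side of that smaller face.\<close>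

lemma Min_inter_mins:
  assumes \<alpha>: "\<alpha> \<in> sfaces Y C"
  shows "Min (\<alpha> \<inter> mins Y C') = Min \<alpha>"
proof (rule Min_eqI)
  have fa: "finite \<alpha>" using sfacesD(3)[OF \<alpha> finite_Y] .
  then show "finite (\<alpha> \<inter> mins Y C')" by simp
  show "Min \<alpha> \<le> m" if "m \<in> \<alpha> \<inter> mins Y C'" for m using fa that by simp
  have m: "Min \<alpha> \<in> \<alpha>" using Min_in[OF fa sfacesD(2)[OF \<alpha>]] .
  then have mY: "Min \<alpha> \<in> Y" using sfacesD(1)[OF \<alpha>] by blast
  have "Min (face_at Y C' (Min \<alpha>)) \<ge> Min \<alpha>" using Min_face_in[OF \<alpha> m] fa by simp
  moreover have "Min (face_at Y C' (Min \<alpha>)) \<le> Min \<alpha>"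
    using face_at_self[OF mY] finite_face_at[OF finite_Y] by simp
  ultimately show "Min \<alpha> \<in> \<alpha> \<inter> mins Y C'" using Min_face_in[OF \<alpha> m] by simp
qed

lemma mins_mins: "mins (mins Y C') C = mins Y C"
  unfolding mins_def[of "mins Y C'"] mins_def[of Y C] sfaces_mins image_image
  by (rule image_cong[OF refl Min_inter_mins])

text \<open>A face of \<open>C\<close> is the disjoint union of the faces of \<open>C'\<close> whose
  least sides it contains.\<close>

lemma bsum_bsum:
  assumes "m \<in> mins Y C"
  shows "bsum (mins Y C') C (bsum Y C' b) m = bsum Y C b m"
proof -
  have mY: "m \<in> Y" using assms mins_subset[OF finite_Y] by blast
  let ?\<alpha> = "face_at Y C m"
  have \<alpha>: "?\<alpha> \<in> sfaces Y C" using mY by (simp add: sfaces_def)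
  have "(\<Sum>k\<in>?\<alpha> \<inter> mins Y C'. \<Sum>s\<in>face_at Y C' k. b s) = (\<Sum>s\<in>(\<Union>k\<in>?\<alpha> \<inter> mins Y C'. face_at Y C' k). b s)"
  proof (rule sum.UNION_disjoint[symmetric])
    show "finite (?\<alpha> \<inter> mins Y C')" using finite_face_at[OF finite_Y] by blast
    show "\<forall>k\<in>?\<alpha> \<inter> mins Y C'. finite (face_at Y C' k)" using finite_face_at[OF finite_Y] by blast
    show "\<forall>k\<in>?\<alpha> \<inter> mins Y C'. \<forall>l\<in>?\<alpha> \<inter> mins Y C'. k \<noteq> l \<longrightarrow> face_at Y C' k \<inter> face_at Y C' l = {}"
    proof (intro ballI impI, rule ccontr)
      fix k l assume *: "k \<in> ?\<alpha> \<inter> mins Y C'" "l \<in> ?\<alpha> \<inter> mins Y C'" "k \<noteq> l" "face_at Y C' k \<inter> face_at Y C' l \<noteq> {}"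
      then obtain s where "s \<in> face_at Y C' k" "s \<in> face_at Y C' l" by blast
      then have "face_at Y C' k = face_at Y C' l" using face_at_eq by metis
      then show False using * mins_iff[OF finite_Y] by (metis IntD2)
    qed
  qed
  also have "(\<Union>k\<in>?\<alpha> \<inter> mins Y C'. face_at Y C' k) = ?\<alpha>"
  proof (intro equalityI subsetI)
    fix s assume "s \<in> (\<Union>k\<in>?\<alpha> \<inter> mins Y C'. face_at Y C' k)"
    then obtain k where k: "k \<in> ?\<alpha>" "s \<in> face_at Y C' k" by blast
    then have "s \<in> face_at Y C k" using sub by (auto simp: face_at_def)
    then show "s \<in> ?\<alpha>" using face_at_eq[OF k(1)] by simp
  next
    fix s assume s: "s \<in> ?\<alpha>"
    then have "s \<in> Y" by (simp add: face_at_def)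
    then have "s \<in> face_at Y C' (Min (face_at Y C' s))"
      using face_at_Min[OF finite_Y, of s C'] face_at_self[of s Y C'] by simp
    then show "s \<in> (\<Union>k\<in>?\<alpha> \<inter> mins Y C'. face_at Y C' k)" using Min_face_in[OF \<alpha> s] by blast
  qed
  finally show ?thesis by (simp add: bsum_def face_at_mins)
qed

lemma gen_mins_mins:
  "gen (mins (mins Y C') C) C (bsum (mins Y C') C (bsum Y C' b)) = gen (mins Y C) C (bsum Y C b)"
  unfolding mins_mins
  by (rule gen_cong) (use finite_subset[OF mins_subset[OF finite_Y] finite_Y] bsum_bsum in auto)

text \<open>\<open>restrict_orient\<close> is applied twice: to \<alpha> as a face of
  \<open>C\<close> in \<open>Y\<close>, and to the least sides in \<alpha> as a face of
  \<open>C\<close> in the contraction along \<open>C'\<close>.\<close>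

lemma flips_restrict:
  assumes \<alpha>: "\<alpha> \<in> sfaces Y C"
  shows "flips \<alpha> (inn \<alpha>) (new \<alpha>) = flips Y H C' \<inter> inn \<alpha>"
proof -
  interpret M: tree_system "mins Y C'" C' using mins_tree[OF sub(2)] by unfold_locales
  have "orient (mins \<alpha> (new \<alpha>)) (new \<alpha>) c = orient (mins Y C') C' c" if c: "c \<in> new \<alpha>" for c
  proof -
    have f: "\<alpha> \<inter> mins Y C' \<in> sfaces (mins Y C') C" using \<alpha> by (auto simp: sfaces_mins)
    show ?thesis unfolding mins_restrict[OF \<alpha>]
      using M.restrict_orient[OF sub(1) f, of c] c unfolding sinner_mins[OF \<alpha>] by simp
  qed
  moreover have "orient \<alpha> (inn \<alpha>) c = orient Y H c" if "c \<in> new \<alpha>" for c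
    using restrict_orient[OF CH \<alpha>] that by simp
  ultimately show ?thesis by (auto simp: flips_def)
qed

text \<open>Chords of \<open>C'\<close> outside \<open>C\<close> are counted once on either side. A
  chord of \<open>C\<close> has three directions, with respect to \<open>H\<close>,
  \<open>C'\<close> and \<open>C\<close>; the first and last differ iff exactly one of the two
  intermediate comparisons is a flip. So the sets of flips combine by symmetric difference, which
  adds cardinalities modulo 2.\<close>

lemma card_flips:
  "even (card (flips Y H C) + (\<Sum>\<alpha>\<in>sfaces Y C. card (flips \<alpha> (inn \<alpha>) (new \<alpha>)))) \<longleftrightarrow>
   even (card (flips Y H C') + card (flips (mins Y C') C' C))"
proof -
  have fin: "finite C'" "finite C"
    by (fact finite_subset[OF sub(2) finite_H] finite_subset[OF CH finite_H])+
  have "(\<Sum>\<alpha>\<in>sfaces Y C. card (flips \<alpha> (inn \<alpha>) (new \<alpha>))) = card (flips Y H C' \<inter> (H - C))"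
    using sum_card_sinner[OF CH] by (simp add: flips_restrict)
  moreover have "flips Y H C' = (flips Y H C' \<inter> C) \<union> (flips Y H C' \<inter> (H - C))"
    using sub by (auto simp: flips_def)
  then have "card (flips Y H C') = card (flips Y H C' \<inter> C) + card (flips Y H C' \<inter> (H - C))"
    using fin by (subst card_Un_disjoint[symmetric]) (auto simp: flips_def intro: finite_subset)
  moreover have "even (card (flips Y H C)) \<longleftrightarrow> even (card (flips Y H C' \<inter> C) + card (flips (mins Y C') C' C))"
  proof -
    let ?P = "flips Y H C' \<inter> C" and ?Q = "flips (mins Y C') C' C"
    have "flips Y H C = (?P - ?Q) \<union> (?Q - ?P)"
      using sub by (auto simp: flips_def mins_mins)
    moreover have "finite ?P" "finite ?Q" using fin by (auto simp: flips_def)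
    ultimately show ?thesis by (simp add: even_card_sym_diff)
  qed
  ultimately show ?thesis by auto
qed

end

text \<open>The distributive law: choosing a subset of each of the disjoint sets \<open>S i\<close>
  is the same as choosing one subset of their union.\<close>

lemma prod_sum_Pow:
  fixes f :: "'i \<Rightarrow> 'b set \<Rightarrow> 'a::comm_semiring_1"
  assumes "finite A" "\<And>i. i \<in> A \<Longrightarrow> finite (S i)" "\<And>i j. i \<in> A \<Longrightarrow> j \<in> A \<Longrightarrow> i \<noteq> j \<Longrightarrow> S i \<inter> S j = {}"
  shows "(\<Prod>i\<in>A. \<Sum>B\<in>Pow (S i). f i B) = (\<Sum>B\<in>Pow (\<Union>i\<in>A. S i). \<Prod>i\<in>A. f i (B \<inter> S i))"
  using assms
proof (induction A)
  case (insert i A)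
  let ?U = "\<Union>j\<in>A. S j"
  have dis: "S i \<inter> ?U = {}" using insert.hyps insert.prems(2)[of i] by force
  have IH: "(\<Prod>i\<in>A. \<Sum>B\<in>Pow (S i). f i B) = (\<Sum>B\<in>Pow ?U. \<Prod>i\<in>A. f i (B \<inter> S i))"
    by (rule insert.IH) (use insert.prems in auto)
  have "(\<Sum>B\<in>Pow (\<Union>j\<in>insert i A. S j). \<Prod>j\<in>insert i A. f j (B \<inter> S j)) =
      (\<Sum>(B1, B2)\<in>Pow (S i) \<times> Pow ?U. f i B1 * (\<Prod>j\<in>A. f j (B2 \<inter> S j)))"
  proof (rule sum.reindex_bij_witness[of _ "\<lambda>(B1, B2). B1 \<union> B2" "\<lambda>B. (B \<inter> S i, B \<inter> ?U)"])
    fix B assume B: "B \<in> Pow (\<Union>j\<in>insert i A. S j)"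
    have "(\<Prod>j\<in>A. f j (B \<inter> S j)) = (\<Prod>j\<in>A. f j (B \<inter> ?U \<inter> S j))"
      by (intro prod.cong refl arg_cong[where f = "f _"]) blast
    then show "(case (B \<inter> S i, B \<inter> ?U) of (B1, B2) \<Rightarrow> f i B1 * (\<Prod>j\<in>A. f j (B2 \<inter> S j))) =
        (\<Prod>j\<in>insert i A. f j (B \<inter> S j))"
      using insert.hyps by simp
  qed (use dis in auto)
  also have "\<dots> = (\<Sum>B\<in>Pow (S i). f i B) * (\<Sum>B\<in>Pow ?U. \<Prod>j\<in>A. f j (B \<inter> S j))"
    by (simp add: sum_product sum.cartesian_product)
  finally show ?case using insert.hyps IH by simp
qed simp

section \<open>Comparison of the two iterated coproducts\<close>

context tree_system
begin

lemma prod_cop: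
  assumes "C \<subseteq> H"
  shows "(\<Prod>\<alpha>\<in>sfaces Y C. cop \<alpha> (sinner H C \<alpha>) b) =
    (\<Sum>B\<in>Pow (H - C). \<Prod>\<alpha>\<in>sfaces Y C. cop_term \<alpha> (sinner H C \<alpha>) b (B \<inter> sinner H C \<alpha>))"
proof -
  have "finite (sinner H C \<alpha>)" for \<alpha>
    by (rule finite_subset[OF subset_trans[OF sinner_subset Diff_subset] finite_H])
  then show ?thesis
    unfolding cop_def
    by (subst prod_sum_Pow) (use finite_sfaces[OF finite_Y] sinner_disjoint[OF assms] in \<open>simp_all add: UN_sinner[OF assms]\<close>)
qed

lemma coassoc_term:
  assumes "C \<subseteq> C'" "C' \<subseteq> H"
  shows "qscale ((-1) ^ card (flips Y H C)) (tensor_assoc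
      ((\<Prod>\<alpha>\<in>sfaces Y C. cop_term \<alpha> (sinner H C \<alpha>) b (C' \<inter> sinner H C \<alpha>)) \<otimes> gen (mins Y C) C (bsum Y C b))) =
    qscale ((-1) ^ card (flips Y H C'))
      ((\<Prod>\<beta>\<in>sfaces Y C'. gen \<beta> (sinner H C' \<beta>) b) \<otimes> cop_term (mins Y C') C' (bsum Y C' b) C)"
proof -
  interpret nested_chords Y H C C' using assms by unfold_locales
  have "(-1 :: rat) ^ card (flips Y H C) * (\<Prod>\<alpha>\<in>sfaces Y C. (-1) ^ card (flips \<alpha> (inn \<alpha>) (new \<alpha>))) =
      (-1) ^ card (flips Y H C') * (-1) ^ card (flips (mins Y C') C' C)"
    unfolding power_sum[symmetric] power_add[symmetric] unfolding minus_one_power_iff using card_flips by simp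
  then show ?thesis
    unfolding cop_term_def prod_qscale tensor_prod prod_restrict prod_mins gen_mins_mins
    by (simp add: tensor_scale_left tensor_scale_right lin_scale[OF lin_tensor_assoc] tensor_assoc_tensor)
qed

end

text \<open>\<Delta> is kept abstract, because the fact that \<open>dd_coproduct\<close> sends
  \<open>gen\<close> to \<open>cop\<close> depends on the passage from diagrams to tree systems
  below.\<close>

lemma coassoc_cop:
  assumes \<Delta>: "alg_hom \<Delta>" "\<And>Y H b. tree_sys Y H \<Longrightarrow> \<Delta> (gen Y H b) = cop Y H b" and tree: "tree_sys Y H"
  shows "tensor_assoc (tensor_map \<Delta> id (cop Y H b)) = tensor_map id \<Delta> (cop Y H b)"
proof -
  interpret tree_system Y H using tree by unfold_locales
  have l: "lin \<Delta>" "lin id" using \<Delta>(1) lin_id by (simp_all add: alg_hom_lin id_def)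
  define T where "T C C' = qscale ((-1) ^ card (flips Y H C)) (tensor_assoc
      ((\<Prod>\<alpha>\<in>sfaces Y C. cop_term \<alpha> (sinner H C \<alpha>) b (C' \<inter> sinner H C \<alpha>)) \<otimes> gen (mins Y C) C (bsum Y C b)))" for C C'
  have 1: "tensor_assoc (tensor_map \<Delta> id (cop_term Y H b C)) = (\<Sum>B\<in>Pow (H - C). T C (C \<union> B))" if C: "C \<subseteq> H" for C
  proof -
    have "\<Delta> (gen \<alpha> (sinner H C \<alpha>) b) = cop \<alpha> (sinner H C \<alpha>) b" if "\<alpha> \<in> sfaces Y C" for \<alpha>
      by (rule \<Delta>(2)[OF restrict_tree[OF C that]])
    then have "\<Delta> (\<Prod>\<alpha>\<in>sfaces Y C. gen \<alpha> (sinner H C \<alpha>) b) = (\<Prod>\<alpha>\<in>sfaces Y C. cop \<alpha> (sinner H C \<alpha>) b)"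
      by (simp add: alg_hom_prod[OF \<Delta>(1)])
    then have "tensor_assoc (tensor_map \<Delta> id (cop_term Y H b C)) =
        (\<Sum>B\<in>Pow (H - C). qscale ((-1) ^ card (flips Y H C)) (tensor_assoc
      ((\<Prod>\<alpha>\<in>sfaces Y C. cop_term \<alpha> (sinner H C \<alpha>) b (B \<inter> sinner H C \<alpha>)) \<otimes> gen (mins Y C) C (bsum Y C b))))"
      by (simp add: cop_term_def[of Y] lin_scale[OF lin_tensor_map] lin_scale[OF lin_tensor_assoc]
          tensor_map_tensor[OF l] prod_cop[OF C] tensor_sum_left lin_sum[OF lin_tensor_assoc] qscale_sum)
    also have "\<dots> = (\<Sum>B\<in>Pow (H - C). T C (C \<union> B))"
    proof (rule sum.cong[OF refl])
      fix B assume "B \<in> Pow (H - C)"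
      have "(C \<union> B) \<inter> sinner H C \<alpha> = B \<inter> sinner H C \<alpha>" for \<alpha> using sinner_subset by blast
      then show "qscale ((-1) ^ card (flips Y H C)) (tensor_assoc
      ((\<Prod>\<alpha>\<in>sfaces Y C. cop_term \<alpha> (sinner H C \<alpha>) b (B \<inter> sinner H C \<alpha>)) \<otimes> gen (mins Y C) C (bsum Y C b))) = T C (C \<union> B)"
        by (simp add: T_def)
    qed
    finally show ?thesis .
  qed
  have 2: "tensor_map id \<Delta> (cop_term Y H b C') = (\<Sum>C\<in>Pow C'. T C C')" if C': "C' \<subseteq> H" for C'
  proof -
    have "\<Delta> (gen (mins Y C') C' (bsum Y C' b)) = (\<Sum>C\<in>Pow C'. cop_term (mins Y C') C' (bsum Y C' b) C)"
      using \<Delta>(2)[OF mins_tree[OF C']] by (simp add: cop_def)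
    then show ?thesis
      by (simp add: cop_term_def[of Y] lin_scale[OF lin_tensor_map] tensor_map_tensor[OF l(2,1)] tensor_sum_right qscale_sum)
        (use C' in \<open>auto simp: T_def coassoc_term intro!: sum.cong\<close>)
  qed
  have "tensor_assoc (tensor_map \<Delta> id (cop Y H b)) = (\<Sum>C\<in>Pow H. \<Sum>B\<in>Pow (H - C). T C (C \<union> B))"
    by (simp add: cop_def lin_sum[OF lin_tensor_map] lin_sum[OF lin_tensor_assoc] 1)
  also have "\<dots> = (\<Sum>(C, B)\<in>Sigma (Pow H) (\<lambda>C. Pow (H - C)). T C (C \<union> B))"
    by (rule sum.Sigma) (use finite_H in auto)
  \<comment> \<open>The substitution is \<open>C' = C \<union> B\<close>, with inverse
    \<open>B = C' - C\<close>.\<close>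
  also have "\<dots> = (\<Sum>(C', C)\<in>Sigma (Pow H) Pow. T C C')"
    by (rule sum.reindex_bij_witness[of _ "\<lambda>(C', C). (C, C' - C)" "\<lambda>(C, B). (C \<union> B, C)"]) auto
  also have "\<dots> = (\<Sum>C'\<in>Pow H. \<Sum>C\<in>Pow C'. T C C')"
    by (rule sum.Sigma[symmetric]) (use finite_H finite_subset in auto)
  also have "\<dots> = tensor_map id \<Delta> (cop Y H b)"
    by (simp add: cop_def lin_sum[OF lin_tensor_map] 2)
  finally show ?thesis .
qed

subsection \<open>Dissection diagrams are tree systems\<close>

lemma arc_inject:
  assumes "a \<noteq> b" "c \<noteq> d" "arc {a, b} = arc {c, d}"
  shows "{a, b} = {c, d}"
proof -
  have "{min a b..<max a b} = {min c d..<max c d}" using assms by (simp add: arc_pair)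
  then have "min a b = min c d" "max a b = max c d" using assms(1,2) by (auto simp: atLeastLessThan_eq_iff)
  then show ?thesis by (auto simp: min_def max_def split: if_splits)
qed

text \<open>Call a chord other than \<open>I\<close> admissible if its ends lie in
  \<open>{a..b}\<close>. The path leaves \<open>x\<close> by the admissible chord covering side
  \<open>x\<close> with the greatest upper end. It starts at \<open>x\<close> itself because no
  admissible arc contains \<open>x\<close> in its interior; maximality and the absence of crossings
  carry this property over to its upper end.\<close>

lemma increasing_path:
  fixes K :: "nat set set" and I :: "nat set"
  assumes K: "\<And>c. c \<in> K \<Longrightarrow> \<exists>i j. i \<noteq> j \<and> c = {i, j}" and nc: "noncrossing K"
    and cover: "\<And>s. a \<le> s \<Longrightarrow> s < b \<Longrightarrow> \<exists>J\<in>K. J \<noteq> I \<and> a \<le> Min J \<and> Max J \<le> b \<and> s \<in> arc J"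
  assumes "a \<le> x" "x \<le> b" "\<And>J. J \<in> K \<Longrightarrow> J \<noteq> I \<Longrightarrow> a \<le> Min J \<Longrightarrow> Max J \<le> b \<Longrightarrow> \<not> (Min J < x \<and> x < Max J)"
  shows "\<exists>vs. vs \<noteq> [] \<and> hd vs = x \<and> last vs = b \<and> sorted_wrt (<) vs \<and>
    (\<forall>i. Suc i < length vs \<longrightarrow> {vs ! i, vs ! Suc i} \<in> K - {I})"
  using assms(4-6)
proof (induction "b - x" arbitrary: x rule: less_induct)
  case less
  show ?case
  proof (cases "x = b")
    case True
    then show ?thesis by (intro exI[of _ "[b]"]) simp
  next
    case False
    then have xb: "x < b" using less.prems by simp
    define P where "P J \<longleftrightarrow> J \<in> K \<and> J \<noteq> I \<and> a \<le> Min J \<and> Max J \<le> b \<and> x \<in> arc J" for J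
    obtain J1 where "P J1" unfolding P_def using cover[OF less.prems(1) xb] by blast
    moreover have "\<forall>J. P J \<longrightarrow> Max J < Suc b" by (simp add: P_def less_Suc_eq_le)
    ultimately have "\<exists>J. P J \<and> (\<forall>J'. P J' \<longrightarrow> Max J' \<le> Max J)" by (rule Lattices_Big.ex_has_greatest_nat)
    then obtain J where J: "P J" and J_max: "\<And>J'. P J' \<Longrightarrow> Max J' \<le> Max J" by blast
    have J': "J \<in> K" "J \<noteq> I" "a \<le> Min J" "Max J \<le> b" "Min J \<le> x" "x < Max J"
      using J by (simp_all add: P_def arc_def)
    have minJ: "Min J = x" using less.prems(3)[OF J'(1-4)] J'(5,6) by simp
    obtain p q where "p \<noteq> q" "J = {p, q}" using K[OF J'(1)] by blast
    then have Jeq: "J = {x, Max J}" using minJ by (auto simp: min_def max_def split: if_splits)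
    have unc: "\<not> (Min J2 < Max J \<and> Max J < Max J2)"
      if J2: "J2 \<in> K" "J2 \<noteq> I" "a \<le> Min J2" "Max J2 \<le> b" for J2
    proof
      assume s: "Min J2 < Max J \<and> Max J < Max J2"
      consider "Min J2 < x" | "Min J2 = x" | "x < Min J2" by linarith
      then show False
      proof cases
        case 1
        then show False using less.prems(3)[OF J2] s J'(6) by simp
      next
        case 2
        then have "P J2" using J2 s J'(6) by (simp add: P_def arc_def)
        then show False using J_max s by fastforce
      next
        case 3
        then have "crossing J J2" using s minJ by (simp add: crossing_def)
        then show False using nc J'(1) J2(1) by (simp add: noncrossing_def)
      qed
    qed
    have lt: "b - Max J < b - x" using J'(4,6) by simp
    obtain vs where vs: "vs \<noteq> []" "hd vs = Max J" "last vs = b" "sorted_wrt (<) vs"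
      "\<And>i. Suc i < length vs \<Longrightarrow> {vs ! i, vs ! Suc i} \<in> K - {I}"
      using less.hyps[OF lt _ J'(4) unc] J'(6) less.prems(1) by fastforce
    have hd_le: "hd vs \<le> v" if "v \<in> set vs" for v using vs(1,4) that by (cases vs) auto
    have "sorted_wrt (<) (x # vs)" using vs(4) hd_le vs(2) J'(6) by fastforce
    moreover have "{(x # vs) ! i, (x # vs) ! Suc i} \<in> K - {I}" if i: "Suc i < length (x # vs)" for i
    proof (cases i)
      case 0
      have "vs ! 0 = Max J" using vs(1,2) by (simp add: hd_conv_nth)
      then show ?thesis using 0 Jeq J'(1,2) by simp
    next
      case (Suc k)
      then show ?thesis using vs(5)[of k] i by simp
    qed
    ultimately show ?thesis using vs(1,3) by (intro exI[of _ "x # vs"]) simp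
  qed
qed

text \<open>Otherwise the arc of \<open>I\<close> is tiled by arcs of other chords, which form a cycle with \<open>I\<close>.\<close>

lemma private_side:
  assumes K: "\<And>c. c \<in> K \<Longrightarrow> \<exists>i j. i \<noteq> j \<and> c = {i, j}" and nc: "noncrossing K"
    and ac: "acyclic_chords K" and I: "I \<in> K"
  shows "\<exists>s\<in>arc I. \<forall>J\<in>K. arc J \<subset> arc I \<longrightarrow> s \<notin> arc J"
proof (rule ccontr)
  assume neg: "\<not> ?thesis"
  define a b where "a = Min I" "b = Max I"
  obtain p q where pq: "p \<noteq> q" "I = {p, q}" using K[OF I] by blast
  then have ab: "I = {a, b}" "a < b" by (auto simp: a_b_def min_def max_def)
  have arcI: "arc I = {a..<b}" by (simp add: arc_def a_b_def)
  have cover: "\<exists>J\<in>K. J \<noteq> I \<and> a \<le> Min J \<and> Max J \<le> b \<and> s \<in> arc J" if "a \<le> s" "s < b" for s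
  proof -
    have "s \<in> arc I" using that by (simp add: arcI)
    then obtain J where J: "J \<in> K" "arc J \<subset> arc I" "s \<in> arc J" using neg by blast
    then have "{Min J..<Max J} \<subseteq> {a..<b}" "Min J < Max J" by (auto simp: arc_def a_b_def)
    then have "a \<le> Min J" "Max J \<le> b" by (simp_all add: atLeastLessThan_subset_iff)
    moreover have "J \<noteq> I" using J(2) by auto
    ultimately show ?thesis using J(1,3) by (intro bexI[of _ J] conjI)
  qed
  have "\<exists>vs. vs \<noteq> [] \<and> hd vs = a \<and> last vs = b \<and> sorted_wrt (<) vs \<and>
    (\<forall>i. Suc i < length vs \<longrightarrow> {vs ! i, vs ! Suc i} \<in> K - {I})"
    by (rule increasing_path[OF K nc cover]) (use ab in auto)
  then obtain vs where vs: "vs \<noteq> []" "hd vs = a" "last vs = b" "sorted_wrt (<) vs"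
    "\<And>i. Suc i < length vs \<Longrightarrow> {vs ! i, vs ! Suc i} \<in> K - {I}" by blast
  have v0: "vs ! 0 = a" and vl: "vs ! (length vs - 1) = b" using vs by (simp_all add: hd_conv_nth last_conv_nth)
  have "length vs \<noteq> 1" using v0 vl ab(2) by auto
  moreover have "length vs \<noteq> 2" using v0 vl vs(5)[of 0] ab(1) by auto
  moreover have "length vs \<noteq> 0" using vs(1) by simp
  ultimately have len: "3 \<le> length vs" by linarith
  have "distinct vs" using vs(4) strict_sorted_iff by blast
  moreover have "{vs ! i, vs ! (Suc i mod length vs)} \<in> K" if i: "i < length vs" for i
  proof (cases "Suc i < length vs")
    case True
    then show ?thesis using vs(5)[OF True] by simp
  next
    case False
    then have "i = length vs - 1" "Suc i = length vs" using i by auto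
    then show ?thesis using v0 vl ab(1) I by (simp add: insert_commute)
  qed
  ultimately show False using ac len unfolding acyclic_chords_def by blast
qed

lemma dissection_diagramD:
  assumes "dissection_diagram D"
  shows "\<And>c. c \<in> chords D \<Longrightarrow> \<exists>i j. i \<noteq> j \<and> i \<le> deg D \<and> j \<le> deg D \<and> c = {i, j}"
    "card (chords D) = deg D" "noncrossing (chords D)" "acyclic_chords (chords D)"
    "finite (chords D)"
proof -
  have *: "chords D \<subseteq> {{i, j} | i j. i \<le> deg D \<and> j \<le> deg D \<and> i \<noteq> j}"
    using assms by (simp add: dissection_diagram_def)
  show "\<exists>i j. i \<noteq> j \<and> i \<le> deg D \<and> j \<le> deg D \<and> c = {i, j}" if "c \<in> chords D" for c
    using subsetD[OF * that] by blast
  have "chords D \<subseteq> Pow {..deg D}" using * by auto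
  then show "finite (chords D)" by (rule finite_subset) simp
  show "card (chords D) = deg D" "noncrossing (chords D)" "acyclic_chords (chords D)"
    using assms by (simp_all add: dissection_diagram_def noncrossing_def)
qed

text \<open>Each chord gets a private side, lying in its arc but in no strictly smaller arc. The
  private sides are distinct, and a count shows that they are all the sides except
  \<open>deg D\<close>, which lies in no arc. Hence any two sides are separated, and the nesting of
  the arcs yields the dual edges.\<close>

lemma dissection_tree:
  assumes D: "dissection_diagram D"
  shows "tree_sys {0..deg D} (chords D)"
proof -
  let ?n = "deg D" and ?K = "chords D"
  note K = dissection_diagramD[OF D]
  have K2: "\<exists>i j. i \<noteq> j \<and> c = {i, j}" if "c \<in> ?K" for c using K(1)[OF that] by blast
  have arc_le: "arc c \<subseteq> {0..<?n}" if c: "c \<in> ?K" for c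
  proof -
    obtain i j where "i \<le> ?n" "j \<le> ?n" "c = {i, j}" using K(1)[OF c] by blast
    then show ?thesis by (auto simp: arc_pair)
  qed
  have arc_inj: "c = d" if cd: "c \<in> ?K" "d \<in> ?K" "arc c = arc d" for c d
  proof -
    obtain i j where 1: "i \<noteq> j" "c = {i, j}" using K2[OF cd(1)] by blast
    obtain k l where 2: "k \<noteq> l" "d = {k, l}" using K2[OF cd(2)] by blast
    show ?thesis using arc_inject[OF 1(1) 2(1)] cd(3) 1 2 by simp
  qed
  have lam: "arc c \<inter> arc d = {} \<or> arc c \<subseteq> arc d \<or> arc d \<subseteq> arc c" if cd: "c \<in> ?K" "d \<in> ?K" for c d
  proof -
    obtain i j where 1: "i \<noteq> j" "c = {i, j}" using K2[OF cd(1)] by blast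
    obtain k l where 2: "k \<noteq> l" "d = {k, l}" using K2[OF cd(2)] by blast
    have "\<not> crossing c d" "\<not> crossing d c" using K(3) cd by (auto simp: noncrossing_def)
    then show ?thesis unfolding 1(2) 2(2) by (rule laminar)
  qed
  have "\<forall>I\<in>?K. \<exists>s. s \<in> arc I \<and> (\<forall>J\<in>?K. arc J \<subset> arc I \<longrightarrow> s \<notin> arc J)"
    using private_side[OF K2 K(3,4)] by blast
  then obtain p where p: "\<And>I. I \<in> ?K \<Longrightarrow> p I \<in> arc I"
    and priv: "\<And>I J. I \<in> ?K \<Longrightarrow> J \<in> ?K \<Longrightarrow> arc J \<subset> arc I \<Longrightarrow> p I \<notin> arc J" by metis
  have up: "arc I \<subseteq> arc J" if "I \<in> ?K" "J \<in> ?K" "p I \<in> arc J" for I J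
    using lam[OF that(1,2)] priv[OF that(1,2)] p[OF that(1)] that(3) by blast
  have inj: "inj_on p ?K"
  proof (rule inj_onI)
    fix I J assume IJ: "I \<in> ?K" "J \<in> ?K" "p I = p J"
    then have "arc I = arc J" using up[of I J] up[of J I] p[of I] p[of J] by auto
    then show "I = J" using arc_inj IJ by blast
  qed
  have "p ` ?K \<subseteq> {0..<?n}" using p arc_le by blast
  moreover have "card (p ` ?K) = card {0..<?n}" using card_image[OF inj] K(2) by simp
  \<comment> \<open>The number of chords enters here: \<open>deg D\<close> distinct private sides
    fill \<open>{0..<deg D}\<close>.\<close>
  ultimately have surj: "p ` ?K = {0..<?n}" by (intro card_subset_eq) auto
  show ?thesis
    unfolding tree_sys_def
  proof (intro conjI ballI impI)
    show "\<exists>a b. a \<noteq> b \<and> c = {a, b}" if "c \<in> ?K" for c using K2[OF that] .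
    show "finite ?K" "noncrossing ?K" by (fact K)+
    have sep1: "\<exists>c\<in>?K. sep c s t" if st: "s < ?n" "t \<le> ?n" "s \<noteq> t" for s t
    proof -
      have "s \<in> p ` ?K" using surj st by simp
      then obtain I where I: "I \<in> ?K" "s = p I" by blast
      show ?thesis
      proof (cases "t \<in> arc I")
        case False
        then have "sep I s t" using p[OF I(1)] I(2) by (simp add: sep_def)
        then show ?thesis using I by blast
      next
        case True
        then have "t \<in> p ` ?K" using arc_le[OF I(1)] surj by auto
        then obtain J where J: "J \<in> ?K" "t = p J" by blast
        have "s \<notin> arc J"
        proof
          assume "s \<in> arc J"
          then have "arc I = arc J" using up[OF I(1) J(1)] up[OF J(1) I(1)] True I J by auto
          then show False using arc_inj[OF I(1) J(1)] I J st by simp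
        qed
        then have "sep J s t" using p[OF J(1)] J(2) by (simp add: sep_def)
        then show ?thesis using J by blast
      qed
    qed
    show "\<exists>c\<in>?K. sep c s t" if st: "s \<in> {0..?n}" "t \<in> {0..?n}" "s \<noteq> t" for s t
    proof (cases "s < ?n")
      case True
      then show ?thesis using sep1[of s t] st by simp
    next
      case False
      then have "t < ?n" using st by simp
      then show ?thesis using sep1[of t s] st sep_commute by auto
    qed
    show "\<exists>s\<in>{0..?n}. \<exists>t\<in>{0..?n}. s < t \<and> dual ?K I s t" if I: "I \<in> ?K" for I
    proof -
      \<comment> \<open>The other end of the dual edge is the private side of the smallest arc
        strictly containing that of \<open>I\<close>, or side \<open>deg D\<close> if there is
        none.\<close>
      have "\<exists>t\<le>?n. dual ?K I (p I) t"
      proof (cases "\<exists>J\<in>?K. arc I \<subset> arc J")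
        case False
        have "sep d (p I) ?n \<longleftrightarrow> d = I" if d: "d \<in> ?K" for d
        proof -
          have "?n \<notin> arc d" using arc_le[OF d] by auto
          moreover have "p I \<in> arc d \<longleftrightarrow> d = I" using up[OF I d] p[OF I] False d arc_inj[OF I d] by blast
          ultimately show ?thesis by (simp add: sep_def)
        qed
        then show ?thesis unfolding dual_def by blast
      next
        case True
        then obtain J0 where "J0 \<in> ?K \<and> arc I \<subset> arc J0" by blast
        then obtain J where J: "J \<in> ?K" "arc I \<subset> arc J"
          and J_min: "\<And>J'. J' \<in> ?K \<Longrightarrow> arc I \<subset> arc J' \<Longrightarrow> card (arc J) \<le> card (arc J')"
          using ex_has_least_nat[of "\<lambda>J. J \<in> ?K \<and> arc I \<subset> arc J" J0 "\<lambda>J. card (arc J)"] by blast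
        have "sep d (p I) (p J) \<longleftrightarrow> d = I" if d: "d \<in> ?K" for d
        proof (cases "d = I")
          case True
          then show ?thesis using p[OF I] priv[OF J(1) I J(2)] by (simp add: sep_def)
        next
          case False
          have "p J \<in> arc d" if pd: "p I \<in> arc d"
          proof -
            have "arc I \<subset> arc d" using up[OF I d pd] arc_inj[OF I d] False by blast
            then have le: "card (arc J) \<le> card (arc d)" by (rule J_min[OF d])
            have "arc I \<noteq> {}" using p[OF I] by blast
            then have "arc J \<subseteq> arc d \<or> arc d \<subseteq> arc J" using lam[OF J(1) d] J(2) \<open>arc I \<subset> arc d\<close> by blast
            moreover have "arc d = arc J" if "arc d \<subseteq> arc J"
              using card_seteq[OF _ that le] by (simp add: arc_def)
            ultimately show ?thesis using p[OF J(1)] by blast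
          qed
          moreover have "p I \<in> arc d" if "p J \<in> arc d"
            using up[OF J(1) d that] J(2) p[OF I] by blast
          ultimately show ?thesis using False by (auto simp: sep_def)
        qed
        then show ?thesis unfolding dual_def using arc_le[OF J(1)] p[OF J(1)] by (intro exI[of _ "p J"]) auto
      qed
      then obtain t where t: "t \<le> ?n" "dual ?K I (p I) t" by blast
      have "p I \<noteq> t" using t(2) I by (auto simp: dual_def)
      moreover have "p I \<le> ?n" using p[OF I] arc_le[OF I] by auto
      ultimately show ?thesis using t dual_commute[of ?K I] by (metis atLeastAtMost_iff le0 linorder_neqE_nat)
    qed
  qed auto
qed

section \<open>Trees on the standard polygon and their cuts\<close>

locale rooted_tree = tree_system "{0..n}" K for n K +
  assumes chord_le: "c \<in> K \<Longrightarrow> c \<subseteq> {0..n}"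
begin

lemma card_K: "card K = n"
  using card_eq by simp

text \<open>\<open>{s<..t}\<close> is the fundamental cut of the tree edge \<open>c\<close>: no
  other chord crosses it.\<close>

lemma cut_iff:
  assumes "{v, w} \<in> K" "s < t" "dual K c s t"
  shows "((v \<in> {s<..t}) \<noteq> (w \<in> {s<..t})) \<longleftrightarrow> {v, w} = c"
  using sep_cut[OF assms(2), of v w] dualD[OF assms(3,1)] by simp

text \<open>The rest of a cycle would lead from \<open>vs ! 1\<close> back to \<open>vs ! 0\<close>
  without crossing the cut of the first chord, which has these vertices on different sides.\<close>

lemma acyclic: "acyclic_chords K"
  unfolding acyclic_chords_def
proof (intro notI, elim exE conjE)
  fix vs assume len: "3 \<le> length vs" and dist: "distinct vs"
    and e: "\<forall>i<length vs. {vs ! i, vs ! (Suc i mod length vs)} \<in> K"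
  let ?c = "{vs ! 0, vs ! 1}" and ?m = "length vs"
  have "vs \<noteq> []" using len by auto
  then have c: "?c \<in> K" using e[rule_format, of 0] len by simp
  obtain s t where st: "s \<in> {0..n}" "t \<in> {0..n}" "s < t" "dual K ?c s t" using dualE[OF c] .
  have step: "vs ! i \<in> {s<..t} \<longleftrightarrow> vs ! (Suc i mod ?m) \<in> {s<..t}" if i: "0 < i" "i < ?m" for i
  proof -
    have m: "Suc i mod ?m < ?m" using i by (intro mod_less_divisor) linarith
    have l0: "0 < ?m" and l1: "1 < ?m" using len by linarith+
    have "vs ! i \<noteq> vs ! 0" using nth_eq_iff_index_eq[OF dist i(2) l0] i by simp
    moreover have "vs ! i \<noteq> vs ! 1 \<or> vs ! (Suc i mod ?m) \<noteq> vs ! 0"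
    proof (cases "i = 1")
      case True
      then have "Suc i mod ?m = 2" using len by (simp add: numeral_2_eq_2)
      then show ?thesis using nth_eq_iff_index_eq[OF dist m l0] by simp
    next
      case False
      then show ?thesis using nth_eq_iff_index_eq[OF dist i(2) l1] by simp
    qed
    ultimately have "{vs ! i, vs ! (Suc i mod ?m)} \<noteq> ?c" by (auto simp: doubleton_eq_iff)
    then show ?thesis using cut_iff[OF e[rule_format, OF i(2)] st(3,4)] by blast
  qed
  have "vs ! (Suc i mod ?m) \<in> {s<..t} \<longleftrightarrow> vs ! 1 \<in> {s<..t}" if "i < ?m" for i
    using that
  proof (induction i)
    case 0
    then show ?case using len by simp
  next
    case (Suc i)
    then have "Suc i mod ?m = Suc i" by simp
    then show ?case using Suc.IH Suc.prems step[of "Suc i"] by simp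
  qed
  moreover have "?m - 1 < ?m" "Suc (?m - 1) = ?m" using len by linarith+
  then have "?m - 1 < ?m" "Suc (?m - 1) mod ?m = 0" by simp_all
  ultimately have "vs ! 0 \<in> {s<..t} \<longleftrightarrow> vs ! 1 \<in> {s<..t}" by metis
  then show False using cut_iff[OF c st(3,4)] by simp
qed

lemma dissection_diagram_tree:
  assumes "deg D = n" "chords D = K"
  shows "dissection_diagram D"
proof -
  have "c \<in> {{i, j} | i j. i \<le> n \<and> j \<le> n \<and> i \<noteq> j}" if c: "c \<in> K" for c
  proof -
    obtain a b where "a \<noteq> b" "c = {a, b}" using chordE[OF c] .
    then show ?thesis using chord_le[OF c] by auto
  qed
  then show ?thesis
    unfolding dissection_diagram_def assms
    using card_K noncrossing acyclic by (auto simp: noncrossing_def)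
qed

end

subsection \<open>Parents\<close>

lemma joined_refl: "joined K x x"
  by (simp add: joined_def)

lemma joined_trans: "joined K x y \<Longrightarrow> joined K y z \<Longrightarrow> joined K x z"
  unfolding joined_def by (rule rtrancl_trans)

lemma joined_edge: "{x, y} \<in> K \<Longrightarrow> joined K x y"
  unfolding joined_def by auto

lemma joined_sym: "joined K x y \<Longrightarrow> joined K y x"
proof -
  have "sym {(x, y). {x, y} \<in> K}" by (auto simp: sym_def insert_commute)
  then show "joined K x y \<Longrightarrow> joined K y x" unfolding joined_def by (meson symD sym_rtrancl)
qed

lemma joined_invariant:
  assumes "joined K x y" "\<And>u v. {u, v} \<in> K \<Longrightarrow> h u = h v"
  shows "h x = h y"
  using assms(1) unfolding joined_def
  by (induction rule: rtrancl_induct) (use assms(2) in auto)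

text \<open>After its last passage through the removed edge, a path to \<open>z\<close> continues
  from \<open>u\<close> or \<open>v\<close> without it.\<close>

lemma joined_remove:
  assumes "joined K x z"
  shows "joined (K - {{u, v}}) x z \<or> joined (K - {{u, v}}) u z \<or> joined (K - {{u, v}}) v z"
  using assms unfolding joined_def
proof (induction rule: converse_rtrancl_induct)
  case (step x y)
  show ?case
  proof (cases "{x, y} = {u, v}")
    case True
    then have "y = u \<or> y = v" "x = u \<or> x = v" by (auto simp: doubleton_eq_iff)
    then show ?thesis using step.IH True by (auto simp: doubleton_eq_iff)
  next
    case False
    then have "(x, y) \<in> {(x, y). {x, y} \<in> K - {{u, v}}}" using step.hyps by simp
    then show ?thesis using step.IH by (meson converse_rtrancl_into_rtrancl)
  qed
qed simp

lemma joined_chain: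
  assumes "i \<le> j" "\<And>x. i \<le> x \<Longrightarrow> x < j \<Longrightarrow> joined K x (Suc x)"
  shows "joined K i j"
  using assms
  by (induction j rule: dec_induct) (auto intro: joined_refl joined_trans)

section \<open>Paths to the root and the directions of the chords\<close>

context rooted_tree
begin

lemma not_n_arc: "c \<in> K \<Longrightarrow> n \<notin> arc c"
proof -
  assume c: "c \<in> K"
  obtain a b where "a \<noteq> b" "c = {a, b}" using chordE[OF c] .
  then show "n \<notin> arc c" using chord_le[OF c] by (auto simp: arc_pair)
qed

lemma sep_n: "c \<in> K \<Longrightarrow> sep c x n \<longleftrightarrow> x \<in> arc c"
  using not_n_arc by (simp add: sep_def)

text \<open>The ends of side \<open>u\<close> are joined by going around the innermost chord cutting off \<open>u\<close>; by
  induction the other sides met on the way may be used as if they were chords.\<close>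

lemma joined_Suc_innermost:
  assumes "c \<in> K" "u \<in> arc c" "t \<in> {0..n}" "t \<notin> arc c" "dual K c u t"
  shows "joined K u (Suc u)"
  using assms
proof (induction "card (arc c)" arbitrary: c u t rule: less_induct)
  case less
  obtain a b where ab: "a < b" "c = {a, b}"
    using chordE[OF less.prems(1)] by (metis insert_commute linorder_neqE_nat)
  have arcc: "arc c = {a..<b}" using ab by (simp add: arc_pair)
  have bn: "b \<le> n" using chord_le[OF less.prems(1)] ab by auto
  have u: "a \<le> u" "u < b" "u \<in> {0..n}" using less.prems(2) arcc bn by auto
  have step: "joined K x (Suc x)" if x: "x \<in> arc c" "x \<noteq> u" for x
  proof -
    have xn: "x \<in> {0..n}" "n \<in> {0..n}" "x \<noteq> n" using x arcc bn by auto
    obtain d t' where d: "d \<in> K" "t' \<in> {0..n}" "dual K d x t'" "sep d x n" "\<not> sep d t' n"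
      and nest: "\<And>e y. e \<in> K \<Longrightarrow> sep e x n \<Longrightarrow> sep d y n \<Longrightarrow> y \<in> {0..n} \<Longrightarrow> sep e y n"
      using innermost[OF xn] by blast
    have sub: "arc d \<subseteq> arc c"
    proof
      fix y assume y: "y \<in> arc d"
      obtain a' b' where "a' \<noteq> b'" "d = {a', b'}" using chordE[OF d(1)] .
      then have "y \<in> {0..n}" using y chord_le[OF d(1)] by (auto simp: arc_pair)
      then show "y \<in> arc c" using nest[OF less.prems(1), of y] x(1) y sep_n[OF less.prems(1)] sep_n[OF d(1)] by simp
    qed
    have "u \<notin> arc d"
    proof
      assume ud: "u \<in> arc d"
      show False
      proof (cases "d = c")
        case True
        then have "dual K c x t'" "\<not> sep c u x" using d x(1) less.prems(2) by (auto simp: sep_def)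
        then show False using dual_eq[OF less.prems(1) u(3) xn(1) less.prems(5)] x(2) by blast
      next
        case False
        then have "\<not> sep d u t" using dualD[OF less.prems(5) d(1)] by simp
        then show False using ud sub less.prems(4) by (auto simp: sep_def)
      qed
    qed
    then have "arc d \<subset> arc c" using sub less.prems(2) by blast
    then have lt: "card (arc d) < card (arc c)" by (intro psubset_card_mono) (simp_all add: arcc)
    show ?thesis
      by (rule less.hyps[OF lt d(1) _ d(2) _ d(3)]) (use d sep_n[OF d(1)] in auto)
  qed
  have "joined K a u" by (rule joined_chain) (use u step arcc in auto)
  moreover have "joined K (Suc u) b" by (rule joined_chain) (use u step arcc in auto)
  moreover have "joined K a b" using less.prems(1) ab by (intro joined_edge) simp
  ultimately show ?case by (meson joined_sym joined_trans)
qed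

lemma joined_root:
  assumes "v \<le> n"
  shows "joined K v 0"
proof -
  have step: "joined K u (Suc u)" if u: "u < n" for u
  proof -
    have un: "u \<in> {0..n}" "n \<in> {0..n}" "u \<noteq> n" using u by auto
    show ?thesis
    proof (rule innermost[OF un])
      fix c t assume "c \<in> K" "t \<in> {0..n}" "dual K c u t" "sep c u n" "\<not> sep c t n"
      then show ?thesis using joined_Suc_innermost[of c u t] sep_n[of c] by simp
    qed
  qed
  have "joined K 0 v"
  proof (rule joined_chain)
    show "joined K x (Suc x)" if "x < v" for x by (rule step) (use that assms in simp)
  qed simp
  then show ?thesis by (rule joined_sym)
qed

text \<open>All other chords stay on one side of the cut, and the root 0 is outside
  \<open>{s<..t}\<close>.\<close>

lemma not_joined_cut:
  assumes "c \<in> K" "s < t" "dual K c s t" "v \<in> {s<..t}"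
  shows "\<not> joined (K - {c}) v 0"
proof
  assume "joined (K - {c}) v 0"
  then have "(v \<in> {s<..t}) = (0 \<in> {s<..t})"
  proof (rule joined_invariant)
    fix x y assume "{x, y} \<in> K - {c}"
    then show "(x \<in> {s<..t}) = (y \<in> {s<..t})" using cut_iff[of x y, OF _ assms(2,3)] by auto
  qed
  then show False using assms(4) by simp
qed

lemma joined_cut:
  assumes "{v, w} \<in> K" "s < t" "dual K {v, w} s t" "v \<in> {s<..t}"
  shows "joined (K - {{v, w}}) w 0"
proof -
  have "w \<le> n" using chord_le[OF assms(1)] by simp
  then have "joined K w 0" by (rule joined_root)
  from joined_remove[OF this, of v w] show ?thesis using not_joined_cut[OF assms] by blast
qed

text \<open>Two chords directed away from \<open>v\<close> would have overlapping cuts. A chord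
  separating the outermost sides of these cuts, one from each, then leads to a
  contradiction.\<close>

lemma source_unique:
  assumes c: "{v, w} \<in> K" "s \<in> {0..n}" "t \<in> {0..n}" "s < t" "dual K {v, w} s t" "v \<in> {s<..t}"
    and d: "{v, j} \<in> K" "s' \<in> {0..n}" "t' \<in> {0..n}" "s' < t'" "dual K {v, j} s' t'" "v \<in> {s'<..t'}"
  shows "w = j"
proof (rule ccontr)
  assume "w \<noteq> j"
  then have ne: "{v, w} \<noteq> {v, j}" by (auto simp: doubleton_eq_iff)
  have in_out: "w \<notin> {s<..t}" "j \<in> {s<..t}" "j \<notin> {s'<..t'}" "w \<in> {s'<..t'}"
    using cut_iff[OF c(1) c(4,5)] cut_iff[OF d(1) c(4,5)] cut_iff[OF d(1) d(4,5)] cut_iff[OF c(1) d(4,5)] ne c(6) d(6)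
    by auto
  have A: False if c: "{v, w} \<in> K" "s \<in> {0..n}" "t \<in> {0..n}" "s < t" "dual K {v, w} s t" "v \<in> {s<..t}"
    and d: "{v, j} \<in> K" "s' \<in> {0..n}" "t' \<in> {0..n}" "s' < t'" "dual K {v, j} s' t'" "v \<in> {s'<..t'}"
    and io: "w \<notin> {s<..t}" "j \<in> {s<..t}" "j \<notin> {s'<..t'}" "w \<in> {s'<..t'}" and ss: "s < s'" for w j s t s' t'
  proof -
    \<comment> \<open>Altogether \<open>s < j \<le> s' < v \<le> t < w \<le> t'\<close>.\<close>
    have ord: "s < s'" "s' < t" "t < t'" "t < w" "w \<le> t'" "s < j" "j \<le> s'" "s' < v" "v \<le> t" using ss io c(6) d(6) by auto
    obtain e where e: "e \<in> K" "sep e s t'" using separated[OF c(2) d(3)] ord by auto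
    have "\<not> sep {v, w} s t'" "\<not> sep {v, j} s t'" using ord by (auto simp: sep_def arc_pair)
    then have "e \<noteq> {v, w}" "e \<noteq> {v, j}" using e by auto
    then have "\<not> sep e s t" "\<not> sep e s' t'" using dualD[OF c(5) e(1)] dualD[OF d(5) e(1)] by auto
    \<comment> \<open>Membership in the arc of \<open>e\<close> agrees at \<open>s\<close> and
      \<open>t\<close>, agrees at \<open>s'\<close> and \<open>t'\<close>, and differs at
      \<open>s\<close> and \<open>t'\<close>. It would thus alternate along
      \<open>s < s' < t < t'\<close>, which is impossible for an interval.\<close>
    then show False using e(2) ord by (auto simp: sep_def arc_def)
  qed
  have "s \<noteq> s'" using in_out c(6) d(6) by auto
  then consider "s < s'" | "s' < s" by linarith
  then show False
  proof cases
    case 1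
    then show False using A[OF c d in_out] by blast
  next
    case 2
    then show False using A[OF d c in_out(3,4,1,2)] by blast
  qed
qed

text \<open>This matches the direction given by the cut with the one defined by paths: removing the
  chord disconnects its end inside the cut from the root, and leaves the other end joined to
  it.\<close>

lemma parent_eq:
  assumes D: "chords D = K"
    and c: "{v, w} \<in> K" "s \<in> {0..n}" "t \<in> {0..n}" "s < t" "dual K {v, w} s t" "v \<in> {s<..t}"
  shows "parent D v = w"
  unfolding parent_def D
proof (rule the_equality)
  show "{v, w} \<in> K \<and> joined (K - {{v, w}}) w 0" using c(1) joined_cut[OF c(1,4-6)] by blast
  fix j assume j: "{v, j} \<in> K \<and> joined (K - {{v, j}}) j 0"
  obtain s' t' where st': "s' \<in> {0..n}" "t' \<in> {0..n}" "s' < t'" "dual K {v, j} s' t'" using dualE[of "{v, j}"] j by blast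
  have "j \<notin> {s'<..t'}" using not_joined_cut[OF _ st'(3,4)] j by blast
  then have "v \<in> {s'<..t'}" using cut_iff[OF _ st'(3,4)] j by blast
  then show "j = w" using source_unique[OF c _ st'] j by blast
qed

lemma source_exists:
  assumes "c \<in> K"
  obtains v w s t where "c = {v, w}" "v \<noteq> w" "s \<in> {0..n}" "t \<in> {0..n}" "s < t" "dual K c s t" "v \<in> {s<..t}" "w \<notin> {s<..t}"
proof -
  obtain a b where ab: "a \<noteq> b" "c = {a, b}" using chordE[OF assms] .
  obtain s t where st: "s \<in> {0..n}" "t \<in> {0..n}" "s < t" "dual K c s t" using dualE[OF assms] .
  have "(a \<in> {s<..t}) \<noteq> (b \<in> {s<..t})" using cut_iff[of a b s t c] st ab assms by simp
  then consider "a \<in> {s<..t}" "b \<notin> {s<..t}" | "b \<in> {s<..t}" "a \<notin> {s<..t}" by blast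
  then show ?thesis
  proof cases
    case 1
    show ?thesis by (rule that[OF ab(2,1) st 1])
  next
    case 2
    have "c = {b, a}" "b \<noteq> a" using ab by auto
    then show ?thesis by (rule that[OF _ _ st 2])
  qed
qed

lemma chord_surj:
  assumes D: "chords D = K" and c: "c \<in> K"
  shows "\<exists>i\<in>{1..n}. c = chord D i"
proof -
  obtain v w s t where *: "c = {v, w}" "s \<in> {0..n}" "t \<in> {0..n}" "s < t" "dual K c s t" "v \<in> {s<..t}"
    by (rule source_exists[OF c])
  have "parent D v = w" by (rule parent_eq[OF D _ *(2-4) _ *(6)]) (use * c in auto)
  then have "c = chord D v" using * by (simp add: chord_def)
  moreover have "v \<in> {1..n}" using *(3,6) by auto
  ultimately show ?thesis by blast
qed

lemma chord_bij:
  assumes D: "chords D = K"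
  shows "bij_betw (chord D) {1..n} K"
proof -
  have "K \<subseteq> chord D ` {1..n}" using chord_surj[OF D] by blast
  moreover have "card (chord D ` {1..n}) \<le> card K" using card_image_le[of "{1..n}" "chord D"] card_K by simp
  ultimately have "chord D ` {1..n} = K" by (metis card_seteq finite_atLeastAtMost finite_imageI)
  then show ?thesis by (simp add: bij_betw_def eq_card_imp_inj_on card_K)
qed

lemma chord_in: "chords D = K \<Longrightarrow> i \<in> {1..n} \<Longrightarrow> chord D i \<in> K"
  using bij_betwE[OF chord_bij] by blast

lemma chord_inj:
  "chords D = K \<Longrightarrow> i \<in> {1..n} \<Longrightarrow> j \<in> {1..n} \<Longrightarrow> chord D i = chord D j \<Longrightarrow> i = j"
  by (rule inj_onD[OF bij_betw_imp_inj_on[OF chord_bij]])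

lemma parent_cut:
  assumes D: "chords D = K" and i: "i \<in> {1..n}"
  obtains s t where "s \<in> {0..n}" "t \<in> {0..n}" "s < t" "dual K (chord D i) s t" "i \<in> {s<..t}" "parent D i \<notin> {s<..t}"
proof -
  have c: "chord D i \<in> K" using chord_bij[OF D] i by (auto simp: bij_betw_def)
  obtain v w s t where *: "chord D i = {v, w}" "v \<noteq> w" "s \<in> {0..n}" "t \<in> {0..n}" "s < t"
    "dual K (chord D i) s t" "v \<in> {s<..t}" "w \<notin> {s<..t}"
    using source_exists[OF c] .
  have "{v, w} \<in> K" "dual K {v, w} s t" using * c by simp_all
  then have p: "parent D v = w" using parent_eq[OF D _ *(3-5) _ *(7)] by blast
  then have "chord D v = chord D i" using *(1) by (simp add: chord_def)
  moreover have "v \<in> {1..n}" using *(4,7) by auto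
  ultimately have "v = i" using chord_bij[OF D] i by (auto simp: bij_betw_def dest: inj_onD)
  then show ?thesis using that[OF *(3-6)] *(7,8) p by simp
qed

end

lemma dissection_rooted_tree:
  assumes "dissection_diagram D"
  shows "rooted_tree (deg D) (chords D)"
proof
  show "tree_sys {0..deg D} (chords D)" by (rule dissection_tree[OF assms])
  show "c \<subseteq> {0..deg D}" if "c \<in> chords D" for c
    using dissection_diagramD(1)[OF assms that] by auto
qed

subsection \<open>Contractions and gauges\<close>

text \<open>The decoration of \<open>e\<close> after the translation by \<open>\<phi>\<close>.  Contracting an edge for which it vanishes
  does not change it for any other edge.\<close>

definition gauged :: "(nat \<Rightarrow> 'l) \<Rightarrow> 'l::ab_group_add graph \<Rightarrow> edge \<Rightarrow> 'l" where
  "gauged \<phi> G e = dec G e + \<phi> (tgt G e) - \<phi> (src G e)"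

lemma gauged_contract:
  assumes "gauged \<phi> G e = 0"
  shows "gauged \<phi> (contract e G) f = gauged \<phi> G f"
proof -
  have "dec G e = \<phi> (src G e) - \<phi> (tgt G e)" using assms by (simp add: gauged_def algebra_simps)
  then show ?thesis by (simp add: gauged_def contract_def algebra_simps)
qed

text \<open>\<open>F\<close> records how vertices have been identified so far, starting from the
  original ends \<open>s0\<close> and \<open>t0\<close>. The clause on \<open>h\<close> bounds the
  identification from above: a function that takes equal values at the ends of every contracted edge
  still distinguishes the vertices it distinguished before.\<close>

lemma fold_contract:
  fixes G :: "'l::ab_group_add graph"
  assumes "src G = (\<lambda>e. F (s0 e))" "tgt G = (\<lambda>e. F (t0 e))"
  shows "\<exists>F'. src (fold contract es G) = (\<lambda>e. F' (s0 e)) \<and> tgt (fold contract es G) = (\<lambda>e. F' (t0 e)) \<and>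
    (\<forall>e\<in>set es. F' (s0 e) = F' (t0 e)) \<and> (\<forall>u v. F u = F v \<longrightarrow> F' u = F' v) \<and>
    (\<forall>h :: nat \<Rightarrow> nat. (\<forall>v. h (F v) = h v) \<longrightarrow> (\<forall>e\<in>set es. h (s0 e) = h (t0 e)) \<longrightarrow> (\<forall>v. h (F' v) = h v)) \<and>
    edges (fold contract es G) = edges G - set es \<and>
    (\<forall>\<phi>. (\<forall>e\<in>set es. gauged \<phi> G e = 0) \<longrightarrow> gauged \<phi> (fold contract es G) = gauged \<phi> G)"
  using assms
proof (induction es arbitrary: G F)
  case Nil
  then show ?case by (intro exI[of _ F]) simp
next
  case (Cons e es)
  define F1 where "F1 v = (if F v = F (s0 e) then F (t0 e) else F v)" for v
  have 1: "src (contract e G) = (\<lambda>f. F1 (s0 f))" "tgt (contract e G) = (\<lambda>f. F1 (t0 f))"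
    by (auto simp: contract_def Cons.prems F1_def)
  obtain F' where src: "src (fold contract es (contract e G)) = (\<lambda>e. F' (s0 e))"
    and tgt: "tgt (fold contract es (contract e G)) = (\<lambda>e. F' (t0 e))"
    and es: "\<forall>e\<in>set es. F' (s0 e) = F' (t0 e)"
    and F1: "\<forall>u v. F1 u = F1 v \<longrightarrow> F' u = F' v"
    and h: "\<forall>h :: nat \<Rightarrow> nat. (\<forall>v. h (F1 v) = h v) \<longrightarrow> (\<forall>e\<in>set es. h (s0 e) = h (t0 e)) \<longrightarrow> (\<forall>v. h (F' v) = h v)"
    and ed: "edges (fold contract es (contract e G)) = edges (contract e G) - set es"
    and ga: "\<forall>\<phi>. (\<forall>f\<in>set es. gauged \<phi> (contract e G) f = 0) \<longrightarrow>
      gauged \<phi> (fold contract es (contract e G)) = gauged \<phi> (contract e G)"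
    using Cons.IH[OF 1]
    apply (elim exE conjE)
    subgoal premises p for F2 by (rule p(1)[of F2, OF p(2-8)])
    done
  have F1_eq: "F1 (s0 e) = F1 (t0 e)" by (simp add: F1_def)
  show ?case
  proof (intro exI[of _ F'] conjI ballI allI impI)
    show "F' (s0 f) = F' (t0 f)" if "f \<in> set (e # es)" for f
      using that es F1[rule_format, OF F1_eq] by auto
    show "F' u = F' v" if "F u = F v" for u v by (rule F1[rule_format]) (simp add: F1_def that)
    show "h' (F' v) = h' v" if hF: "\<forall>v. h' (F v) = h' v" and he: "\<forall>f\<in>set (e # es). h' (s0 f) = h' (t0 f)"
      for h' :: "nat \<Rightarrow> nat" and v
    proof (rule h[rule_format])
      have "h' (F (s0 e)) = h' (F (t0 e))" using hF he by simp
      then show "h' (F1 v) = h' v" for v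
        using hF[rule_format, of v] by (cases "F v = F (s0 e)") (simp_all add: F1_def)
    qed (use he in simp)
    show "edges (fold contract (e # es) G) = edges G - set (e # es)"
      by (simp add: ed) (auto simp: contract_def)
    show "gauged \<phi> (fold contract (e # es) G) = gauged \<phi> G" if "\<forall>f\<in>set (e # es). gauged \<phi> G f = 0" for \<phi>
    proof -
      have c: "gauged \<phi> (contract e G) = gauged \<phi> G" using gauged_contract[of \<phi> G e] that by (simp add: fun_eq_iff)
      show ?thesis using ga[rule_format, of \<phi>] that by (simp add: c)
    qed
  qed (simp_all add: src tgt)
qed

section \<open>Reading a diagram off a graph\<close>

lemma graph_sides_eq:
  assumes "edges G = Side ` Y \<union> Chord ` I"
  shows "graph_sides G = sorted_list_of_set Y" "{i. Chord i \<in> edges G} = I"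
proof -
  have "{i. Side i \<in> edges G} = Y" "{i. Chord i \<in> edges G} = I" using assms by auto
  then show "graph_sides G = sorted_list_of_set Y" "{i. Chord i \<in> edges G} = I" by (simp_all add: graph_sides_def)
qed

lemma (in tree_system) image_rooted: "rooted_tree (card H) ((`) (nu Y) ` H)"
proof
  have "nu Y ` Y = {0..card H}" using nu_image_self[OF finite_Y] card_eq by auto
  then show "tree_sys {0..card H} ((`) (nu Y) ` H)" using image_tree by simp
  show "c \<subseteq> {0..card H}" if "c \<in> (`) (nu Y) ` H" for c
    using that nu_less[OF finite_Y Y_ne] card_eq by (auto simp: less_Suc_eq_le)
qed

text \<open>The common criterion for \<open>q_face\<close> and \<open>r_diag\<close>. A vertex of
  the graph is named by the value of \<open>F\<close> at the side that leaves it; \<open>u i\<close>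
  and \<open>w i\<close> are the original ends of chord \<open>i\<close>, the cut condition makes
  \<open>u i\<close> its source, and \<phi> brings the decorations into normal form.\<close>

lemma (in tree_system) graph_diagram_real:
  fixes G :: "'l::ab_group_add graph" and b :: "nat \<Rightarrow> 'l"
  assumes edges: "edges G = Side ` Y \<union> Chord ` I" and inj: "inj_on F Y"
    and src: "\<And>s. s \<in> Y \<Longrightarrow> src G (Side s) = F s"
    and tgt: "\<And>s. s \<in> Y \<Longrightarrow> tgt G (Side s) = F (ix Y (nu Y (Suc s)))"
    and src_c: "\<And>i. i \<in> I \<Longrightarrow> src G (Chord i) = F (ix Y (nu Y (u i)))"
    and tgt_c: "\<And>i. i \<in> I \<Longrightarrow> tgt G (Chord i) = F (ix Y (nu Y (w i)))"
    and bij: "bij_betw (\<lambda>i. {u i, w i}) I H"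
    and cut: "\<And>i. i \<in> I \<Longrightarrow> \<exists>s\<in>Y. \<exists>t\<in>Y. s < t \<and> dual H {u i, w i} s t \<and> u i \<in> {s<..t}"
    and gauge: "\<And>s. s \<in> Y \<Longrightarrow> gauged \<phi> G (Side s) = b s" "\<And>i. i \<in> I \<Longrightarrow> gauged \<phi> G (Chord i) = 0"
  shows "translation_rel (graph_diagram G) (real_diag Y H b)"
proof -
  let ?N = "card Y" and ?K = "(`) (nu Y) ` H" and ?D = "graph_diagram G" and ?R = "real_diag Y H b"
  define V where "V k = F (ix Y k)" for k
  define p where "p i = nu Y (u i)" for i
  define q where "q i = nu Y (w i)" for i
  interpret R: rooted_tree "card H" ?K by (rule image_rooted)
  note gs = graph_sides_eq[OF edges]
  have lt: "nu Y v < ?N" for v by (rule nu_less[OF finite_Y Y_ne])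
  have V_inj: "V k = V l \<longleftrightarrow> k = l" if "k < ?N" "l < ?N" for k l
    using inj_on_eq_iff[OF inj ix_in[OF finite_Y that(1)] ix_in[OF finite_Y that(2)]] ix_inj[OF finite_Y that]
    by (simp add: V_def)
  have vn: "vertex_number G (V k) = k" if k: "k < ?N" for k
    unfolding vertex_number_def gs(1)
  proof (rule the_equality)
    have *: "src G (Side (sorted_list_of_set Y ! j)) = V j" if "j < ?N" for j
      using src[OF ix_in[OF finite_Y that]] by (simp add: V_def ix_def)
    show "k < length (sorted_list_of_set Y) \<and> src G (Side (sorted_list_of_set Y ! k)) = V k" using k * by simp
    show "j = k" if j: "j < length (sorted_list_of_set Y) \<and> src G (Side (sorted_list_of_set Y ! j)) = V k" for j
    proof -
      have jN: "j < ?N" using j by simp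
      have "V j = V k" by (rule trans[OF *[OF jN, symmetric]]) (rule conjunct2[OF j])
      then show ?thesis by (simp only: V_inj[OF jN k])
    qed
  qed
  have vsrc: "vertex_number G (src G (Chord i)) = p i" and vtgt: "vertex_number G (tgt G (Chord i)) = q i"
    if "i \<in> I" for i
    using vn[OF lt] src_c[OF that] tgt_c[OF that] by (simp_all add: V_def p_def q_def)
  have degD: "deg ?D = card H" using bij_betw_same_card[OF bij] by (simp add: graph_diagram_def gs(2) Let_def)
  have HI: "H = (\<lambda>i. {u i, w i}) ` I" using bij by (simp add: bij_betw_def)
  have chD: "chords ?D = ?K"
  proof -
    have "chords ?D = (\<lambda>i. {p i, q i}) ` I" using vsrc vtgt by (simp add: graph_diagram_def gs(2) Let_def)
    then show ?thesis unfolding HI image_image by (simp add: p_def q_def)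
  qed
  have R: "deg ?R = card H" "chords ?R = ?K" by (simp_all add: real_diag_def)
  have pq: "\<exists>s\<in>{0..card H}. \<exists>t\<in>{0..card H}. s < t \<and> dual ?K {p i, q i} s t \<and> p i \<in> {s<..t}" if i: "i \<in> I" for i
  proof -
    obtain s t where st: "s \<in> Y" "t \<in> Y" "s < t" "dual H {u i, w i} s t" "u i \<in> {s<..t}" using cut[OF i] by blast
    have "{u i, w i} \<in> H" using i HI by blast
    then have "dual ?K {p i, q i} (nu Y s) (nu Y t)"
      using dual_image[OF order_refl _ st(1,2,4)] by (simp add: p_def q_def)
    moreover have "nu Y s < nu Y t" by (rule nu_less_mono[OF finite_Y st(1-3)])
    moreover have "p i \<in> {nu Y s<..nu Y t}"
      using nu_interval[OF finite_Y \<open>nu Y s < nu Y t\<close> lt] st ix_nu[OF finite_Y] by (simp add: p_def)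
    moreover have "nu Y s \<in> {0..card H}" "nu Y t \<in> {0..card H}"
      using lt[of s] lt[of t] card_eq by simp_all
    ultimately show ?thesis by blast
  qed
  have pqK: "{p i, q i} \<in> ?K" if "i \<in> I" for i
    using that unfolding HI image_image by (auto simp: p_def q_def)
  have par: "parent ?D (p i) = q i" "p i \<in> {1..card H}" if i: "i \<in> I" for i
  proof -
    obtain s t where st: "s \<in> {0..card H}" "t \<in> {0..card H}" "s < t" "dual ?K {p i, q i} s t" "p i \<in> {s<..t}"
      using pq[OF i] by blast
    show "parent ?D (p i) = q i" by (rule R.parent_eq[OF chD pqK[OF i] st])
    show "p i \<in> {1..card H}" using st by auto
  qed
  have inj_pq: "i = j" if ij: "i \<in> I" "j \<in> I" "{p i, q i} = {p j, q j}" for i j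
  proof -
    have "{u i, w i} \<in> H" "{u j, w j} \<in> H" using ij HI by auto
    moreover have "nu Y ` {u i, w i} = nu Y ` {u j, w j}" using ij by (simp add: p_def q_def)
    ultimately have "{u i, w i} = {u j, w j}" using inj_onD[OF inj_on_image_chords] by blast
    then show ?thesis using inj_onD[OF bij_betw_imp_inj_on[OF bij], of i j] ij by simp
  qed
  have chord_p: "chord ?D (p i) = {p i, q i}" if "i \<in> I" for i using par(1)[OF that] by (simp add: chord_def)
  \<comment> \<open>Distinct chords leave distinct vertices, so the definite description in
    \<open>graph_diagram\<close> selects the intended chord.\<close>
  have the: "\<exists>i\<in>I. p i = k \<and> (THE i. i \<in> I \<and> vertex_number G (src G (Chord i)) = k) = i" if k: "k \<in> {1..card H}" for k
  proof -
    have "chord ?D k \<in> ?K" by (rule R.chord_in[OF chD k])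
    then obtain i where i: "i \<in> I" "chord ?D k = {p i, q i}" unfolding HI image_image by (auto simp: p_def q_def)
    then have "chord ?D k = chord ?D (p i)" using chord_p by simp
    then have pk: "p i = k" using R.chord_inj[OF chD k par(2)[OF i(1)]] by simp
    have "(THE i. i \<in> I \<and> vertex_number G (src G (Chord i)) = k) = i"
    proof (rule the_equality)
      show "i \<in> I \<and> vertex_number G (src G (Chord i)) = k" using i vsrc pk by simp
      fix j assume j: "j \<in> I \<and> vertex_number G (src G (Chord j)) = k"
      then have "p j = p i" using vsrc pk by auto
      then have "{p i, q i} = {p j, q j}" using chord_p i(1) j by metis
      then show "j = i" using inj_pq i(1) j by metis
    qed
    then show ?thesis using i(1) pk by blast
  qed
  have "\<forall>e\<in>edges (diagram_graph ?D). deco ?R e = deco ?D e + V' (tgt (diagram_graph ?D) e) - V' (src (diagram_graph ?D) e)"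
    if V': "V' = (\<lambda>k. \<phi> (V k))" for V'
  proof
    fix e assume "e \<in> edges (diagram_graph ?D)"
    then consider k where "e = Side k" "k \<le> card H" | k where "e = Chord k" "k \<in> {1..card H}"
      by (auto simp: diagram_graph_def degD)
    then show "deco ?R e = deco ?D e + V' (tgt (diagram_graph ?D) e) - V' (src (diagram_graph ?D) e)"
    proof cases
      case (1 k)
      then have k: "k < ?N" using card_eq by simp
      let ?s = "ix Y k"
      have s: "?s \<in> Y" by (rule ix_in[OF finite_Y k])
      \<comment> \<open>The vertex after the side number \<open>k\<close> is where the side number
        \<open>k + 1\<close> starts, reduced modulo \<open>card Y\<close> at the last side.\<close>
      have "cnt Y (Suc ?s) = Suc k"
      proof (rule antisym)
        show "Suc k \<le> cnt Y (Suc ?s)" using less_cnt_iff[OF finite_Y k, of "Suc ?s"] by simp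
        show "cnt Y (Suc ?s) \<le> Suc k"
        proof (rule ccontr)
          assume "\<not> ?thesis"
          then have "Suc k < cnt Y (Suc ?s)" by simp
          moreover have "Suc k < ?N" using calculation cnt_le[OF finite_Y, of "Suc ?s"] by simp
          ultimately show False using less_cnt_iff[OF finite_Y, of "Suc k" "Suc ?s"] ix_less[OF finite_Y, of k "Suc k"] by simp
        qed
      qed
      then have "nu Y (Suc ?s) = Suc k mod ?N" by (simp add: nu_def)
      then have "tgt G (Side ?s) = V (Suc k mod Suc (card H))" using tgt[OF s] card_eq by (simp add: V_def)
      moreover have "src G (Side ?s) = V k" using src[OF s] by (simp add: V_def)
      ultimately show ?thesis using gauge(1)[OF s] 1 k
        by (simp add: real_diag_def diagram_graph_def graph_diagram_def gs Let_def degD[unfolded graph_diagram_def gs Let_def, simplified] gauged_def V' ix_def)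
    next
      case (2 k)
      obtain i where i: "i \<in> I" "p i = k" "(THE i. i \<in> I \<and> vertex_number G (src G (Chord i)) = k) = i" using the[OF 2(2)] by blast
      have "deco ?D e = dec G (Chord i)" using 2 i(3) by (simp add: graph_diagram_def gs Let_def)
      moreover have "tgt (diagram_graph ?D) e = q i" "src (diagram_graph ?D) e = p i"
        using 2 i par(1)[OF i(1)] by (simp_all add: diagram_graph_def)
      moreover have "deco ?R e = 0" using 2 by (simp add: real_diag_def)
      ultimately show ?thesis using gauge(2)[OF i(1)] src_c[OF i(1)] tgt_c[OF i(1)]
        by (simp add: gauged_def V' V_def p_def q_def)
    qed
  qed
  then have "\<exists>\<phi>. \<forall>e\<in>edges (diagram_graph ?D). deco ?R e = deco ?D e + \<phi> (tgt (diagram_graph ?D) e) - \<phi> (src (diagram_graph ?D) e)"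
    by blast
  then show ?thesis
    unfolding translation_rel_def
    using R.dissection_diagram_tree[OF degD chD] R.dissection_diagram_tree[OF R] degD chD R by simp
qed

section \<open>Normal forms of decorations up to translation\<close>

lemma nu_interval_self: "k \<le> n \<Longrightarrow> nu {0..n} k = k"
proof -
  assume k: "k \<le> n"
  have "{s \<in> {0..n}. s < k} = {..<k}" using k by auto
  then show ?thesis using k by (simp add: nu_def cnt_def)
qed

lemma ix_interval: "k \<le> n \<Longrightarrow> ix {0..n} k = k"
  using ix_nu[of "{0..n}" k] by (simp add: nu_interval_self)

lemma (in rooted_tree) real_diag_std:
  "deg (real_diag {0..n} K b) = n" "chords (real_diag {0..n} K b) = K"
  "s \<le> n \<Longrightarrow> deco (real_diag {0..n} K b) (Side s) = b s" "deco (real_diag {0..n} K b) (Chord i) = 0"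
proof -
  have "nu {0..n} ` c = c" if "c \<in> K" for c
  proof -
    have "nu {0..n} ` c = (\<lambda>x. x) ` c"
      by (rule image_cong[OF refl]) (use chord_le[OF that] nu_interval_self in auto)
    then show ?thesis by simp
  qed
  then show "chords (real_diag {0..n} K b) = K" by (simp add: real_diag_def)
qed (simp_all add: real_diag_def card_K ix_interval)

lemma translation_real:
  assumes D: "dissection_diagram D"
  shows "translation_rel D (real_diag {0..deg D} (chords D) b) \<longleftrightarrow>
    (\<exists>\<phi>. (\<forall>s\<le>deg D. gauged \<phi> (diagram_graph D) (Side s) = b s) \<and> (\<forall>i\<in>{1..deg D}. gauged \<phi> (diagram_graph D) (Chord i) = 0))"
proof -
  interpret rooted_tree "deg D" "chords D" by (rule dissection_rooted_tree[OF D])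
  note R = real_diag_std[where b = b]
  have *: "(\<forall>e\<in>edges (diagram_graph D). deco (real_diag {0..deg D} (chords D) b) e =
      deco D e + \<phi> (tgt (diagram_graph D) e) - \<phi> (src (diagram_graph D) e)) \<longleftrightarrow>
    (\<forall>s\<le>deg D. gauged \<phi> (diagram_graph D) (Side s) = b s) \<and> (\<forall>i\<in>{1..deg D}. gauged \<phi> (diagram_graph D) (Chord i) = 0)" for \<phi>
  proof -
    have ed: "edges (diagram_graph D) = Side ` {0..deg D} \<union> Chord ` {1..deg D}" "dec (diagram_graph D) = deco D"
      by (simp_all add: diagram_graph_def)
    show ?thesis
      unfolding ed(1) ball_Un ball_simps gauged_def ed(2)
      using R(3,4) by (metis atLeastAtMost_iff le0)
  qed
  show ?thesis
    unfolding translation_rel_def * using D dissection_diagram_tree[OF R(1,2)] R(1,2) by simp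
qed

text \<open>The potential of \<open>v\<close> is the sum of the decorations of the chords on the path from \<open>v\<close> to the
  root, which are the chords whose cut contains \<open>v\<close>.\<close>

lemma gauge_exists:
  assumes D: "dissection_diagram D"
  obtains b where "translation_rel D (real_diag {0..deg D} (chords D) b)"
proof -
  interpret rooted_tree "deg D" "chords D" by (rule dissection_rooted_tree[OF D])
  have "\<forall>i\<in>{1..deg D}. \<exists>s t. s < t \<and> dual (chords D) (chord D i) s t \<and> i \<in> {s<..t} \<and> parent D i \<notin> {s<..t}"
    using parent_cut[OF refl] by metis
  then obtain S T where ST: "\<And>i. i \<in> {1..deg D} \<Longrightarrow>
      S i < T i \<and> dual (chords D) (chord D i) (S i) (T i) \<and> i \<in> {S i<..T i} \<and> parent D i \<notin> {S i<..T i}" by metis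
  define \<phi> where "\<phi> v = (\<Sum>i\<in>{1..deg D}. if v \<in> {S i<..T i} then deco D (Chord i) else 0)" for v
  have "gauged \<phi> (diagram_graph D) (Chord i) = 0" if i: "i \<in> {1..deg D}" for i
  proof -
    \<comment> \<open>Chord \<open>i\<close> crosses no cut but its own, so the potentials at its
      ends differ by a single summand.\<close>
    have ij: "i \<in> {S j<..T j} \<longleftrightarrow> parent D i \<in> {S j<..T j}" if j: "j \<in> {1..deg D} - {i}" for j
    proof -
      have c: "{i, parent D i} \<in> chords D" using chord_in[OF refl i] by (simp add: chord_def)
      have ne: "{i, parent D i} \<noteq> chord D j" using chord_inj[OF refl i, of j] j by (auto simp: chord_def)
      have "S j < T j" "dual (chords D) (chord D j) (S j) (T j)" using ST[of j] j by simp_all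
      from cut_iff[OF c this] show ?thesis using ne by simp
    qed
    have "\<phi> i = deco D (Chord i) + (\<Sum>j\<in>{1..deg D} - {i}. if i \<in> {S j<..T j} then deco D (Chord j) else 0)"
      unfolding \<phi>_def using i ST[OF i] by (subst sum.remove[of _ i]) auto
    moreover have "\<phi> (parent D i) = (\<Sum>j\<in>{1..deg D} - {i}. if parent D i \<in> {S j<..T j} then deco D (Chord j) else 0)"
      unfolding \<phi>_def using i ST[OF i] by (subst sum.remove[of _ i]) auto
    moreover have "(\<Sum>j\<in>{1..deg D} - {i}. if i \<in> {S j<..T j} then deco D (Chord j) else 0) =
        (\<Sum>j\<in>{1..deg D} - {i}. if parent D i \<in> {S j<..T j} then deco D (Chord j) else 0)"
      by (rule sum.cong[OF refl]) (simp only: ij)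
    ultimately show ?thesis by (simp add: gauged_def diagram_graph_def)
  qed
  then show ?thesis
    using that[of "\<lambda>s. gauged \<phi> (diagram_graph D) (Side s)"] translation_real[OF D] by blast
qed

subsection \<open>The vertices of a face\<close>

lemma half_polygon_pair:
  assumes "p < q"
  shows "half_polygon n {p, q} s = (if p \<le> s \<and> s < q then {p..q} else {0..p} \<union> {q..n})"
  using assms by (simp add: half_polygon_def arc_pair)

locale tree_face = rooted_tree n K for n K +
  fixes C :: "nat set set" and \<alpha> :: "nat set"
  assumes CK: "C \<subseteq> K" and \<alpha>: "\<alpha> \<in> sfaces {0..n} C"
begin

definition V :: "nat set" where
  "V = {v \<in> {0..n}. \<forall>c\<in>C. \<forall>s\<in>\<alpha>. v \<in> half_polygon n c s}"

lemma chord_less: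
  assumes "c \<in> K"
  obtains p q where "p < q" "q \<le> n" "c = {p, q}"
proof -
  obtain a b where ab: "a \<noteq> b" "c = {a, b}" using chordE[OF assms] .
  have le: "a \<le> n" "b \<le> n" using chord_le[OF assms] ab by auto
  show ?thesis
  proof (cases "a < b")
    case True
    then show ?thesis using that ab le by blast
  next
    case False
    then have "b < a" "c = {b, a}" using ab by auto
    then show ?thesis using that le by blast
  qed
qed

lemma nc:
  assumes "{p, q} \<in> K" "{p', q'} \<in> K" "p < q" "p' < q'"
  shows "\<not> (p < p' \<and> p' < q \<and> q < q')"
proof -
  have "\<not> crossing {p, q} {p', q'}" using noncrossing assms(1,2) by (auto simp: noncrossing_def)
  then show ?thesis using assms(3,4) by (simp add: crossing_def)
qed

lemma fin_\<alpha>: "finite \<alpha>" and \<alpha>_ne: "\<alpha> \<noteq> {}" and \<alpha>_le: "s \<in> \<alpha> \<Longrightarrow> s \<le> n"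
  using sfacesD[OF \<alpha>] by auto

lemma not_sep:
  assumes "{p, q} \<in> C" "p < q" "s \<in> \<alpha>" "t \<in> \<alpha>"
  shows "(p \<le> s \<and> s < q) \<longleftrightarrow> (p \<le> t \<and> t < q)"
  using not_sep_face[OF \<alpha> assms(3,4,1)] assms(2) by (simp add: sep_def arc_pair)

lemma V_half:
  assumes "v \<in> V" "{p, q} \<in> C" "p < q" "s \<in> \<alpha>"
  shows "if p \<le> s \<and> s < q then p \<le> v \<and> v \<le> q else v \<le> p \<or> q \<le> v"
proof -
  have "v \<in> half_polygon n {p, q} s" using assms by (simp add: V_def)
  then show ?thesis unfolding half_polygon_pair[OF assms(3)] by (auto split: if_splits)
qed

lemma V_I:
  assumes "v \<le> n" "\<And>p q s. {p, q} \<in> C \<Longrightarrow> p < q \<Longrightarrow> s \<in> \<alpha> \<Longrightarrow>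
    (if p \<le> s \<and> s < q then p \<le> v \<and> v \<le> q else v \<le> p \<or> q \<le> v)"
  shows "v \<in> V"
  unfolding V_def
proof (intro CollectI conjI ballI)
  fix c s assume c: "c \<in> C" and s: "s \<in> \<alpha>"
  obtain p q where pq: "p < q" "q \<le> n" "c = {p, q}" using chord_less CK c by blast
  have cC: "{p, q} \<in> C" using c pq by simp
  show "v \<in> half_polygon n c s"
    unfolding pq(3) half_polygon_pair[OF pq(1)] using assms(2)[OF cC pq(1) s] assms(1) by (auto split: if_splits)
qed (use assms in simp)

text \<open>Some chord of \<open>C\<close> separates side \<open>v\<close> from the face, and it
  must end at \<open>v\<close> because \<open>v\<close> is a vertex of the face. Going forward from
  \<open>v\<close>, the chord of case \<open>right\<close> skips the sides up to \<open>q\<close>,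
  that of case \<open>left\<close> the sides past the root up to \<open>p\<close>, and no side of
  the face is skipped. The longest skip is chosen, with \<open>left\<close> taking precedence, so
  that its far end is again a vertex of the face.\<close>

lemma V_step:
  assumes v: "v \<in> V" "v \<notin> \<alpha>"
  obtains (right) q where "{v, q} \<in> C" "v < q" "q \<in> V" "\<And>s. s \<in> \<alpha> \<Longrightarrow> \<not> (v \<le> s \<and> s < q)"
  | (left) p where "{p, v} \<in> C" "p < v" "p \<in> V" "\<And>s. s \<in> \<alpha> \<Longrightarrow> p \<le> s \<and> s < v"
proof -
  define R where "R q \<longleftrightarrow> {v, q} \<in> C \<and> v < q \<and> (\<forall>s\<in>\<alpha>. \<not> (v \<le> s \<and> s < q))" for q
  define L where "L p \<longleftrightarrow> {p, v} \<in> C \<and> p < v \<and> (\<forall>s\<in>\<alpha>. p \<le> s \<and> s < v)" for p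
  have vn: "v \<le> n" using v(1) by (simp add: V_def)
  obtain a where a: "a \<in> \<alpha>" using \<alpha>_ne by blast
  have "v \<notin> face_at {0..n} C a" using sfaces_eq[OF \<alpha> a] v(2) by simp
  then obtain c where c: "c \<in> C" "sep c a v" using vn by (auto simp: face_at_def)
  obtain p q where pq: "p < q" "q \<le> n" "c = {p, q}" using chord_less CK c(1) by blast
  have cC: "{p, q} \<in> C" using c pq by simp
  have ex: "R q \<or> L p"
  proof (cases "p \<le> a \<and> a < q")
    case True
    then have "v = q" using V_half[OF v(1) cC pq(1) a] c(2) pq by (auto simp: sep_def arc_pair)
    then have "L p" using not_sep[OF cC pq(1) a] True cC pq(1) by (simp add: L_def)
    then show ?thesis ..
  next
    case False
    then have "p \<le> v" "v < q" using c(2) pq by (auto simp: sep_def arc_pair)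
    then have "v = p" using V_half[OF v(1) cC pq(1) a] False by auto
    then have "R q" using not_sep[OF cC pq(1) a] False cC pq(1) by (simp add: R_def)
    then show ?thesis ..
  qed
  show ?thesis
  proof (cases "\<exists>p. L p")
    case True
    then obtain p0 where "L p0" ..
    moreover have "\<forall>p. L p \<longrightarrow> p \<le> v" by (simp add: L_def)
    ultimately obtain p where p: "L p" and p_max: "\<forall>p'. L p' \<longrightarrow> p' \<le> p"
      using Nat.ex_has_greatest_nat[of L p0 v] by auto
    have pC: "{p, v} \<in> C" "p < v" and p\<alpha>: "\<And>s. s \<in> \<alpha> \<Longrightarrow> p \<le> s \<and> s < v" using p by (simp_all add: L_def)
    have "p \<in> V"
    proof (rule V_I)
      show "p \<le> n" using pC(2) vn by simp
      fix p' q' s assume d: "{p', q'} \<in> C" "p' < q'" and s: "s \<in> \<alpha>"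
      have n1: "\<not> (p' < p \<and> p < q' \<and> q' < v)" and n2: "\<not> (p < p' \<and> p' < v \<and> v < q')"
        using nc[of p' q' p v] nc[of p v p' q'] d pC CK by blast+
      note vh = V_half[OF v(1) d s] and ps = p\<alpha>[OF s]
      show "if p' \<le> s \<and> s < q' then p' \<le> p \<and> p \<le> q' else p \<le> p' \<or> q' \<le> p"
      proof (cases "p' \<le> s \<and> s < q'")
        case True
        have "p' \<le> p"
        proof (rule ccontr)
          assume lt: "\<not> p' \<le> p"
          have "q' = v" using n2 lt vh True ps by auto
          moreover have "\<forall>t\<in>\<alpha>. p' \<le> t \<and> t < q'" using not_sep[OF d s] True by blast
          ultimately have "L p'" using d by (simp add: L_def)
          then show False using p_max lt by blast
        qed
        then show ?thesis using True ps by simp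
      next
        case False
        then show ?thesis using n1 ps by auto
      qed
    qed
    then show ?thesis using left pC p\<alpha> by blast
  next
    case noL: False
    then have "R q" using ex by blast
    moreover have Rn: "\<forall>q. R q \<longrightarrow> q \<le> n" unfolding R_def using chord_le CK by fastforce
    ultimately obtain q where q: "R q" and q_max: "\<forall>q'. R q' \<longrightarrow> q' \<le> q"
      using Nat.ex_has_greatest_nat[of R q n] by auto
    have qC: "{v, q} \<in> C" "v < q" and q\<alpha>: "\<And>s. s \<in> \<alpha> \<Longrightarrow> \<not> (v \<le> s \<and> s < q)" using q by (simp_all add: R_def)
    have "q \<in> V"
    proof (rule V_I)
      show "q \<le> n" using Rn q by blast
      fix p' q' s assume d: "{p', q'} \<in> C" "p' < q'" and s: "s \<in> \<alpha>"
      have n1: "\<not> (v < p' \<and> p' < q \<and> q < q')" and n2: "\<not> (p' < v \<and> v < q' \<and> q' < q)"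
        using nc[of v q p' q'] nc[of p' q' v q] d qC CK by blast+
      note vh = V_half[OF v(1) d s] and qs = q\<alpha>[OF s]
      have all: "(p' \<le> s \<and> s < q') \<longleftrightarrow> (p' \<le> t \<and> t < q')" if "t \<in> \<alpha>" for t by (rule not_sep[OF d s that])
      show "if p' \<le> s \<and> s < q' then p' \<le> q \<and> q \<le> q' else q \<le> p' \<or> q' \<le> q"
      proof (cases "p' \<le> s \<and> s < q'")
        case True
        have "q \<le> q'"
        proof (rule ccontr)
          assume lt: "\<not> q \<le> q'"
          have "q' \<noteq> v"
          proof
            assume "q' = v"
            then have "L p'" using d all True by (simp add: L_def)
            then show False using noL by blast
          qed
          then have "p' = v" using n2 lt vh True by auto
          then show False using qs True lt by auto
        qed
        then show ?thesis using True vh qC(2) by auto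
      next
        case False
        show ?thesis
        proof (rule ccontr)
          assume "\<not> ?thesis"
          then have lt: "p' < q" "q < q'" using False by auto
          then have "v = p'" using n1 vh False qC(2) by auto
          then have "R q'" using d all False by (simp add: R_def)
          then show False using q_max lt by auto
        qed
      qed
    qed
    then show ?thesis using right qC q\<alpha> by blast
  qed
qed

text \<open>A vertex of a face is joined by chords in \<open>C\<close> to the start of the next side of the face: follow
  the longest chord that does not jump over a side of the face.\<close>

lemma V_next:
  assumes F: "\<And>x y. {x, y} \<in> C \<Longrightarrow> F x = F y" and v: "v \<in> V"
  shows "F v = F (ix \<alpha> (nu \<alpha> v))"
proof -
  \<comment> \<open>The number of sides from \<open>v\<close> forward to the next side of the face,
    passing the root if necessary.\<close>
  define \<mu> where "\<mu> v = (let s = ix \<alpha> (nu \<alpha> v) in if v \<le> s then s - v else s + n + 1 - v)" for v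
  show ?thesis
    using v
  proof (induction "\<mu> v" arbitrary: v rule: less_induct)
    case less
    have vn: "v \<le> n" using less.prems by (simp add: V_def)
    let ?s = "ix \<alpha> (nu \<alpha> v)"
    have s: "?s \<in> \<alpha>" by (rule ix_in[OF fin_\<alpha> nu_less[OF fin_\<alpha> \<alpha>_ne]])
    show ?case
    proof (cases "v \<in> \<alpha>")
      case True
      then show ?thesis using ix_nu[OF fin_\<alpha>] by simp
    next
      case False
      from less.prems False show ?thesis
      proof (cases rule: V_step)
        case (right q)
        have "{s \<in> \<alpha>. s < q} = {s \<in> \<alpha>. s < v}" using right(2,4) by fastforce
        then have nu: "nu \<alpha> q = nu \<alpha> v" by (simp add: nu_def cnt_def)
        have "q \<le> n" using right(3) by (simp add: V_def)
        then have "\<mu> q < \<mu> v" using right(2) right(4)[OF s] by (auto simp: \<mu>_def nu Let_def)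
        then have "F q = F (ix \<alpha> (nu \<alpha> q))" by (rule less.hyps[OF _ right(3)])
        then show ?thesis using F[OF right(1)] nu by simp
      next
        case (left p)
        have e: "{s \<in> \<alpha>. s < v} = \<alpha>" "{s \<in> \<alpha>. s < p} = {}" using left(4) by fastforce+
        have nu: "nu \<alpha> p = nu \<alpha> v" unfolding nu_def cnt_def e by simp
        then have "\<mu> p < \<mu> v" using left(2) left(4)[OF s] vn by (auto simp: \<mu>_def nu Let_def)
        then have "F p = F (ix \<alpha> (nu \<alpha> p))" by (rule less.hyps[OF _ left(3)])
        then show ?thesis using F[OF left(1)] nu by simp
      qed
    qed
  qed
qed

lemma V_side:
  assumes s: "s \<in> \<alpha>"
  shows "s \<in> V" "Suc s mod Suc n \<in> V"
proof -
  have sn: "s \<le> n" by (rule \<alpha>_le[OF s])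
  show "s \<in> V"
  proof (rule V_I[OF sn])
    fix p q t assume d: "{p, q} \<in> C" "p < q" and t: "t \<in> \<alpha>"
    show "if p \<le> t \<and> t < q then p \<le> s \<and> s \<le> q else s \<le> p \<or> q \<le> s" using not_sep[OF d s t] by auto
  qed
  show "Suc s mod Suc n \<in> V"
  proof (rule V_I)
    fix p q t assume d: "{p, q} \<in> C" "p < q" and t: "t \<in> \<alpha>"
    have "q \<le> n" using chord_le d(1) CK by fastforce
    then show "if p \<le> t \<and> t < q then p \<le> Suc s mod Suc n \<and> Suc s mod Suc n \<le> q else Suc s mod Suc n \<le> p \<or> q \<le> Suc s mod Suc n"
      using not_sep[OF d s t] sn d(2) by (cases "s = n") auto
  qed (simp add: less_Suc_eq_le[symmetric])
qed

text \<open>If both ends of \<open>c\<close> lie in the polygon of the face, a chord of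
  \<open>C\<close> cannot cut off the dual edge of \<open>c\<close>: with both ends of
  \<open>c\<close> on the other side, \<open>c\<close> would not separate two sides beyond that
  chord. Conversely, \<open>c\<close> separates two sides lying in the same half of each chord of
  \<open>C\<close>, and not crossing that chord it has its ends in this half.\<close>

lemma inner_iff:
  assumes c: "c \<in> K" "c \<notin> C"
  shows "c \<subseteq> V \<longleftrightarrow> (\<exists>s\<in>\<alpha>. \<exists>t\<in>\<alpha>. sep c s t)"
proof -
  obtain x y where xy: "x < y" "y \<le> n" "c = {x, y}" using chord_less[OF c(1)] .
  have cK: "{x, y} \<in> K" using c xy by simp
  have sepc: "sep c s t \<longleftrightarrow> (x \<le> s \<and> s < y) \<noteq> (x \<le> t \<and> t < y)" for s t
    using xy by (simp add: sep_def arc_pair)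
  show ?thesis
  proof
    assume cV: "c \<subseteq> V"
    then have xV: "x \<in> V" "y \<in> V" using xy by auto
    obtain s t where st: "s \<in> {0..n}" "t \<in> {0..n}" "s < t" "dual K c s t" using dualE[OF c(1)] .
    have sc: "sep c s t" using st(4) c(1) by (simp add: dual_def)
    obtain a where a: "a \<in> \<alpha>" using \<alpha>_ne by blast
    have d: False if d: "d \<in> C" "sep d a s" for d
    proof -
      have nst: "\<not> sep d s t" using dualD[OF st(4), of d] d(1) CK c(2) by blast
      obtain p q where pq: "p < q" "q \<le> n" "d = {p, q}" using chord_less CK d(1) by blast
      have dC: "{p, q} \<in> C" using d pq by simp
      have sepd: "sep d u v \<longleftrightarrow> (p \<le> u \<and> u < q) \<noteq> (p \<le> v \<and> v < q)" for u v
        using pq by (simp add: sep_def arc_pair)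
      show False
        using V_half[OF xV(1) dC pq(1) a] V_half[OF xV(2) dC pq(1) a] nst d(2) sc xy(1) unfolding sepd sepc
        by (cases "p \<le> a \<and> a < q") auto
    qed
    have "\<alpha> = face_at {0..n} C a" by (rule sfaces_eq[OF \<alpha> a])
    then have s\<alpha>: "s \<in> \<alpha>" using d st(1) by (auto simp: face_at_def)
    have "\<not> sep e s t" if "e \<in> C" for e using dualD[OF st(4), of e] that CK c(2) by blast
    then have "t \<in> face_at {0..n} C s" using st(2) by (simp add: face_at_def)
    then have "t \<in> \<alpha>" using sfaces_eq[OF \<alpha> s\<alpha>] by simp
    then show "\<exists>s\<in>\<alpha>. \<exists>t\<in>\<alpha>. sep c s t" using s\<alpha> sc by blast
  next
    assume "\<exists>s\<in>\<alpha>. \<exists>t\<in>\<alpha>. sep c s t"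
    then obtain s t where st: "s \<in> \<alpha>" "t \<in> \<alpha>" "sep c s t" by blast
    have *: "(if p \<le> u \<and> u < q then p \<le> x \<and> x \<le> q else x \<le> p \<or> q \<le> x) \<and>
        (if p \<le> u \<and> u < q then p \<le> y \<and> y \<le> q else y \<le> p \<or> q \<le> y)"
      if d: "{p, q} \<in> C" "p < q" and u: "u \<in> \<alpha>" for p q u
    proof -
      have "{p, q} \<in> K" using d CK by blast
      then have n: "\<not> (p < x \<and> x < q \<and> q < y)" "\<not> (x < p \<and> p < y \<and> y < q)"
        using nc[of p q x y] nc[of x y p q] cK d(2) xy(1) by blast+
      have st': "(x \<le> s \<and> s < y) \<noteq> (x \<le> t \<and> t < y)" using st(3) by (simp only: sepc not_False_eq_True)
      show ?thesis
      proof (cases "p \<le> u \<and> u < q")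
        case True
        then have "p \<le> s" "s < q" "p \<le> t" "t < q" using not_sep[OF d u st(1)] not_sep[OF d u st(2)] by auto
        then have "p \<le> x \<and> x \<le> q \<and> p \<le> y \<and> y \<le> q" using st' n xy(1) by linarith
        then show ?thesis using True by simp
      next
        case False
        then have "\<not> (p \<le> s \<and> s < q)" "\<not> (p \<le> t \<and> t < q)" using not_sep[OF d u st(1)] not_sep[OF d u st(2)] by auto
        then show ?thesis unfolding if_not_P[OF False] using st' n xy(1) d(2) by linarith
      qed
    qed
    have "x \<in> V" by (rule V_I) (use xy * in auto)
    moreover have "y \<in> V" by (rule V_I) (use xy * in auto)
    ultimately show "c \<subseteq> V" using xy by simp
  qed
qed

end

subsection \<open>The operations on diagrams\<close>

lemma faces_eq: "faces D C = sfaces {0..deg D} (chord D ` C)"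
proof -
  define r where "r = {(s, t). s \<in> {0..deg D} \<and> t \<in> {0..deg D} \<and>
    (\<forall>i\<in>C. s \<in> arc (chord D i) \<longleftrightarrow> t \<in> arc (chord D i))}"
  have "r `` {s} = face_at {0..deg D} (chord D ` C) s" if "s \<in> {0..deg D}" for s
    using that by (auto simp: r_def face_at_def sep_def)
  then have "{0..deg D} // r = face_at {0..deg D} (chord D ` C) ` {0..deg D}"
    unfolding quotient_def by blast
  then show ?thesis by (simp add: faces_def sfaces_def r_def)
qed

lemma contraction_map:
  fixes G :: "'l::ab_group_add graph"
  obtains F where "src (fold contract es G) = (\<lambda>e. F (src G e))" "tgt (fold contract es G) = (\<lambda>e. F (tgt G e))"
    "\<forall>e\<in>set es. F (src G e) = F (tgt G e)"
    "\<forall>h :: nat \<Rightarrow> nat. (\<forall>e\<in>set es. h (src G e) = h (tgt G e)) \<longrightarrow> (\<forall>v. h (F v) = h v)"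
    "edges (fold contract es G) = edges G - set es"
    "\<forall>\<phi>. (\<forall>e\<in>set es. gauged \<phi> G e = 0) \<longrightarrow> gauged \<phi> (fold contract es G) = gauged \<phi> G"
proof -
  have *: "src G = (\<lambda>e. (\<lambda>v. v) (src G e))" "tgt G = (\<lambda>e. (\<lambda>v. v) (tgt G e))" by simp_all
  show ?thesis
    using fold_contract[OF *, of es]
    apply (elim exE conjE)
    subgoal premises p for F
      by (rule that[OF p(1-3) _ p(6,7)]) (use p(5) in simp)
    done
qed

lemma diagram_graph_simps:
  "src (diagram_graph D) (Side s) = s" "src (diagram_graph D) (Chord i) = i"
  "tgt (diagram_graph D) (Side s) = Suc s mod Suc (deg D)" "tgt (diagram_graph D) (Chord i) = parent D i"
  "edges (diagram_graph D) = Side ` {0..deg D} \<union> Chord ` {1..deg D}"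
  by (simp_all add: diagram_graph_def)

lemma keep_edges_simps:
  "src (keep_edges E G) = src G" "tgt (keep_edges E G) = tgt G" "edges (keep_edges E G) = edges G \<inter> E"
  "gauged \<phi> (keep_edges E G) = gauged \<phi> G"
  by (simp_all add: keep_edges_def gauged_def fun_eq_iff)

lemma nu_wrap:
  assumes "Y \<subseteq> {0..n}" "s \<le> n"
  shows "nu Y (Suc s mod Suc n) = nu Y (Suc s)"
proof (cases "s = n")
  case True
  have "{s \<in> Y. s < Suc n} = Y" using assms by auto
  then show ?thesis using True by (simp add: nu_def cnt_def)
qed (use assms in simp)

lemma nu_Suc: "s \<notin> Y \<Longrightarrow> nu Y (Suc s) = nu Y s"
proof -
  assume "s \<notin> Y"
  then have "{x \<in> Y. x < Suc s} = {x \<in> Y. x < s}" using less_Suc_eq by auto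
  then show "nu Y (Suc s) = nu Y s" by (simp add: nu_def cnt_def)
qed

section \<open>The diagrams \<open>q_face\<close> and \<open>r_diag\<close> in normal form\<close>

locale diagram_chords = rooted_tree "deg D" "chords D" for D :: "'l::ab_group_add diagram" +
  fixes C :: "nat set" and \<phi> :: "nat \<Rightarrow> 'l" and b :: "nat \<Rightarrow> 'l"
  assumes C: "C \<subseteq> {1..deg D}"
    and side: "s \<le> deg D \<Longrightarrow> gauged \<phi> (diagram_graph D) (Side s) = b s"
    and chord0: "i \<in> {1..deg D} \<Longrightarrow> gauged \<phi> (diagram_graph D) (Chord i) = 0"
begin

abbreviation n where "n \<equiv> deg D"
abbreviation K where "K \<equiv> chords D"
abbreviation CC where "CC \<equiv> chord D ` C"
abbreviation M where "M \<equiv> mins {0..n} CC"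

lemma finite_C: "finite C"
  using C finite_subset by blast

lemma CC: "CC \<subseteq> K"
  using chord_in[OF refl] C by blast

lemma bij_C: "bij_betw (chord D) C CC"
  using chord_inj[OF refl] C by (intro bij_betw_imageI inj_onI) blast+

lemma chord_notin: "i \<in> {1..n} \<Longrightarrow> i \<notin> C \<Longrightarrow> chord D i \<notin> CC"
  using chord_inj[OF refl] C by blast

lemma q_face_real:
  assumes \<alpha>: "\<alpha> \<in> faces D C"
  shows "translation_rel (q_face D C \<alpha>) (real_diag \<alpha> (sinner K CC \<alpha>) b)"
proof -
  have \<alpha>': "\<alpha> \<in> sfaces {0..n} CC" using \<alpha> by (simp add: faces_eq)
  interpret T: tree_face n K CC \<alpha> by unfold_locales (fact CC \<alpha>')+
  interpret R: tree_system \<alpha> "sinner K CC \<alpha>" using restrict_tree[OF CC \<alpha>'] by unfold_locales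
  let ?G0 = "diagram_graph D" and ?es = "map Chord (sorted_list_of_set C)" and ?I = "inner_chords D C \<alpha>"
  have V: "face_vertices D C \<alpha> = T.V" by (simp add: face_vertices_def T.V_def)
  obtain F where F: "src (fold contract ?es ?G0) = (\<lambda>e. F (src ?G0 e))" "tgt (fold contract ?es ?G0) = (\<lambda>e. F (tgt ?G0 e))"
    and Fe: "\<forall>e\<in>set ?es. F (src ?G0 e) = F (tgt ?G0 e)"
    and h: "\<forall>h :: nat \<Rightarrow> nat. (\<forall>e\<in>set ?es. h (src ?G0 e) = h (tgt ?G0 e)) \<longrightarrow> (\<forall>v. h (F v) = h v)"
    and ed: "edges (fold contract ?es ?G0) = edges ?G0 - set ?es"
    and ga: "\<forall>\<phi>. (\<forall>e\<in>set ?es. gauged \<phi> ?G0 e = 0) \<longrightarrow> gauged \<phi> (fold contract ?es ?G0) = gauged \<phi> ?G0"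
    by (rule contraction_map)
  have es: "set ?es = Chord ` C" using finite_C by simp
  have ga': "gauged \<phi> (fold contract ?es ?G0) = gauged \<phi> ?G0"
    by (rule ga[rule_format]) (use es chord0 C in auto)
  have Fc: "F x = F y" if "{x, y} \<in> CC" for x y
  proof -
    obtain i where i: "i \<in> C" "{x, y} = {i, parent D i}" using \<open>{x, y} \<in> CC\<close> by (auto simp: chord_def)
    have "F i = F (parent D i)" using Fe[rule_format, of "Chord i"] es i(1) by (simp add: diagram_graph_simps)
    then show ?thesis using i(2) by (auto simp: doubleton_eq_iff)
  qed
  have Vn: "F v = F (ix \<alpha> (nu \<alpha> v))" if "v \<in> T.V" for v by (rule T.V_next[OF Fc that])
  have I: "?I \<subseteq> {1..n} - C" by (auto simp: inner_chords_def)
  have I_iff: "i \<in> ?I \<longleftrightarrow> chord D i \<in> sinner K CC \<alpha>" if i: "i \<in> {1..n} - C" for i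
    using T.inner_iff[OF chord_in[OF refl, of i] chord_notin] i chord_in[OF refl, of i] chord_notin[of i]
    by (simp add: inner_chords_def V sinner_def)
  show ?thesis
    unfolding q_face_def
  proof (rule R.graph_diagram_real[where I = ?I and F = F and u = "\<lambda>i. i" and w = "parent D" and \<phi> = \<phi>], unfold keep_edges_simps F)
    show "edges (fold contract ?es ?G0) \<inter> (Side ` \<alpha> \<union> Chord ` ?I) = Side ` \<alpha> \<union> Chord ` ?I"
      unfolding ed es diagram_graph_simps using I sfacesD(1)[OF \<alpha>'] by auto
    show "inj_on F \<alpha>"
    proof (rule linorder_inj_onI)
      fix s t assume st: "s < t" "s \<in> \<alpha>" "t \<in> \<alpha>"
      \<comment> \<open>No chord of \<open>C\<close> separates two sides of a face, so none crosses
        the cut between them; the indicator function of the cut survives the contraction and keeps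
        their images distinct.\<close>
      define hh :: "nat \<Rightarrow> nat" where "hh x = (if x \<in> {s<..t} then 1 else 0)" for x
      have "hh (src ?G0 e) = hh (tgt ?G0 e)" if e: "e \<in> set ?es" for e
      proof -
        obtain i where i: "i \<in> C" "e = Chord i" using e unfolding es by blast
        have "\<not> sep {i, parent D i} s t" using not_sep_face[OF \<alpha>' st(2,3)] i by (simp add: chord_def)
        then show ?thesis using sep_cut[OF st(1), of i "parent D i"] i by (simp add: hh_def diagram_graph_simps)
      qed
      then have "hh (F s) = hh s" "hh (F t) = hh t" using h by blast+
      moreover have "hh s \<noteq> hh t" using st(1) by (simp add: hh_def)
      ultimately show "F s \<noteq> F t" by metis
    qed auto
    show "F (src ?G0 (Side s)) = F s" for s by (simp add: diagram_graph_simps)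
    show "F (tgt ?G0 (Side s)) = F (ix \<alpha> (nu \<alpha> (Suc s)))" if "s \<in> \<alpha>" for s
      using Vn[OF T.V_side(2)[OF that]] nu_wrap[OF sfacesD(1)[OF \<alpha>'] T.\<alpha>_le[OF that]] by (simp add: diagram_graph_simps)
    have iV: "i \<in> T.V" "parent D i \<in> T.V" if "i \<in> ?I" for i
      using that by (simp_all add: inner_chords_def V chord_def)
    show "F (src ?G0 (Chord i)) = F (ix \<alpha> (nu \<alpha> i))" if "i \<in> ?I" for i
      using Vn[OF iV(1)[OF that]] by (simp add: diagram_graph_simps)
    show "F (tgt ?G0 (Chord i)) = F (ix \<alpha> (nu \<alpha> (parent D i)))" if "i \<in> ?I" for i
      using Vn[OF iV(2)[OF that]] by (simp add: diagram_graph_simps)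
    show "bij_betw (\<lambda>i. {i, parent D i}) ?I (sinner K CC \<alpha>)"
      unfolding chord_def[symmetric]
    proof (rule bij_betw_imageI)
      show "inj_on (chord D) ?I" using chord_inj[OF refl] I by (intro inj_onI) blast
      show "chord D ` ?I = sinner K CC \<alpha>"
      proof (intro equalityI subsetI)
        fix c assume "c \<in> chord D ` ?I"
        then show "c \<in> sinner K CC \<alpha>" using I_iff I by blast
      next
        fix c assume c: "c \<in> sinner K CC \<alpha>"
        then have "c \<in> K" "c \<notin> CC" using sinner_subset by blast+
        then obtain i where "i \<in> {1..n}" "c = chord D i" using chord_surj[OF refl] by blast
        then show "c \<in> chord D ` ?I" using I_iff[of i] c \<open>c \<notin> CC\<close> by blast
      qed
    qed
    show "\<exists>s\<in>\<alpha>. \<exists>t\<in>\<alpha>. s < t \<and> dual (sinner K CC \<alpha>) {i, parent D i} s t \<and> i \<in> {s<..t}" if i: "i \<in> ?I" for i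
    proof -
      have i': "i \<in> {1..n}" and ci: "chord D i \<in> sinner K CC \<alpha>" using i I I_iff by blast+
      obtain s t where st: "s \<in> {0..n}" "t \<in> {0..n}" "s < t" "dual K (chord D i) s t" "i \<in> {s<..t}"
        by (rule parent_cut[OF refl i'])
      have "dual (sinner K CC \<alpha>) (chord D i) s t" by (rule dual_mono[OF st(4)]) (use sinner_subset in blast)
      then show ?thesis
        unfolding chord_def[of D i, symmetric] using restrict_dual[OF CC \<alpha>' ci st(1,2,4)] st(3,5) by blast
    qed
    show "gauged \<phi> (fold contract ?es ?G0) (Side s) = b s" if "s \<in> \<alpha>" for s
      unfolding ga' by (rule side[OF T.\<alpha>_le[OF that]])
    show "gauged \<phi> (fold contract ?es ?G0) (Chord i) = 0" if "i \<in> ?I" for i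
      unfolding ga' by (rule chord0) (use that I in auto)
  qed
qed

lemma M_subset: "M \<subseteq> {0..n}"
  by (rule mins_subset[OF finite_Y])

lemma zero_M: "0 \<in> M"
proof -
  have "0 \<in> face_at {0..n} CC 0" by (rule face_at_self) simp
  then have "Min (face_at {0..n} CC 0) \<le> 0" by (rule Min_le[OF finite_face_at[OF finite_Y]])
  then show ?thesis using mins_iff[OF finite_Y] by simp
qed

lemma plus_sides_eq: "plus_sides D C = {0..n} - M"
proof -
  have "s \<in> plus_sides D C \<longleftrightarrow> s \<in> {0..n} \<and> Min (face_at {0..n} CC s) \<noteq> s" for s
  proof
    assume "s \<in> plus_sides D C"
    then obtain \<alpha> where \<alpha>: "\<alpha> \<in> sfaces {0..n} CC" "s \<in> \<alpha>" "s \<noteq> Min \<alpha>" by (auto simp: plus_sides_def faces_eq)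
    then show "s \<in> {0..n} \<and> Min (face_at {0..n} CC s) \<noteq> s" using sfaces_eq[OF \<alpha>(1,2)] sfacesD(1)[OF \<alpha>(1)] by auto
  next
    assume s: "s \<in> {0..n} \<and> Min (face_at {0..n} CC s) \<noteq> s"
    then have "face_at {0..n} CC s \<in> sfaces {0..n} CC" "s \<in> face_at {0..n} CC s" using face_at_self by (auto simp: sfaces_def)
    then show "s \<in> plus_sides D C" using s unfolding plus_sides_def faces_eq by fastforce
  qed
  then show ?thesis using mins_iff[OF finite_Y] by auto
qed

text \<open>This potential moves the decorations of all sides of a face to its least side.  It takes the
  same value at both ends of a chord in \<open>C\<close>, because the arc of such a chord is a union of faces.\<close>

definition \<psi> :: "nat \<Rightarrow> 'l" where
  "\<psi> v = (\<Sum>s\<in>{0..<v}. (if s \<in> M then bsum {0..n} CC b s else 0) - b s)"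

text \<open>On a union of faces the sum is regrouped by faces: each least side receives exactly what
  the sides of its face give up.\<close>

lemma sum_faces:
  assumes X: "X \<subseteq> {0..n}" "\<And>s. s \<in> X \<Longrightarrow> face_at {0..n} CC s \<subseteq> X"
  shows "(\<Sum>s\<in>X. (if s \<in> M then bsum {0..n} CC b s else 0) - b s) = 0"
proof -
  have fX: "finite X" using X finite_subset by blast
  have "(\<Sum>s\<in>X. if s \<in> M then bsum {0..n} CC b s else 0) = (\<Sum>k\<in>X \<inter> M. bsum {0..n} CC b k)"
    by (simp add: sum.inter_restrict fX)
  also have "\<dots> = (\<Sum>k\<in>X \<inter> M. \<Sum>s\<in>{s \<in> X. Min (face_at {0..n} CC s) = k}. b s)"
  proof (rule sum.cong[OF refl])
    fix k assume k: "k \<in> X \<inter> M"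
    have kM: "Min (face_at {0..n} CC k) = k" using k mins_iff[OF finite_Y] by blast
    have "face_at {0..n} CC k = {s \<in> X. Min (face_at {0..n} CC s) = k}"
    proof (intro equalityI subsetI)
      fix s assume s: "s \<in> face_at {0..n} CC k"
      then show "s \<in> {s \<in> X. Min (face_at {0..n} CC s) = k}" using X(2)[of k] k kM face_at_eq[OF s] by auto
    next
      fix s assume s: "s \<in> {s \<in> X. Min (face_at {0..n} CC s) = k}"
      then have sY: "s \<in> {0..n}" using X(1) by blast
      have "face_at {0..n} CC k = face_at {0..n} CC s" using face_at_Min[OF finite_Y sY, of CC] s by simp
      then show "s \<in> face_at {0..n} CC k" using face_at_self[OF sY] by simp
    qed
    then show "bsum {0..n} CC b k = (\<Sum>s\<in>{s \<in> X. Min (face_at {0..n} CC s) = k}. b s)" by (simp add: bsum_def)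
  qed
  also have "\<dots> = (\<Sum>s\<in>X. b s)"
  proof (rule sum.group)
    show "finite X" "finite (X \<inter> M)" using fX by auto
    show "(\<lambda>s. Min (face_at {0..n} CC s)) ` X \<subseteq> X \<inter> M"
    proof (intro subsetI)
      fix m assume "m \<in> (\<lambda>s. Min (face_at {0..n} CC s)) ` X"
      then obtain s where s: "s \<in> X" "m = Min (face_at {0..n} CC s)" by blast
      then have sY: "s \<in> {0..n}" using X(1) by blast
      show "m \<in> X \<inter> M" using Min_face[OF finite_Y sY, of CC] X(2)[OF s(1)] Min_mins[OF sY] s(2) by blast
    qed
  qed
  finally show ?thesis by (simp add: sum_subtractf)
qed

lemma \<psi>_chord:
  assumes i: "i \<in> C"
  shows "\<psi> i = \<psi> (parent D i)"
proof -
  have eq: "\<psi> p = \<psi> q" if pq: "p < q" "chord D i = {p, q}" for p q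
  proof -
    have qn: "q \<le> n" using chord_le[of "chord D i"] CC i pq(2) by auto
    have arc: "arc (chord D i) = {p..<q}" using pq by (simp add: arc_pair)
    have "\<psi> q = \<psi> p + (\<Sum>s\<in>{p..<q}. (if s \<in> M then bsum {0..n} CC b s else 0) - b s)"
      unfolding \<psi>_def using pq(1) by (simp add: sum.atLeastLessThan_concat)
    also have "(\<Sum>s\<in>{p..<q}. (if s \<in> M then bsum {0..n} CC b s else 0) - b s) = 0"
    proof (rule sum_faces)
      show "{p..<q} \<subseteq> {0..n}" using qn by auto
      show "face_at {0..n} CC s \<subseteq> {p..<q}" if s: "s \<in> {p..<q}" for s
      proof
        fix t assume "t \<in> face_at {0..n} CC s"
        then have "\<not> sep (chord D i) s t" using i by (simp add: face_at_def)
        then show "t \<in> {p..<q}" using s by (simp add: sep_def arc)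
      qed
    qed
    finally show ?thesis by simp
  qed
  obtain a b where ab: "a \<noteq> b" "chord D i = {a, b}" using chordE[of "chord D i"] CC i by blast
  have "i \<noteq> parent D i"
  proof
    assume "i = parent D i"
    then have "{i} = {a, b}" using ab(2) by (simp add: chord_def)
    then show False using ab(1) by auto
  qed
  then consider "i < parent D i" | "parent D i < i" by linarith
  then show ?thesis
  proof cases
    case 1
    then show ?thesis by (rule eq) (simp add: chord_def)
  next
    case 2
    then have "\<psi> (parent D i) = \<psi> i" by (rule eq) (auto simp: chord_def)
    then show ?thesis ..
  qed
qed

lemma \<psi>_side:
  assumes s: "s \<le> n"
  shows "b s + \<psi> (Suc s mod Suc n) - \<psi> s = (if s \<in> M then bsum {0..n} CC b s else 0)"
proof (cases "s = n")
  case True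
  \<comment> \<open>All the sides together form a union of faces, so the potential closes up around
    the polygon.\<close>
  have "\<psi> (Suc n) = 0" unfolding \<psi>_def
    by (rule sum_faces) (auto simp: face_at_def)
  moreover have "\<psi> (Suc n) = \<psi> n + ((if n \<in> M then bsum {0..n} CC b n else 0) - b n)" by (simp add: \<psi>_def)
  moreover have "\<psi> 0 = 0" by (simp add: \<psi>_def)
  ultimately have "- \<psi> n = (if n \<in> M then bsum {0..n} CC b n else 0) - b n" by (intro minus_unique) simp
  then have "b n + \<psi> 0 + - \<psi> n = (if n \<in> M then bsum {0..n} CC b n else 0)" using \<open>\<psi> 0 = 0\<close> by simp
  then show ?thesis using True by simp
next
  case False
  then have "Suc s mod Suc n = Suc s" using s by simp
  then show ?thesis by (simp add: \<psi>_def)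
qed

text \<open>Contraction pushes every vertex forward to the start of the next side in
  \<open>M\<close>, and \<open>nu M\<close>, constant along contracted sides, keeps these starts
  apart. With respect to \<open>\<phi> + \<psi>\<close> the contracted sides are decorated by 0, so
  the gauged decorations do not change.\<close>

lemma r_graph_map:
  obtains F where
    "\<And>s. src (r_graph D C) (Side s) = F s" "\<And>s. tgt (r_graph D C) (Side s) = F (Suc s mod Suc n)"
    "\<And>i. src (r_graph D C) (Chord i) = F i" "\<And>i. tgt (r_graph D C) (Chord i) = F (parent D i)"
    "\<And>v. v \<le> n \<Longrightarrow> F v = F (ix M (nu M v))" "\<And>v. nu M (F v) = nu M v"
    "edges (r_graph D C) = Side ` M \<union> Chord ` C"
    "\<And>e. gauged (\<lambda>v. \<phi> v + \<psi> v) (r_graph D C) e = gauged (\<lambda>v. \<phi> v + \<psi> v) (diagram_graph D) e"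
proof -
  let ?G0 = "keep_edges (Side ` {0..n} \<union> Chord ` C) (diagram_graph D)"
  let ?es = "map Side (sorted_list_of_set (plus_sides D C))" and ?\<phi> = "\<lambda>v. \<phi> v + \<psi> v"
  have G: "r_graph D C = fold contract ?es ?G0" by (simp add: r_graph_def)
  have es: "set ?es = Side ` ({0..n} - M)" by (simp add: plus_sides_eq)
  obtain F where F: "src (fold contract ?es ?G0) = (\<lambda>e. F (src ?G0 e))" "tgt (fold contract ?es ?G0) = (\<lambda>e. F (tgt ?G0 e))"
    and Fe: "\<forall>e\<in>set ?es. F (src ?G0 e) = F (tgt ?G0 e)"
    and h: "\<forall>h :: nat \<Rightarrow> nat. (\<forall>e\<in>set ?es. h (src ?G0 e) = h (tgt ?G0 e)) \<longrightarrow> (\<forall>v. h (F v) = h v)"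
    and ed: "edges (fold contract ?es ?G0) = edges ?G0 - set ?es"
    and ga: "\<forall>\<phi>. (\<forall>e\<in>set ?es. gauged \<phi> ?G0 e = 0) \<longrightarrow> gauged \<phi> (fold contract ?es ?G0) = gauged \<phi> ?G0"
    by (rule contraction_map)
  have nuP: "nu M s = nu M (Suc s mod Suc n)" if "s \<le> n" "s \<notin> M" for s
    using nu_wrap[OF M_subset that(1)] nu_Suc[OF that(2)] by simp
  have FP: "F s = F (Suc s mod Suc n)" if "s \<le> n" "s \<notin> M" for s
  proof -
    have "Side s \<in> set ?es" unfolding es using that by simp
    then show ?thesis using Fe[rule_format, of "Side s"] by (simp add: keep_edges_simps diagram_graph_simps)
  qed
  have next_: "F v = F (ix M (nu M v))" if "v \<le> n" for v
    using that
  proof (induction "n - v" arbitrary: v rule: less_induct)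
    case less
    have fM: "finite M" using M_subset finite_subset by blast
    show ?case
    proof (cases "v \<in> M")
      case True
      then show ?thesis using ix_nu[OF fM] by simp
    next
      case v: False
      show ?thesis
      proof (cases "v = n")
        case True
        then have "Suc v mod Suc n = 0" by simp
        then have "F v = F 0" "nu M v = nu M 0" using FP[OF less.prems v] nuP[OF less.prems v] by simp_all
        then show ?thesis using ix_nu[OF fM zero_M] by simp
      next
        case False
        then have lt: "Suc v \<le> n" "n - Suc v < n - v" "Suc v mod Suc n = Suc v" using less.prems by auto
        have "F v = F (Suc v)" "nu M v = nu M (Suc v)" using FP[OF less.prems v] nuP[OF less.prems v] lt(3) by simp_all
        then show ?thesis using less.hyps[OF lt(2,1)] by simp
      qed
    qed
  qed
  have nuF: "nu M (F v) = nu M v" for v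
  proof (rule h[rule_format])
    fix e assume "e \<in> set ?es"
    then obtain s where "e = Side s" "s \<le> n" "s \<notin> M" unfolding es by auto
    then show "nu M (src ?G0 e) = nu M (tgt ?G0 e)" using nuP by (simp add: keep_edges_simps diagram_graph_simps)
  qed
  have g: "gauged ?\<phi> (fold contract ?es ?G0) = gauged ?\<phi> ?G0"
  proof (rule ga[rule_format])
    fix e assume "e \<in> set ?es"
    then obtain s where s: "e = Side s" "s \<le> n" "s \<notin> M" unfolding es by auto
    have "gauged ?\<phi> ?G0 e = gauged \<phi> (diagram_graph D) (Side s) + \<psi> (Suc s mod Suc n) - \<psi> s"
      unfolding keep_edges_simps by (simp add: s(1) gauged_def diagram_graph_simps algebra_simps)
    also have "\<dots> = 0" unfolding side[OF s(2)] \<psi>_side[OF s(2)] using s(3) by simp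
    finally show "gauged ?\<phi> ?G0 e = 0" .
  qed
  show ?thesis
  proof (rule that[of F])
    show "edges (r_graph D C) = Side ` M \<union> Chord ` C"
      unfolding G ed es keep_edges_simps diagram_graph_simps using C M_subset by auto
    show "gauged ?\<phi> (r_graph D C) e = gauged ?\<phi> (diagram_graph D) e" for e
      unfolding G g keep_edges_simps ..
  qed (use next_ nuF in \<open>simp_all add: G F keep_edges_simps diagram_graph_simps\<close>)
qed

lemma joined_map:
  assumes "joined L x y" "\<And>u v. {u, v} \<in> L \<Longrightarrow> {g u, g v} \<in> L'"
  shows "joined L' (g x) (g y)"
  using assms(1) unfolding joined_def
proof (induction rule: rtrancl_induct)
  case (step y z)
  then have "{g y, g z} \<in> L'" using assms(2) by simp
  then have "(g y, g z) \<in> {(x, y). {x, y} \<in> L'}" by simp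
  then show ?case using step.IH by (rule rtrancl_into_rtrancl[rotated])
qed simp

text \<open>The images of the other chords do not cross the cut \<open>{s<..t}\<close>, which
  excludes the root. If \<open>i\<close> is inside the cut, \<open>joined_cut\<close> gives a path
  from the other end to the root in the renumbered tree, and \<open>ix M\<close> followed by
  \<open>F\<close> carries it to the contracted graph.\<close>

lemma points_to_root_iff:
  assumes i: "i \<in> C" and st: "s \<in> M" "t \<in> M" "s < t" "dual CC (chord D i) s t"
  shows "points_to_root (r_graph D C) i \<longleftrightarrow> i \<in> {s<..t}"
proof -
  interpret Mt: tree_system M CC using mins_tree[OF CC] by unfold_locales
  let ?NK = "(`) (nu M) ` CC"
  interpret R: rooted_tree "card CC" ?NK by (rule Mt.image_rooted)
  obtain F where F: "\<And>s. src (r_graph D C) (Side s) = F s"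
    "\<And>i. src (r_graph D C) (Chord i) = F i" "\<And>i. tgt (r_graph D C) (Chord i) = F (parent D i)"
    and Fn: "\<And>v. v \<le> n \<Longrightarrow> F v = F (ix M (nu M v))" and nuF: "\<And>v. nu M (F v) = nu M v"
    and ed: "edges (r_graph D C) = Side ` M \<union> Chord ` C"
    apply (rule r_graph_map)
    subgoal premises p for F by (rule p(1)[of F, OF p(2) p(4-8)])
    done
  have E: "{j. Chord j \<in> edges (r_graph D C)} - {i} = C - {i}" unfolding ed by auto
  define L where "L = (\<lambda>j. {F j, F (parent D j)}) ` (C - {i})"
  have pr: "points_to_root (r_graph D C) i \<longleftrightarrow> joined L (F (parent D i)) (F 0)"
    by (simp add: points_to_root_def E F L_def)
  have lt: "nu M s < nu M t" by (rule nu_less_mono[OF Mt.finite_Y st(1-3)])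
  have lt2: "nu M t < card M" by (rule nu_less[OF Mt.finite_Y Mt.Y_ne])
  have int: "nu M v \<in> {nu M s<..nu M t} \<longleftrightarrow> v \<in> {s<..t}" for v
    using nu_interval[OF Mt.finite_Y lt lt2, of v] ix_nu[OF Mt.finite_Y] st by simp
  have ij: "j \<in> {s<..t} \<longleftrightarrow> parent D j \<in> {s<..t}" if j: "j \<in> C - {i}" for j
  proof -
    have "chord D j \<noteq> chord D i" using chord_inj[OF refl, of j i] j i C by blast
    then have "\<not> sep {j, parent D j} s t" using dualD[OF st(4), of "chord D j"] j by (simp add: chord_def)
    then show ?thesis using sep_cut[OF st(3)] by simp
  qed
  have ci: "(i \<in> {s<..t}) \<noteq> (parent D i \<in> {s<..t})"
    using dualD[OF st(4), of "chord D i"] i sep_cut[OF st(3), of i "parent D i"] by (simp add: chord_def)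
  have pn: "j \<le> n" "parent D j \<le> n" if "j \<in> C" for j
    using chord_le[of "chord D j"] CC that by (auto simp: chord_def)
  show ?thesis
  proof (cases "i \<in> {s<..t}")
    case False
    have "\<not> joined L (F (parent D i)) (F 0)"
    proof
      assume j: "joined L (F (parent D i)) (F 0)"
      have "(nu M (F (parent D i)) \<in> {nu M s<..nu M t}) = (nu M (F 0) \<in> {nu M s<..nu M t})"
      proof (rule joined_invariant[OF j])
        fix u v assume "{u, v} \<in> L"
        then obtain j where j: "j \<in> C - {i}" "{u, v} = {F j, F (parent D j)}" unfolding L_def by blast
        have "(nu M (F j) \<in> {nu M s<..nu M t}) = (nu M (F (parent D j)) \<in> {nu M s<..nu M t})"
          unfolding nuF int by (rule ij[OF j(1)])
        then show "(nu M u \<in> {nu M s<..nu M t}) = (nu M v \<in> {nu M s<..nu M t})"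
          using j(2) by (auto simp: doubleton_eq_iff)
      qed
      then have "(parent D i \<in> {s<..t}) = (0 \<in> {s<..t})" unfolding nuF int .
      then show False using ci False by simp
    qed
    then show ?thesis using pr False by simp
  next
    case True
    have "nu M ` chord D i = {nu M i, nu M (parent D i)}" by (simp add: chord_def)
    then have c: "{nu M i, nu M (parent D i)} \<in> ?NK" using i by (metis imageI)
    have d: "dual ?NK {nu M i, nu M (parent D i)} (nu M s) (nu M t)"
      using Mt.dual_image[OF order_refl _ st(1,2,4)] i by (simp add: chord_def)
    have "nu M i \<in> {nu M s<..nu M t}" using int True by blast
    then have "joined (?NK - {{nu M i, nu M (parent D i)}}) (nu M (parent D i)) 0"
      by (rule R.joined_cut[OF c lt d])
    then have "joined L (F (ix M (nu M (parent D i)))) (F (ix M 0))"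
    proof (rule joined_map[where g = "\<lambda>k. F (ix M k)"])
      fix u v assume uv: "{u, v} \<in> ?NK - {{nu M i, nu M (parent D i)}}"
      then obtain j where j: "j \<in> C" "{u, v} = {nu M j, nu M (parent D j)}" by (auto simp: chord_def)
      then have "j \<in> C - {i}" using uv by auto
      then have "{F j, F (parent D j)} \<in> L" unfolding L_def by blast
      then show "{F (ix M u), F (ix M v)} \<in> L"
        using j(2) Fn[OF pn(1)[OF j(1)]] Fn[OF pn(2)[OF j(1)]] by (auto simp: doubleton_eq_iff insert_commute)
    qed
    moreover have "F (ix M 0) = F 0"
    proof -
      have "{x \<in> M. x < 0} = {}" by simp
      then have "nu M 0 = 0" by (simp add: nu_def cnt_def)
      then show ?thesis using ix_nu[OF Mt.finite_Y zero_M] by simp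
    qed
    ultimately show ?thesis using pr True Fn[OF pn(2)[OF i]] by simp
  qed
qed

text \<open>In the original tree \<open>i\<close> is the source of its chord and hence lies in the
  cut; so the direction changes iff \<open>i\<close> lies outside the cut of the
  contraction.\<close>

lemma flipped_iff:
  assumes i: "i \<in> C"
  shows "i \<in> flipped_chords D C \<longleftrightarrow> chord D i \<in> flips {0..n} K CC"
proof -
  interpret Mt: tree_system M CC using mins_tree[OF CC] by unfold_locales
  have ci: "chord D i \<in> CC" using i by blast
  obtain s' t' where st': "s' \<in> M" "t' \<in> M" "s' < t'" "dual CC (chord D i) s' t'" using Mt.dualE[OF ci] .
  have i': "i \<in> {1..n}" using i C by blast
  obtain s t where st: "s \<in> {0..n}" "t \<in> {0..n}" "s < t" "dual K (chord D i) s t" "i \<in> {s<..t}"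
    by (rule parent_cut[OF refl i'])
  have "chord D i \<in> flips {0..n} K CC \<longleftrightarrow> (i \<in> {s<..t}) \<noteq> (i \<in> {s'<..t'})"
    by (rule flip_iff[OF CC ci _ st(1-4) st']) (simp add: chord_def)
  also have "\<dots> \<longleftrightarrow> i \<in> flipped_chords D C"
    using points_to_root_iff[OF i st'] st(5) i unfolding flipped_chords_def by blast
  finally show ?thesis ..
qed

lemma k_num_eq: "k_num D C = card (flips {0..n} K CC)"
proof -
  have fl: "flips {0..n} K CC \<subseteq> CC" "flipped_chords D C \<subseteq> C" by (auto simp: flips_def flipped_chords_def)
  have "chord D ` flipped_chords D C = flips {0..n} K CC"
    using flipped_iff fl by blast
  moreover have "inj_on (chord D) (flipped_chords D C)"
    using inj_on_subset[OF bij_betw_imp_inj_on[OF bij_C] fl(2)] .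
  ultimately show ?thesis unfolding k_num_def using card_image by metis
qed

lemma r_diag_real: "translation_rel (r_diag D C) (real_diag M CC (bsum {0..n} CC b))"
proof -
  interpret Mt: tree_system M CC using mins_tree[OF CC] by unfold_locales
  let ?Fl = "flipped_chords D C" and ?\<phi> = "\<lambda>v. \<phi> v + \<psi> v" and ?G = "r_graph D C"
  obtain F where F: "\<And>s. src ?G (Side s) = F s" "\<And>s. tgt ?G (Side s) = F (Suc s mod Suc n)"
    "\<And>i. src ?G (Chord i) = F i" "\<And>i. tgt ?G (Chord i) = F (parent D i)"
    and Fn: "\<And>v. v \<le> n \<Longrightarrow> F v = F (ix M (nu M v))" and nuF: "\<And>v. nu M (F v) = nu M v"
    and ed: "edges ?G = Side ` M \<union> Chord ` C"
    and ga: "\<And>e. gauged ?\<phi> ?G e = gauged ?\<phi> (diagram_graph D) e"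
    apply (rule r_graph_map)
    subgoal premises p for F by (rule p(1)[of F, OF p(2-9)])
    done
  \<comment> \<open>After the flips, chord \<open>i\<close> goes from \<open>u i\<close> to
    \<open>w i\<close>.\<close>
  define u where "u i = (if i \<in> ?Fl then parent D i else i)" for i
  define w where "w i = (if i \<in> ?Fl then i else parent D i)" for i
  have uw: "{u i, w i} = chord D i" for i by (auto simp: u_def w_def chord_def)
  have pn: "i \<le> n" "parent D i \<le> n" if "i \<in> C" for i
    using chord_le[of "chord D i"] CC that by (auto simp: chord_def)
  have sn: "s \<le> n" if "s \<in> M" for s using M_subset that by auto
  show ?thesis
    unfolding r_diag_def
  proof (rule Mt.graph_diagram_real[where I = C and F = F and u = u and w = w and \<phi> = ?\<phi>])
    show "edges (flip_edges (Chord ` ?Fl) ?G) = Side ` M \<union> Chord ` C" by (simp add: flip_edges_def ed)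
    show "inj_on F M"
    proof (rule inj_onI)
      fix s t assume "s \<in> M" "t \<in> M" "F s = F t"
      then show "s = t" using nuF ix_nu[OF Mt.finite_Y] by metis
    qed
    show "src (flip_edges (Chord ` ?Fl) ?G) (Side s) = F s" for s by (simp add: flip_edges_def F image_iff)
    show "tgt (flip_edges (Chord ` ?Fl) ?G) (Side s) = F (ix M (nu M (Suc s)))" if s: "s \<in> M" for s
    proof -
      have le: "Suc s mod Suc n \<le> n" using mod_less_divisor[of "Suc n" "Suc s"] by linarith
      show ?thesis using Fn[OF le] nu_wrap[OF M_subset sn[OF s]] by (simp add: flip_edges_def F image_iff)
    qed
    show "src (flip_edges (Chord ` ?Fl) ?G) (Chord i) = F (ix M (nu M (u i)))" if "i \<in> C" for i
      using Fn[OF pn(1)[OF that]] Fn[OF pn(2)[OF that]] by (simp add: flip_edges_def F image_iff u_def)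
    show "tgt (flip_edges (Chord ` ?Fl) ?G) (Chord i) = F (ix M (nu M (w i)))" if "i \<in> C" for i
      using Fn[OF pn(1)[OF that]] Fn[OF pn(2)[OF that]] by (simp add: flip_edges_def F image_iff w_def)
    show "bij_betw (\<lambda>i. {u i, w i}) C CC" unfolding uw by (rule bij_C)
    show "\<exists>s\<in>M. \<exists>t\<in>M. s < t \<and> dual CC {u i, w i} s t \<and> u i \<in> {s<..t}" if i: "i \<in> C" for i
    proof -
      have ci: "chord D i \<in> CC" using i by blast
      obtain s t where st: "s \<in> M" "t \<in> M" "s < t" "dual CC (chord D i) s t" using Mt.dualE[OF ci] .
      have fl: "i \<in> ?Fl \<longleftrightarrow> i \<notin> {s<..t}" using points_to_root_iff[OF i st] i by (simp add: flipped_chords_def)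
      have "(i \<in> {s<..t}) \<noteq> (parent D i \<in> {s<..t})"
        using dualD[OF st(4) ci] sep_cut[OF st(3), of i "parent D i"] by (simp add: chord_def)
      then have "u i \<in> {s<..t}" using fl by (auto simp: u_def)
      then show ?thesis unfolding uw using st by blast
    qed
    show "gauged ?\<phi> (flip_edges (Chord ` ?Fl) ?G) (Side s) = bsum {0..n} CC b s" if s: "s \<in> M" for s
    proof -
      have "gauged ?\<phi> (flip_edges (Chord ` ?Fl) ?G) (Side s) = gauged ?\<phi> (diagram_graph D) (Side s)"
        unfolding ga[symmetric] by (simp add: gauged_def flip_edges_def image_iff)
      also have "\<dots> = gauged \<phi> (diagram_graph D) (Side s) + \<psi> (Suc s mod Suc n) - \<psi> s"
        by (simp add: gauged_def diagram_graph_simps algebra_simps)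
      also have "\<dots> = bsum {0..n} CC b s" unfolding side[OF sn[OF s]] \<psi>_side[OF sn[OF s]] using s by simp
      finally show ?thesis .
    qed
    show "gauged ?\<phi> (flip_edges (Chord ` ?Fl) ?G) (Chord i) = 0" if i: "i \<in> C" for i
    proof -
      have "gauged ?\<phi> (diagram_graph D) (Chord i) = gauged \<phi> (diagram_graph D) (Chord i)"
        using \<psi>_chord[OF i] by (simp add: gauged_def diagram_graph_simps)
      then have "gauged ?\<phi> ?G (Chord i) = 0" using chord0[of i] C i ga by auto
      then show ?thesis by (auto simp: gauged_def flip_edges_def algebra_simps)
    qed
  qed
qed

end

section \<open>The coproduct formula in normal form\<close>

lemma dd_cong:
  assumes "translation_rel D D'"
  shows "dd D = dd D'"
proof (cases "deg D = 0")
  case False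
  then have "generator_rel D D'" using assms by (simp add: generator_rel_def)
  then have "abs_dd_generator D = abs_dd_generator D'" using Quotient_rel_abs[OF Quotient_dd_generator] by blast
  then show ?thesis using assms by (simp add: dd_def translation_rel_def)
qed (use assms in \<open>simp add: dd_def translation_rel_def\<close>)

text \<open>The right-hand side sees the decorations only through the normal form \<open>b\<close>,
  which translates of \<open>D\<close> share; \<open>coproduct_formula_cong\<close> follows from
  this.\<close>

lemma coproduct_formula_cop:
  assumes D: "dissection_diagram D" and b: "translation_rel D (real_diag {0..deg D} (chords D) b)"
  shows "coproduct_formula D = cop {0..deg D} (chords D) b"
proof -
  interpret rooted_tree "deg D" "chords D" by (rule dissection_rooted_tree[OF D])
  obtain \<phi> where \<phi>: "\<forall>s\<le>deg D. gauged \<phi> (diagram_graph D) (Side s) = b s"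
    "\<forall>i\<in>{1..deg D}. gauged \<phi> (diagram_graph D) (Chord i) = 0" using b translation_real[OF D] by blast
  have t: "qscale ((-1) ^ k_num D C) (q_elem D C \<otimes> r_elem D C) = cop_term {0..deg D} (chords D) b (chord D ` C)"
    if C: "C \<subseteq> {1..deg D}" for C
  proof -
    interpret diagram_chords D C \<phi> b by unfold_locales (use C \<phi> in auto)
    have "q_elem D C = (\<Prod>\<alpha>\<in>sfaces {0..deg D} (chord D ` C). gen \<alpha> (sinner (chords D) (chord D ` C) \<alpha>) b)"
      unfolding q_elem_def faces_eq gen_def
      by (rule prod.cong[OF refl]) (rule dd_cong, rule q_face_real, simp add: faces_eq)
    moreover have "r_elem D C = gen (mins {0..deg D} (chord D ` C)) (chord D ` C) (bsum {0..deg D} (chord D ` C) b)"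
      unfolding r_elem_def gen_def by (rule dd_cong[OF r_diag_real])
    ultimately show ?thesis by (simp add: cop_term_def k_num_eq)
  qed
  have inj: "inj_on ((`) (chord D)) (Pow {1..deg D})"
    by (rule inj_on_image_Pow[OF bij_betw_imp_inj_on[OF chord_bij[OF refl]]])
  have surj: "(`) (chord D) ` Pow {1..deg D} = Pow (chords D)"
    by (rule image_Pow_surj[OF bij_betw_imp_surj_on[OF chord_bij[OF refl]]])
  have "cop {0..deg D} (chords D) b = (\<Sum>C\<in>Pow {1..deg D}. cop_term {0..deg D} (chords D) b (chord D ` C))"
    unfolding cop_def surj[symmetric] by (simp only: sum.reindex[OF inj] o_def)
  then show ?thesis unfolding coproduct_formula_def using t by simp
qed

section \<open>The Hopf algebra of dissection diagrams\<close>

abbreviation eps :: "('x multiset \<Rightarrow>\<^sub>0 rat) \<Rightarrow> rat" where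
  "eps p \<equiv> Poly_Mapping.lookup p {#}"

lemma eps_mult: "eps (p * q) = eps p * eps q"
  using lookup_mult_0[of p q] by simp

lemma eps_one: "eps 1 = 1"
  by (simp add: lookup_one)

lemma eps_prod: "eps (prod f A) = (\<Prod>i\<in>A. eps (f i))"
  by (induction A rule: infinite_finite_induct) (simp_all add: eps_mult eps_one)

lemma tensor_lift_eps:
  "tensor_lift (\<lambda>a b. qscale (eps a) b) (x \<otimes> y) = qscale (eps x) y"
  "tensor_lift (\<lambda>a b. qscale (eps b) a) (x \<otimes> y) = qscale (eps y) x"
  by (rule tensor_universal(3), rule bilinear_mapI; simp add: linear_qscale_iff qscale_add_left lookup_add mult.commute)+

lemma alg_hom_eps: "alg_hom (\<lambda>x. qscale (eps x) (1 :: 'c::comm_monoid_add \<Rightarrow>\<^sub>0 rat))"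
  unfolding algebra_hom_def linear_qscale_iff
  by (simp add: lookup_add qscale_add_left eps_mult eps_one qscale_mult_left)

subsection \<open>Generators\<close>

lemma rep_generator:
  fixes x :: "'l::ab_group_add dd_generator"
  shows "dissection_diagram (rep_dd_generator x)" "0 < deg (rep_dd_generator x)"
proof -
  have "generator_rel (rep_dd_generator x) (rep_dd_generator x)"
    by (rule Quotient_rep_reflp[OF Quotient_dd_generator])
  then show "dissection_diagram (rep_dd_generator x)" "0 < deg (rep_dd_generator x)"
    by (simp_all add: generator_rel_def translation_rel_def)
qed

lemma rep_abs_generator:
  assumes "dissection_diagram D" "0 < deg D"
  shows "translation_rel D (rep_dd_generator (abs_dd_generator D))"
proof -
  have "generator_rel D D" using assms translation_rel_refl by (simp add: generator_rel_def)
  then have "generator_rel D (rep_dd_generator (abs_dd_generator D))"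
    using Quotient_rep_abs[OF Quotient_dd_generator] Quotient_symp[OF Quotient_dd_generator] sympD by metis
  then show ?thesis by (simp add: generator_rel_def)
qed

lemma dd_rep: "dd (rep_dd_generator x) = basis {#x#}"
  using rep_generator(2)[of x] Quotient_abs_rep[OF Quotient_dd_generator, of x] by (simp add: dd_def)

lemma real_diag_dissection:
  assumes "tree_sys Y H"
  shows "dissection_diagram (real_diag Y H b)"
proof -
  interpret tree_system Y H using assms by unfold_locales
  interpret R: rooted_tree "card H" "(`) (nu Y) ` H" by (rule image_rooted)
  show ?thesis by (rule R.dissection_diagram_tree) (simp_all add: real_diag_def)
qed

lemma gen_empty: "gen Y {} b = 1"
  by (simp add: gen_def real_diag_def dd_def)

lemma cop_empty: "cop Y {} b = 1"
proof -
  have "sinner {} C \<alpha> = {}" "flips Y {} {} = {}" for C \<alpha> by (simp_all add: sinner_def flips_def)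
  then show ?thesis by (simp add: cop_def cop_term_def gen_empty tensor_one)
qed

lemma dd_gen:
  assumes D: "dissection_diagram D"
  obtains b where "translation_rel D (real_diag {0..deg D} (chords D) b)" "dd D = gen {0..deg D} (chords D) b"
    "coproduct_formula D = cop {0..deg D} (chords D) b"
proof -
  obtain b where b: "translation_rel D (real_diag {0..deg D} (chords D) b)" by (rule gauge_exists[OF D])
  show ?thesis by (rule that[OF b]) (use dd_cong[OF b] coproduct_formula_cop[OF D b] in \<open>simp_all add: gen_def\<close>)
qed

lemma coproduct_formula_cong:
  assumes "translation_rel D D'" "0 < deg D"
  shows "coproduct_formula D = coproduct_formula D'"
proof -
  have D: "dissection_diagram D" "dissection_diagram D'" and eq: "deg D = deg D'" "chords D = chords D'"
    using assms(1) by (simp_all add: translation_rel_def)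
  obtain b where b: "translation_rel D (real_diag {0..deg D} (chords D) b)" by (rule gauge_exists[OF D(1)])
  have "generator_rel D' (real_diag {0..deg D} (chords D) b)"
    using Quotient_symp[OF Quotient_dd_generator] Quotient_transp[OF Quotient_dd_generator] assms b
    by (meson generator_rel_def sympD transpD)
  then have b': "translation_rel D' (real_diag {0..deg D'} (chords D') b)" using eq by (simp add: generator_rel_def)
  show ?thesis using coproduct_formula_cop[OF D(1) b] coproduct_formula_cop[OF D(2) b'] eq by simp
qed

lemma alg_hom_coproduct: "alg_hom dd_coproduct"
  unfolding dd_coproduct_def by (rule alg_hom_free_ext)

lemma dd_coproduct_basis: "dd_coproduct (basis {#x#}) = coproduct_formula (rep_dd_generator x)"
  by (simp add: dd_coproduct_def free_ext_basis)

lemma dd_coproduct_dd: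
  assumes D: "dissection_diagram D"
  shows "dd_coproduct (dd D) = coproduct_formula D"
proof (cases "deg D = 0")
  case True
  obtain b where b: "translation_rel D (real_diag {0..deg D} (chords D) b)" by (rule gauge_exists[OF D])
  have "chords D = {}" using dissection_diagramD(2,5)[OF D] True by simp
  then have "coproduct_formula D = 1" using coproduct_formula_cop[OF D b] by (simp add: cop_empty)
  then show ?thesis using True alg_hom_one[OF alg_hom_coproduct] by (simp add: dd_def)
next
  case False
  then have "coproduct_formula (rep_dd_generator (abs_dd_generator D)) = coproduct_formula D"
    using coproduct_formula_cong[OF rep_abs_generator[OF D]] by simp
  then show ?thesis using False by (simp add: dd_def dd_coproduct_basis)
qed

text \<open>By definition \<open>gen Y H b\<close> comes from a diagram on the standard polygon,
  already in normal form; \<open>cop_image\<close> returns to the names in \<open>Y\<close>.\<close>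

lemma dd_coproduct_gen:
  assumes "tree_sys Y H"
  shows "dd_coproduct (gen Y H b) = cop Y H b"
proof -
  interpret tree_system Y H using assms by unfold_locales
  interpret R: rooted_tree "card H" "(`) (nu Y) ` H" by (rule image_rooted)
  let ?D = "real_diag Y H b"
  have D: "dissection_diagram ?D" by (rule real_diag_dissection[OF assms])
  have eq: "deg ?D = card H" "chords ?D = (`) (nu Y) ` H" by (simp_all add: real_diag_def)
  have "translation_rel ?D (real_diag {0..deg ?D} (chords ?D) (b \<circ> ix Y))"
    unfolding translation_real[OF D]
    by (rule exI[of _ "\<lambda>_. 0"]) (simp add: gauged_def diagram_graph_def real_diag_def card_eq less_Suc_eq_le)
  then have "coproduct_formula ?D = cop {0..card H} ((`) (nu Y) ` H) (b \<circ> ix Y)"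
    using coproduct_formula_cop[OF D] eq by simp
  moreover have "{0..card H} = nu Y ` Y" using nu_image_self[OF finite_Y] card_eq by auto
  ultimately have "coproduct_formula ?D = cop Y H b" by (simp only: cop_image)
  then show ?thesis using dd_coproduct_dd[OF D] by (simp add: gen_def)
qed

subsection \<open>Counit\<close>

lemma eps_gen:
  assumes "finite H"
  shows "eps (gen Y H b) = (if H = {} then 1 else 0)"
  using assms by (simp add: gen_def dd_def real_diag_def eps_one lookup_single)

context tree_system
begin

lemma mins_all: "mins Y H = Y" and face_at_all: "s \<in> Y \<Longrightarrow> face_at Y H s = {s}"
proof -
  have f: "face_at Y H s = {s}" if s: "s \<in> Y" for s
  proof (intro equalityI subsetI)
    fix t assume "t \<in> face_at Y H s"
    then have "t \<in> Y" "\<forall>c\<in>H. \<not> sep c s t" by (simp_all add: face_at_def)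
    then show "t \<in> {s}" using separated[OF s, of t] by auto
  qed (use face_at_self[OF s] in simp)
  then show "s \<in> Y \<Longrightarrow> face_at Y H s = {s}" .
  show "mins Y H = Y" using mins_iff[OF finite_Y, of _ H] f by auto
qed

text \<open>The counit kills every diagram with a chord, and only \<open>C = H\<close> leaves all
  faces without inner chords. Then every face is a single side, and the contraction is the
  identity.\<close>

lemma counit_left_cop: "tensor_lift (\<lambda>a b. qscale (eps a) b) (cop Y H b) = gen Y H b"
proof -
  have t: "tensor_lift (\<lambda>a b. qscale (eps a) b) (cop_term Y H b C) = (if C = H then gen Y H b else 0)" if C: "C \<subseteq> H" for C
  proof -
    have "eps (\<Prod>\<alpha>\<in>sfaces Y C. gen \<alpha> (sinner H C \<alpha>) b) = (\<Prod>\<alpha>\<in>sfaces Y C. if sinner H C \<alpha> = {} then 1 else 0)"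
      unfolding eps_prod
      by (rule prod.cong[OF refl], rule eps_gen, rule finite_subset[OF subset_trans[OF sinner_subset Diff_subset] finite_H])
    also have "\<dots> = (if C = H then 1 else 0)"
    proof (cases "C = H")
      case True
      then have "sinner H C \<alpha> = {}" for \<alpha> by (simp add: sinner_def)
      then show ?thesis using True by simp
    next
      case False
      then obtain \<alpha> where "\<alpha> \<in> sfaces Y C" "sinner H C \<alpha> \<noteq> {}" using UN_sinner[OF C] C by blast
      then show ?thesis using False finite_sfaces[OF finite_Y, of C] by (auto intro!: prod_zero)
    qed
    finally have e: "eps (\<Prod>\<alpha>\<in>sfaces Y C. gen \<alpha> (sinner H C \<alpha>) b) = (if C = H then 1 else 0)" .
    have "flips Y H H = {}" by (simp add: flips_def mins_all)
    moreover have "gen Y H (bsum Y H b) = gen Y H b"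
      by (rule gen_cong[OF finite_Y]) (simp add: bsum_def face_at_all)
    ultimately show ?thesis
      by (simp add: cop_term_def lin_scale[OF lin_tensor_lift] tensor_lift_eps e mins_all)
  qed
  have "tensor_lift (\<lambda>a b. qscale (eps a) b) (cop Y H b) = (\<Sum>C\<in>Pow H. if C = H then gen Y H b else 0)"
    unfolding cop_def lin_sum[OF lin_tensor_lift] by (rule sum.cong[OF refl t]) simp
  then show ?thesis using finite_H by simp
qed

text \<open>Only \<open>C = {}\<close> leaves no chord in the second factor, and then the whole
  polygon is the only face.\<close>

lemma counit_right_cop: "tensor_lift (\<lambda>a b. qscale (eps b) a) (cop Y H b) = gen Y H b"
proof -
  have t: "tensor_lift (\<lambda>a b. qscale (eps b) a) (cop_term Y H b C) = (if C = {} then gen Y H b else 0)" if C: "C \<subseteq> H" for C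
  proof -
    have fC: "finite C" using C finite_H finite_subset by auto
    have "face_at Y {} s = Y" for s by (simp add: face_at_def)
    then have f: "sfaces Y {} = {Y}" using Y_ne by (auto simp: sfaces_def)
    have "sinner H {} Y = H" using UN_sinner[of "{}"] by (simp add: f)
    then show ?thesis
      by (simp add: cop_term_def lin_scale[OF lin_tensor_lift] tensor_lift_eps eps_gen[OF fC] f flips_def)
  qed
  have "tensor_lift (\<lambda>a b. qscale (eps b) a) (cop Y H b) = (\<Sum>C\<in>Pow H. if C = {} then gen Y H b else 0)"
    unfolding cop_def lin_sum[OF lin_tensor_lift] by (rule sum.cong[OF refl t]) simp
  then show ?thesis using finite_H by simp
qed

end

subsection \<open>Degrees\<close>

definition mdeg :: "'l::ab_group_add dd_generator multiset \<Rightarrow> nat" where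
  "mdeg m = (\<Sum>x\<in>#m. deg (rep_dd_generator x))"

definition homog :: "('a \<Rightarrow> nat) \<Rightarrow> nat \<Rightarrow> ('a \<Rightarrow>\<^sub>0 rat) \<Rightarrow> bool" where
  "homog d n p \<longleftrightarrow> (\<forall>m\<in>Poly_Mapping.keys p. d m = n)"

lemma homog_one: "d 0 = 0 \<Longrightarrow> homog d 0 (1 :: 'a::comm_monoid_add \<Rightarrow>\<^sub>0 rat)"
  by (simp add: homog_def)

lemma homog_mult:
  assumes "\<And>k l. d (k + l) = d k + d l" "homog d m p" "homog d n q"
  shows "homog d (m + n) (p * q :: 'a::comm_monoid_add \<Rightarrow>\<^sub>0 rat)"
  unfolding homog_def
proof
  fix k assume "k \<in> Poly_Mapping.keys (p * q)"
  then obtain a b where "a \<in> Poly_Mapping.keys p" "b \<in> Poly_Mapping.keys q" "k = a + b" using keys_mult[of p q] by blast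
  then show "d k = m + n" using assms by (simp add: homog_def)
qed

lemma homog_prod:
  fixes f :: "'i \<Rightarrow> ('a::comm_monoid_add \<Rightarrow>\<^sub>0 rat)"
  assumes "\<And>k l. d (k + l) = d k + d l" "d 0 = 0" "finite A" "\<And>i. i \<in> A \<Longrightarrow> homog d (e i) (f i)"
  shows "homog d (\<Sum>i\<in>A. e i) (\<Prod>i\<in>A. f i)"
  using assms(3,4) by (induction A) (simp_all add: homog_one homog_mult assms(1,2))

lemma homog_qscale: "homog d n p \<Longrightarrow> homog d n (qscale c p)"
  by (auto simp: homog_def in_keys_iff)

lemma homog_sum:
  assumes "\<And>i. i \<in> A \<Longrightarrow> homog d n (f i)"
  shows "homog d n (\<Sum>i\<in>A. f i)"
  using assms
proof (induction A rule: infinite_finite_induct)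
  case (insert i A)
  then show ?case using Poly_Mapping.keys_add[of "f i" "sum f A"] by (auto simp: homog_def)
qed (simp_all add: homog_def)

lemma homog_tensor:
  assumes "homog d m p" "homog d n q"
  shows "homog (\<lambda>(k, l). d k + d l) (m + n) (p \<otimes> q)"
  using assms by (auto simp: homog_def in_keys_iff)

lemma mdeg_add: "mdeg (k + l) = mdeg k + mdeg l" and mdeg_empty: "mdeg {#} = 0"
  by (simp_all add: mdeg_def)

lemma homog_dd:
  assumes "dissection_diagram D"
  shows "homog mdeg (deg D) (dd D)"
proof (cases "deg D = 0")
  case True
  then show ?thesis using homog_one[of mdeg] by (simp add: dd_def mdeg_empty)
next
  case False
  then have "deg (rep_dd_generator (abs_dd_generator D)) = deg D"
    using rep_abs_generator[OF assms] by (simp add: translation_rel_def)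
  then show ?thesis using False by (simp add: homog_def dd_def mdeg_def)
qed

lemma homog_gen: "tree_sys Y H \<Longrightarrow> homog mdeg (card H) (gen Y H b)"
  using homog_dd[OF real_diag_dissection, of Y H b] by (simp add: gen_def real_diag_def)

text \<open>The chords outside \<open>C\<close> are distributed over the faces, so the two tensor
  factors have degrees \<open>card (H - C)\<close> and \<open>card C\<close>.\<close>

lemma (in tree_system) homog_cop: "homog (\<lambda>(k, l). mdeg k + mdeg l) (card H) (cop Y H b)"
  unfolding cop_def
proof (rule homog_sum)
  fix C assume "C \<in> Pow H"
  then have C: "C \<subseteq> H" by simp
  have q: "homog mdeg (\<Sum>\<alpha>\<in>sfaces Y C. card (sinner H C \<alpha>)) (\<Prod>\<alpha>\<in>sfaces Y C. gen \<alpha> (sinner H C \<alpha>) b)"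
    by (rule homog_prod) (simp_all add: mdeg_add mdeg_empty finite_sfaces[OF finite_Y] homog_gen restrict_tree[OF C])
  have "(\<Sum>\<alpha>\<in>sfaces Y C. card (sinner H C \<alpha>)) = card (H - C)"
    using sum_card_sinner[OF C, of UNIV] by simp
  moreover have r: "homog mdeg (card C) (gen (mins Y C) C (bsum Y C b))" by (rule homog_gen[OF mins_tree[OF C]])
  moreover have "card (H - C) + card C = card H"
    using card_Diff_subset[of C H] C finite_subset[OF C finite_H] card_mono[OF finite_H C] by simp
  ultimately show "homog (\<lambda>(k, l). mdeg k + mdeg l) (card H) (cop_term Y H b C)"
    unfolding cop_term_def using homog_qscale[OF homog_tensor[OF q r]] by simp
qed

lemma homog_coproduct:
  fixes m :: "'l::ab_group_add dd_generator multiset"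
  shows "homog (\<lambda>(k, l). mdeg k + mdeg l) (mdeg m) (dd_coproduct (basis m))"
proof (induction m)
  case empty
  have "dd_coproduct (basis {#}) = (1 :: 'l dd_generator multiset \<times> 'l dd_generator multiset \<Rightarrow>\<^sub>0 rat)"
    using alg_hom_one[OF alg_hom_coproduct] by simp
  moreover have "homog (\<lambda>(k, l). mdeg k + mdeg l) 0 (1 :: 'l dd_generator multiset \<times> 'l dd_generator multiset \<Rightarrow>\<^sub>0 rat)"
    by (rule homog_one) (simp add: zero_prod_def mdeg_empty)
  ultimately show ?case by (simp only: mdeg_empty)
next
  case (add x m)
  let ?D = "rep_dd_generator x"
  obtain b where b: "coproduct_formula ?D = cop {0..deg ?D} (chords ?D) b" by (rule dd_gen[OF rep_generator(1)])
  interpret tree_system "{0..deg ?D}" "chords ?D" using dissection_tree[OF rep_generator(1)] by unfold_locales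
  have "homog (\<lambda>(k, l). mdeg k + mdeg l) (deg ?D) (dd_coproduct (basis {#x#}))"
    unfolding dd_coproduct_basis b using homog_cop card_eq by simp
  then have "homog (\<lambda>(k, l). mdeg k + mdeg l) (deg ?D + mdeg m) (dd_coproduct (basis {#x#}) * dd_coproduct (basis m))"
    by (rule homog_mult[rotated, OF _ add]) (auto simp: mdeg_add)
  moreover have "basis (add_mset x m) = basis {#x#} * basis m" by (simp add: mult_single)
  ultimately show ?case by (simp add: alg_hom_mult[OF alg_hom_coproduct] mdeg_def)
qed

subsection \<open>The Hopf algebra structure\<close>

text \<open>Coassociativity and the counit laws are equations between algebra morphisms, hence are
  checked on generators, where the coproduct is \<open>cop\<close> of a tree system.\<close>

lemma connected_bialgebra_dd: "connected_bialgebra mdeg dd_coproduct eps"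
proof
  let ?\<Delta> = "dd_coproduct :: 'a dd_algebra \<Rightarrow> _"
  have id: "alg_hom id" using alg_hom_id by (simp add: id_def)
  fix x :: "'a dd_algebra"
  show "tensor_assoc (tensor_map ?\<Delta> id (?\<Delta> x)) = tensor_map id ?\<Delta> (?\<Delta> x)"
  proof (rule alg_hom_eqI[of "\<lambda>x. tensor_assoc (tensor_map ?\<Delta> id (?\<Delta> x))" "\<lambda>x. tensor_map id ?\<Delta> (?\<Delta> x)"])
    show "alg_hom (\<lambda>x. tensor_assoc (tensor_map ?\<Delta> id (?\<Delta> x)))" "alg_hom (\<lambda>x. tensor_map id ?\<Delta> (?\<Delta> x))"
      by (intro alg_hom_comp[OF alg_hom_tensor_assoc] alg_hom_comp[OF alg_hom_tensor_map[OF alg_hom_coproduct id]]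
          alg_hom_comp[OF alg_hom_tensor_map[OF id alg_hom_coproduct]] alg_hom_coproduct)+
    fix g :: "'a dd_generator"
    obtain b where b: "coproduct_formula (rep_dd_generator g) = cop {0..deg (rep_dd_generator g)} (chords (rep_dd_generator g)) b"
      by (rule dd_gen[OF rep_generator(1)])
    show "tensor_assoc (tensor_map ?\<Delta> id (?\<Delta> (basis {#g#}))) = tensor_map id ?\<Delta> (?\<Delta> (basis {#g#}))"
      unfolding dd_coproduct_basis b
      by (rule coassoc_cop[OF alg_hom_coproduct dd_coproduct_gen dissection_tree[OF rep_generator(1)]])
  qed
  have l: "alg_hom (tensor_lift (\<lambda>(a :: 'a dd_algebra) b. qscale (eps a) (b :: 'a dd_algebra)))"
    "alg_hom (tensor_lift (\<lambda>(a :: 'a dd_algebra) b. qscale (eps b) (a :: 'a dd_algebra)))"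
    by (rule alg_hom_tensor_lift; simp add: eps_one eps_mult qscale_mult_left qscale_mult_right mult.commute)+
  show "tensor_lift (\<lambda>a b. qscale (eps a) b) (?\<Delta> x) = x"
  proof (rule alg_hom_eqI[OF alg_hom_comp[OF l(1) alg_hom_coproduct] alg_hom_id])
    fix g :: "'a dd_generator"
    obtain b where b: "dd (rep_dd_generator g) = gen {0..deg (rep_dd_generator g)} (chords (rep_dd_generator g)) b"
      "coproduct_formula (rep_dd_generator g) = cop {0..deg (rep_dd_generator g)} (chords (rep_dd_generator g)) b"
      by (rule dd_gen[OF rep_generator(1)])
    interpret tree_system "{0..deg (rep_dd_generator g)}" "chords (rep_dd_generator g)"
      using dissection_tree[OF rep_generator(1)] by unfold_locales
    show "tensor_lift (\<lambda>a b. qscale (eps a) b) (?\<Delta> (basis {#g#})) = basis {#g#}"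
      unfolding dd_coproduct_basis b(2) counit_left_cop b(1)[symmetric] by (rule dd_rep)
  qed
  show "tensor_lift (\<lambda>a b. qscale (eps b) a) (?\<Delta> x) = x"
  proof (rule alg_hom_eqI[OF alg_hom_comp[OF l(2) alg_hom_coproduct] alg_hom_id])
    fix g :: "'a dd_generator"
    obtain b where b: "dd (rep_dd_generator g) = gen {0..deg (rep_dd_generator g)} (chords (rep_dd_generator g)) b"
      "coproduct_formula (rep_dd_generator g) = cop {0..deg (rep_dd_generator g)} (chords (rep_dd_generator g)) b"
      by (rule dd_gen[OF rep_generator(1)])
    interpret tree_system "{0..deg (rep_dd_generator g)}" "chords (rep_dd_generator g)"
      using dissection_tree[OF rep_generator(1)] by unfold_locales
    show "tensor_lift (\<lambda>a b. qscale (eps b) a) (?\<Delta> (basis {#g#})) = basis {#g#}"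
      unfolding dd_coproduct_basis b(2) counit_right_cop b(1)[symmetric] by (rule dd_rep)
  qed
  show "mdeg (a + b) = mdeg a + mdeg b" for a b :: "'a dd_generator multiset" by (rule mdeg_add)
  show "mdeg a = 0 \<longleftrightarrow> a = 0" for a :: "'a dd_generator multiset"
  proof (cases a)
    case (add x m)
    then show ?thesis using rep_generator(2)[of x] by (simp add: mdeg_def)
  qed (simp add: mdeg_empty)
  show "mdeg k + mdeg l = mdeg m" if "(k, l) \<in> Poly_Mapping.keys (?\<Delta> (basis m))" for k l m
    using homog_coproduct[of m] that by (auto simp: homog_def)
  show "alg_hom ?\<Delta>" by (rule alg_hom_coproduct)
  show "eps y = Poly_Mapping.lookup y 0" for y :: "'a dd_algebra" by simp
qed

subsection \<open>Functoriality\<close>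

lemma alg_hom_dd_map: "alg_hom (dd_map h)"
  unfolding dd_map_def by (rule alg_hom_free_ext)

lemma dd_map_basis: "dd_map h (basis {#x#}) = dd (map_deco h (rep_dd_generator x))"
  by (simp add: dd_map_def free_ext_basis)

lemma map_deco_simps [simp]:
  "deg (map_deco h D) = deg D" "chords (map_deco h D) = chords D" "deco (map_deco h D) = h \<circ> deco D"
  by (simp_all add: map_deco_def)

lemma map_deco_dissection: "dissection_diagram (map_deco h D) \<longleftrightarrow> dissection_diagram D"
  by (simp add: dissection_diagram_def)

text \<open>A translation by \<phi> becomes the translation by
  \<open>h \<circ> \<phi>\<close>.\<close>

lemma map_deco_translation:
  assumes h: "additive h" and "translation_rel D D'"
  shows "translation_rel (map_deco h D) (map_deco h D')"
proof -
  interpret additive h by (rule h)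
  obtain \<phi> where D: "dissection_diagram D" "dissection_diagram D'" "deg D = deg D'" "chords D = chords D'"
    and \<phi>: "\<forall>e\<in>edges (diagram_graph D). deco D' e = deco D e + \<phi> (tgt (diagram_graph D) e) - \<phi> (src (diagram_graph D) e)"
    using assms(2) by (auto simp: translation_rel_def)
  have p: "parent (map_deco h D) = parent D" by (simp add: parent_def fun_eq_iff)
  have g: "edges (diagram_graph (map_deco h D)) = edges (diagram_graph D)"
    "src (diagram_graph (map_deco h D)) = src (diagram_graph D)" "tgt (diagram_graph (map_deco h D)) = tgt (diagram_graph D)"
    unfolding diagram_graph_def p by simp_all
  show ?thesis
    unfolding translation_rel_def map_deco_dissection g
    using D \<phi> by (intro conjI exI[of _ "\<lambda>v. h (\<phi> v)"]) (simp_all add: add diff)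
qed

lemma dd_map_dd:
  assumes h: "additive h" and D: "dissection_diagram D"
  shows "dd_map h (dd D) = dd (map_deco h D)"
proof (cases "deg D = 0")
  case True
  then show ?thesis using alg_hom_one[OF alg_hom_dd_map, of h] by (simp add: dd_def)
next
  case False
  then have "dd (map_deco h D) = dd (map_deco h (rep_dd_generator (abs_dd_generator D)))"
    by (intro dd_cong map_deco_translation[OF h] rep_abs_generator[OF D]) simp
  moreover have "dd_map h (dd D) = dd_map h (basis {#abs_dd_generator D#})" using False by (simp add: dd_def)
  ultimately show ?thesis by (simp only: dd_map_basis)
qed

lemma map_deco_real:
  assumes "additive h"
  shows "map_deco h (real_diag Y H b) = real_diag Y H (h \<circ> b)"
proof -
  interpret additive h by (rule assms)
  show ?thesis by (simp add: real_diag_def map_deco_def fun_eq_iff zero split: edge.split)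
qed

lemma dd_map_gen:
  assumes "additive h" "tree_sys Y H"
  shows "dd_map h (gen Y H b) = gen Y H (h \<circ> b)"
  unfolding gen_def using dd_map_dd[OF assms(1) real_diag_dissection[OF assms(2)]] map_deco_real[OF assms(1)] by metis

lemma dd_map_cop:
  assumes h: "additive h" and "tree_sys Y H"
  shows "tensor_map (dd_map h) (dd_map h) (cop Y H b) = cop Y H (h \<circ> b)"
proof -
  interpret h: additive h by (rule h)
  interpret tree_system Y H using assms(2) by unfold_locales
  note l = alg_hom_lin[OF alg_hom_dd_map]
  have "tensor_map (dd_map h) (dd_map h) (cop_term Y H b C) = cop_term Y H (h \<circ> b) C" if C: "C \<subseteq> H" for C
  proof -
    have "h \<circ> bsum Y C b = bsum Y C (h \<circ> b)" by (simp add: fun_eq_iff bsum_def h.sum)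
    then have "dd_map h (gen (mins Y C) C (bsum Y C b)) = gen (mins Y C) C (bsum Y C (h \<circ> b))"
      using dd_map_gen[OF h mins_tree[OF C]] by simp
    moreover have "dd_map h (\<Prod>\<alpha>\<in>sfaces Y C. gen \<alpha> (sinner H C \<alpha>) b) = (\<Prod>\<alpha>\<in>sfaces Y C. gen \<alpha> (sinner H C \<alpha>) (h \<circ> b))"
      unfolding alg_hom_prod[OF alg_hom_dd_map] by (rule prod.cong[OF refl dd_map_gen[OF h restrict_tree[OF C]]])
    ultimately show ?thesis by (simp add: cop_term_def lin_scale[OF lin_tensor_map] tensor_map_tensor[OF l l])
  qed
  then show ?thesis by (simp add: cop_def lin_sum[OF lin_tensor_map])
qed

lemma dd_map_coproduct:
  fixes h :: "'l::ab_group_add \<Rightarrow> 'm::ab_group_add"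
  assumes h: "additive h"
  shows "dd_coproduct (dd_map h x) = tensor_map (dd_map h) (dd_map h) (dd_coproduct x)"
proof (rule alg_hom_eqI[OF alg_hom_comp[OF alg_hom_coproduct alg_hom_dd_map]
      alg_hom_comp[OF alg_hom_tensor_map[OF alg_hom_dd_map alg_hom_dd_map] alg_hom_coproduct]])
  fix g :: "'l dd_generator"
  let ?D = "rep_dd_generator g"
  have D: "dissection_diagram ?D" by (rule rep_generator)
  obtain b where b: "translation_rel ?D (real_diag {0..deg ?D} (chords ?D) b)"
    "coproduct_formula ?D = cop {0..deg ?D} (chords ?D) b" by (rule dd_gen[OF D])
  have "dd_map h (basis {#g#}) = gen {0..deg ?D} (chords ?D) (h \<circ> b)"
    unfolding dd_map_basis gen_def map_deco_real[OF h, symmetric] by (rule dd_cong[OF map_deco_translation[OF h b(1)]])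
  then show "dd_coproduct (dd_map h (basis {#g#})) = tensor_map (dd_map h) (dd_map h) (dd_coproduct (basis {#g#}))"
    unfolding dd_coproduct_basis b(2) dd_map_cop[OF h dissection_tree[OF D]]
    by (simp only: dd_coproduct_gen[OF dissection_tree[OF D]])
qed

lemma dd_map_eps:
  fixes h :: "'l::ab_group_add \<Rightarrow> 'm::ab_group_add"
  shows "eps (dd_map h x) = eps x"
proof -
  \<comment> \<open>The counit is viewed as an algebra morphism into an auxiliary monoid algebra, so
    that comparison on generators applies.\<close>
  have "qscale (eps (dd_map h x)) (1 :: nat \<Rightarrow>\<^sub>0 rat) = qscale (eps x) 1"
  proof (rule alg_hom_eqI[OF alg_hom_comp[OF alg_hom_eps alg_hom_dd_map] alg_hom_eps])
    fix g :: "'l dd_generator"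
    have "deg (rep_dd_generator g) \<noteq> 0" using rep_generator(2)[of g] by simp
    then show "qscale (eps (dd_map h (basis {#g#}))) (1 :: nat \<Rightarrow>\<^sub>0 rat) = qscale (eps (basis {#g#})) 1"
      unfolding dd_map_basis by (simp add: dd_def lookup_single)
  qed
  then show ?thesis by (rule qscale_one_inject)
qed

text \<open>Both counits must be the constant term by \<open>counit_unique\<close>, so
  \<open>dd_map h\<close> preserves them; \<open>antipode_hom\<close> then handles arbitrary
  antipodes.\<close>

lemma dd_map_hopf_hom:
  fixes h :: "'l::ab_group_add \<Rightarrow> 'm::ab_group_add"
  assumes h: "additive h" and H: "hopf_algebra dd_coproduct \<epsilon> S" and H': "hopf_algebra dd_coproduct \<epsilon>' S'"
  shows "hopf_hom dd_coproduct \<epsilon> S dd_coproduct \<epsilon>' S' (dd_map h)"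
proof -
  have e: "\<epsilon> = eps" by (rule counit_unique[OF H connected_bialgebra.hopf[OF connected_bialgebra_dd]])
  have e': "\<epsilon>' = eps" by (rule counit_unique[OF H' connected_bialgebra.hopf[OF connected_bialgebra_dd]])
  have eq: "\<epsilon>' (dd_map h x) = \<epsilon> x" for x unfolding e e' by (rule dd_map_eps)
  have "S' (dd_map h x) = dd_map h (S x)" for x
    by (rule antipode_hom[OF H H' alg_hom_dd_map dd_map_coproduct[OF h] eq])
  then show ?thesis
    unfolding hopf_hom_def using alg_hom_dd_map dd_map_coproduct[OF h] eq by blast
qed

lemma dd_map_id: "dd_map (id :: 'l::ab_group_add \<Rightarrow> 'l) = id"
proof
  fix x :: "'l dd_algebra"
  have m: "map_deco id D = D" for D :: "'l diagram" by (simp add: map_deco_def)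
  have "dd_map id (basis {#g#}) = basis {#g#}" for g :: "'l dd_generator"
    unfolding dd_map_basis m by (rule dd_rep)
  then show "dd_map id x = id x" using alg_hom_eqI[OF alg_hom_dd_map alg_hom_id, of id x] by simp
qed

lemma dd_map_comp:
  assumes h: "additive h" and g: "additive g"
  shows "dd_map (g \<circ> h) = dd_map g \<circ> dd_map h"
proof
  fix x
  have "dd_map (g \<circ> h) x = dd_map g (dd_map h x)"
  proof (rule alg_hom_eqI[OF alg_hom_dd_map alg_hom_comp[OF alg_hom_dd_map alg_hom_dd_map]])
    fix y
    have "dissection_diagram (map_deco h (rep_dd_generator y))" by (simp add: map_deco_dissection rep_generator)
    moreover have "map_deco (g \<circ> h) D = map_deco g (map_deco h D)" for D by (simp add: map_deco_def comp_assoc)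
    ultimately show "dd_map (g \<circ> h) (basis {#y#}) = dd_map g (dd_map h (basis {#y#}))"
      unfolding dd_map_basis by (simp add: dd_map_dd[OF g])
  qed
  then show "dd_map (g \<circ> h) x = (dd_map g \<circ> dd_map h) x" by simp
qed

theorem proposition2p17:
  shows
    "(\<forall>D :: 'l::ab_group_add diagram. dissection_diagram D \<longrightarrow>
        dd_coproduct (dd D) =
          (\<Sum>C\<in>Pow {1..deg D}. qscale ((-1) ^ k_num D C) (q_elem D C \<otimes> r_elem D C))) \<and>
     (\<exists>\<epsilon> S. graded_connected_commutative_hopf_algebra dd_grade
        (dd_coproduct :: 'l dd_algebra \<Rightarrow> _) \<epsilon> S) \<and>
     (\<forall>h :: 'l \<Rightarrow> 'm::ab_group_add. additive h \<longrightarrow>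
        (\<forall>D. dissection_diagram D \<longrightarrow> dd_map h (dd D) = dd (map_deco h D)) \<and>
        (\<forall>\<epsilon> S \<epsilon>' S'. hopf_algebra dd_coproduct \<epsilon> S \<longrightarrow> hopf_algebra dd_coproduct \<epsilon>' S' \<longrightarrow>
           hopf_hom dd_coproduct \<epsilon> S dd_coproduct \<epsilon>' S' (dd_map h))) \<and>
     dd_map (id :: 'l \<Rightarrow> 'l) = id \<and>
     (\<forall>(h :: 'l \<Rightarrow> 'm) (g :: 'm \<Rightarrow> 'n::ab_group_add). additive h \<longrightarrow> additive g \<longrightarrow>
        dd_map (g \<circ> h) = dd_map g \<circ> dd_map h)"
proof (intro conjI allI impI)
  show "dd_coproduct (dd D) = (\<Sum>C\<in>Pow {1..deg D}. qscale ((-1) ^ k_num D C) (q_elem D C \<otimes> r_elem D C))"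
    if "dissection_diagram D" for D :: "'l diagram"
    using dd_coproduct_dd[OF that] by (simp only: coproduct_formula_def)
  have "(dd_grade :: nat \<Rightarrow> 'l dd_algebra set) = connected_bialgebra.grade mdeg"
    by (simp add: fun_eq_iff dd_grade_def connected_bialgebra.grade_def[OF connected_bialgebra_dd] mdeg_def)
  then show "\<exists>\<epsilon> S. graded_connected_commutative_hopf_algebra dd_grade (dd_coproduct :: 'l dd_algebra \<Rightarrow> _) \<epsilon> S"
    using connected_bialgebra.graded_connected_commutative_hopf[OF connected_bialgebra_dd] by metis
qed (simp_all add: dd_map_dd dd_map_hopf_hom dd_map_id dd_map_comp)

end
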